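(* Let the sets $\det_{X,Y}$ be topologized as part of an admissible system of determinant line bundles. Suppose $X,Y$ are Banach spaces and $(D_t)_{t\in[0,1]}$ is a continuous path in $\mathcal F(X,Y)$ so that $D_t$ is an isomorphism except for finitely many values of $t$ in $(0,1)$. If all degenerations of the path $(D_t)_{t\in[0,1]}$ are transverse, then the canonical orientations of $\lambda(D_0)$ and $\lambda(D_1)$ extend continuously to orientations of the lines $\lambda(D_t)$ over $[0,1]$ if and only if the number of the degenerations is even.
   Context: **Transverse degenerations and canonical orientations.** If $D\in\mathcal F(X,Y)$ is an isomorphism, the canonical orientation of $\lambda(D)=\mathbb R\otimes\mathbb R^*$ is the one determined by $1\otimes1^*$. A degeneration of the path is a value $t_0$ for which $D_{t_0}$ is not an isomorphism. It is transverse if $\dim\mathfrak c(D_{t_0})=1$ (hence $\dim\kappa(D_{t_0})=1$) and the following holds. Choose a nonzero $x_0\in\kappa(D_{t_0})$, $y_0\in Y-\mathrm{Im}\,D_{t_0}$, and a closed linear subspace $\dot X\subset X$ such that $D_{t_0}\colon\dot X\to\mathrm{Im}\,D_{t_0}$ is an isomorphism. For $t$ near $t_0$, $Y=D_t(\dot X)\oplus\mathbb Ry_0$, and there are continuous maps $B$ and $f$ with values in $\dot X$ and $\mathbb R$ so that $D_tx_0=D_t(B(t))+f(t)y_0$; then $f$ vanishes only at $t_0$ near $t_0$. The requirement is that $f$ changes sign at $t=t_0$ (this is independent of the choices). **Basics.** All vector spaces are real. For a finite-dimensional $V$, $\lambda(V)=\Lambda^{\dim V}V$ and $\lambda^*(V)=(\lambda(V))^*$,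 viewed as $\mathbb Z_2$-graded lines of degree $\dim V$ mod 2; an isomorphism $\phi$ induces $\lambda(\phi)$. Degrees add under $\otimes$, and $R\colon L_1\otimes L_2\to L_2\otimes L_1$ is $R(v_1\otimes v_2)=(-1)^{(\deg L_1)(\deg L_2)}v_2\otimes v_1$. For $0\ne v\in L$ ($L$ a line), $v^*\in L^*$ is defined by $v^*(v)=1$; $1\in\lambda(\{0\})=\mathbb R$. For Banach spaces $X,Y$, $\mathcal B(X,Y)$ is the space of bounded operators with the norm topology and $\mathcal F(X,Y)\subset\mathcal B(X,Y)$ the open subspace of Fredholm operators. For $D\in\mathcal F(X,Y)$, $\kappa(D)=\ker D$, $\mathfrak c(D)=Y/\mathrm{Im}\,D$, $\lambda(D)=\lambda(\kappa(D))\otimes\lambda^*(\mathfrak c(D))$, of degree $\mathrm{ind}\,D$ mod 2; $\det_{X,Y}=\bigsqcup_{D\in\mathcal F(X,Y)}\lambda(D)$. A quasi-isomorphism $(\phi,\psi)\colon D\to D'$ between Fredholm operators is a pair of (bounded) homomorphisms of domains and targets with $D'\phi=\psi D$ inducing isomorphisms $\phi_\kappa\colon\kappa(D)\to\kappa(D')$, $\psi_{\mathfrak c}\colon\mathfrak c(D)\to\mathfrak c(D')$; it induces $\widetilde{\mathcal I}_{\phi,\psi;D}\colon\lambda(D)\to\lambda(D')$, $x\otimes\alpha\mapsto(\lambda(\phi_\kappa)x)\otimes(\alpha\circ\lambda(\psi_{\mathfrak c}^{-1}))$. **Exact triples.** An exact triple $\mathfrak t$ of Fredholm operators, $0\to D'\to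 D\to D''\to0$, consists of short exact sequences of Banach spaces $0\to X'\xrightarrow{\mathfrak i_X}X\xrightarrow{\mathfrak j_X}X''\to0$, $0\to Y'\xrightarrow{\mathfrak i_Y}Y\xrightarrow{\mathfrak j_Y}Y''\to0$ and Fredholm operators $D'\colon X'\to Y'$, $D\colon X\to Y$, $D''\colon X''\to Y''$ with $D\mathfrak i_X=\mathfrak i_YD'$, $D''\mathfrak j_X=\mathfrak j_YD$. $\mathcal T(X,Y;X',Y';X'',Y'')$ is the space of such tuples $(D,D',D'',\mathfrak i_X,\mathfrak j_X,\mathfrak i_Y,\mathfrak j_Y)$ with the subspace topology; $\pi_C,\pi_L,\pi_R$ send $\mathfrak t$ to $D,D',D''$. A quasi-isomorphism between exact triples $0\to D'_T\to D_T\to D''_T\to0$ and $0\to D'_B\to D_B\to D''_B\to0$ consists of quasi-isomorphisms $(\phi',\psi'),(\phi,\psi),(\phi'',\psi'')$ from $D_T',D_T,D_T''$ to $D_B',D_B,D_B''$ such that $(\phi',\phi,\phi'')$ and $(\psi',\psi,\psi'')$ are homomorphisms of the short exact sequences of domains and of targets. **Admissible system.** This is a collection of topologies making each $\det_{X,Y}$ a line bundle over $\mathcal F(X,Y)$ and of continuous line bundle isomorphisms $\Psi\colon\pi_L^*\det_{X',Y'}\otimes\pi_R^*\det_{X'',Y''}\to\pi_C^*\det_{X,Y}$ over $\mathcal T(X,Y;X',Y';X'',Y'')$, with restrictions $\Psi_{\mathfrak t}\colon\lambda(D')\otimes\lambda(D'')\to\lambda(D)$, for all Banach spaces, with the properties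 below. Notation: $\widetilde\oplus_{D',D''}=\Psi_{\mathfrak t}$ for $0\to D'\to D'\oplus D''\to D''\to0$ with the standard inclusions and projections; $R_{X',X''}\colon X'\oplus X''\to X''\oplus X'$ interchanges components; $\lambda(D\oplus\mathrm{id}_Z)=\lambda(D)$ via the projections dropping $Z$; for $D_1\in\mathcal F(X_1,X_2)$, $D_2\in\mathcal F(X_2,X_3)$, $\widetilde{\mathcal C}_{D_1,D_2}\colon\lambda(D_1)\otimes\lambda(D_2)\to\lambda(D_2D_1\oplus\mathrm{id}_{X_2})=\lambda(D_2D_1)$ is $\Psi_{\mathfrak t}$ for $0\to D_1\to D_2D_1\oplus\mathrm{id}_{X_2}\to D_2\to0$ with $\mathfrak i_X(x_1)=(x_1,D_1x_1)$, $\mathfrak j_X(x_1,x_2)=D_1x_1-x_2$, $\mathfrak i_Y(x_2)=(D_2x_2,x_2)$, $\mathfrak j_Y(x_3,x_2)=x_3-D_2x_2$; for $\mathfrak t_1\colon0\to D_1'\to D_1\to D_1''\to0$ and $\mathfrak t_2\colon0\to D_2'\to D_2\to D_2''\to0$ with the target sequence of $\mathfrak t_1$ equal to the domain sequence of $\mathfrak t_2$, $\mathcal C_{\mathcal T}(\mathfrak t_1,\mathfrak t_2)$ is $0\to D_2'D_1'\to D_2D_1\to D_2''D_1''\to0$. A complex vector space with $\mathbb C$-basis $e_1,\dots,e_n$ is oriented by $e_1,ie_1,\dots,e_n,ie_n$; for $\mathbb C$-linear Fredholm $D$ between Banach spaces with complex structures, this gives the complex orientation of $\lambda(D)$. Properties: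 - *Naturality I*: for isomorphisms $\phi\colon X\to X'$, $\psi\colon Y\to Y'$, the map $\det_{X,Y}\to\mathcal I_{\phi,\psi}^*\det_{X',Y'}$ given by $\widetilde{\mathcal I}_{\phi,\psi;D}$, $\mathcal I_{\phi,\psi}(D)=\psi D\phi^{-1}$, is continuous. - *Complex Orientations*: the complex orientations are continuous on $\det_{X,Y}$ restricted to the space of $\mathbb C$-linear Fredholm operators. - *Normalization I*: with $\mathcal F^*(X,Y)\subset\mathcal F(X,Y)$ the open subspace of surjective operators, the topology of $\det_{X,Y}|_{\mathcal F^*(X,Y)}$ is that of the top exterior power of the vector bundle $\{(D,x)\in\mathcal F^*(X,Y)\times X\colon Dx=0\}$. - *Naturality II*: for every quasi-isomorphism of exact triples, $\widetilde{\mathcal I}_{\phi,\psi;D_T}\circ\Psi_T=\Psi_B\circ(\widetilde{\mathcal I}_{\phi',\psi';D_T'}\otimes\widetilde{\mathcal I}_{\phi'',\psi'';D_T''})$, where $\Psi_T,\Psi_B$ are the isomorphisms of the two triples. - *Normalization II*: if $D',D''$ are surjective, $\Psi_{\mathfrak t}$ is the isomorphism $\wedge_{\kappa(D)}$ of $0\to\kappa(D')\to\kappa(D)\to\kappa(D'')\to0$, where for $0\to V'\xrightarrow{\mathfrak i}V\xrightarrow{\mathfrak j}V''\to0$, $\wedge_V(v_1'\wedge\dots\wedge v_k'\otimes\mathfrak j(v_1)\wedge\dots\wedge\mathfrak j(v_\ell))=\mathfrak i(v_1')\wedge\dots\wedge\mathfrak i(v_k')\wedge v_1\wedge\dots\wedge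 v_\ell$ ($k=\dim V'$, $\ell=\dim V''$). - *Normalization III*: if $D'$ is an isomorphism, $\Psi_{\mathfrak t}((1\otimes1^* )\otimes\sigma'')=\widetilde{\mathcal I}_{\mathfrak j_X,\mathfrak j_Y;D}^{-1}(\sigma'')$; if $D''$ is an isomorphism, $\Psi_{\mathfrak t}(\sigma'\otimes(1\otimes1^* ))=\widetilde{\mathcal I}_{\mathfrak i_X,\mathfrak i_Y;D'}(\sigma')$. - *Direct Sums I*: $\widetilde{\mathcal I}_{R_{X',X''},R_{Y',Y''};D'\oplus D''}\circ\widetilde\oplus_{D',D''}=\widetilde\oplus_{D'',D'}\circ R$. - *Direct Sums II*: $\widetilde\oplus_{D',D''\oplus D'''}\circ(\mathrm{id}\otimes\widetilde\oplus_{D'',D'''})=\widetilde\oplus_{D'\oplus D'',D'''}\circ(\widetilde\oplus_{D',D''}\otimes\mathrm{id})$. - *Compositions I*: $\widetilde{\mathcal C}_{D_1,D_3D_2}\circ(\mathrm{id}\otimes\widetilde{\mathcal C}_{D_2,D_3})=\widetilde{\mathcal C}_{D_2D_1,D_3}\circ(\widetilde{\mathcal C}_{D_1,D_2}\otimes\mathrm{id})$. - *Compositions II*: $\widetilde{\mathcal C}_{D_1,D_2}\circ(\Psi_{\mathfrak t_1}\otimes\Psi_{\mathfrak t_2})=\Psi_{\mathcal C_{\mathcal T}(\mathfrak t_1,\mathfrak t_2)}\circ(\widetilde{\mathcal C}_{D_1',D_2'}\otimes\widetilde{\mathcal C}_{D_1'',D_2''})\circ(\mathrm{id}\otimes R\otimes\mathrm{id})$.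 - *Complex Exact Triples*: if all operators and maps of $\mathfrak t$ are $\mathbb C$-linear, $\Psi_{\mathfrak t}$ intertwines the complex orientations. *)

theory Defs
  imports "HOL-Analysis.Analysis"
begin

section \<open>Vector spaces on carrier sets\<close>

text \<open>
  Statements about all Banach spaces at once cannot quantify over types of class
  \<open>banach\<close>, so a vector space is a record with an explicit carrier set.
  Only the restriction of the operations to the carrier is meaningful. Maps between such
  spaces are extensional on the carrier of their domain, so that equality of maps is equality
  of HOL functions.
\<close>

record 'v vspace =
  vcarrier :: "'v set"
  vadd :: "'v \<Rightarrow> 'v \<Rightarrow> 'v" (infixl "\<oplus>\<index>" 65)
  vzero :: 'v ("\<zero>\<index>")
  vscale :: "real \<Rightarrow> 'v \<Rightarrow> 'v" (infixr "\<odot>\<index>" 75)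

record 'v nspace = "'v vspace" +
  vnorm :: "'v \<Rightarrow> real"

definition vminus :: "('v, 'z) vspace_scheme \<Rightarrow> 'v \<Rightarrow> 'v \<Rightarrow> 'v" (infixl "\<ominus>\<index>" 65)
  where "x \<ominus>\<^bsub>V\<^esub> y = x \<oplus>\<^bsub>V\<^esub> ((-1) \<odot>\<^bsub>V\<^esub> y)"

locale vector_space_real =
  fixes V :: "('v, 'z) vspace_scheme" (structure)
  assumes add_closed: "x \<in> vcarrier V \<Longrightarrow> y \<in> vcarrier V \<Longrightarrow> x \<oplus> y \<in> vcarrier V"
    and zero_closed: "\<zero> \<in> vcarrier V"
    and scale_closed: "x \<in> vcarrier V \<Longrightarrow> c \<odot> x \<in> vcarrier V"
    and add_assoc: "x \<in> vcarrier V \<Longrightarrow> y \<in> vcarrier V \<Longrightarrow> z \<in> vcarrier V \<Longrightarrow>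
      (x \<oplus> y) \<oplus> z = x \<oplus> (y \<oplus> z)"
    and add_commute: "x \<in> vcarrier V \<Longrightarrow> y \<in> vcarrier V \<Longrightarrow> x \<oplus> y = y \<oplus> x"
    and add_zero: "x \<in> vcarrier V \<Longrightarrow> x \<oplus> \<zero> = x"
    and add_neg: "x \<in> vcarrier V \<Longrightarrow> x \<oplus> ((-1) \<odot> x) = \<zero>"
    and scale_add_right: "x \<in> vcarrier V \<Longrightarrow> y \<in> vcarrier V \<Longrightarrow>
      c \<odot> (x \<oplus> y) = (c \<odot> x) \<oplus> (c \<odot> y)"
    and scale_add_left: "x \<in> vcarrier V \<Longrightarrow> (c + d) \<odot> x = (c \<odot> x) \<oplus> (d \<odot> x)"
    and scale_scale: "x \<in> vcarrier V \<Longrightarrow> c \<odot> (d \<odot> x) = (c * d) \<odot> x"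
    and scale_one: "x \<in> vcarrier V \<Longrightarrow> 1 \<odot> x = x"

text \<open>Outside the carrier, \<open>norm_dist\<close> and \<open>op_dist\<close> below are \<open>0\<close>, because \<open>Metric_space\<close>
  requires symmetry and nonnegativity for all elements of the type.\<close>

definition norm_dist :: "('v, 'z) nspace_scheme \<Rightarrow> 'v \<Rightarrow> 'v \<Rightarrow> real"
  where "norm_dist X x y =
    (if x \<in> vcarrier X \<and> y \<in> vcarrier X then vnorm X (x \<ominus>\<^bsub>X\<^esub> y) else 0)"

locale banach_space = vector_space_real V for V :: "('v, 'z) nspace_scheme" (structure) +
  assumes norm_eq_zero: "x \<in> vcarrier V \<Longrightarrow> vnorm V x = 0 \<longleftrightarrow> x = \<zero>"
    and norm_triangle: "x \<in> vcarrier V \<Longrightarrow> y \<in> vcarrier V \<Longrightarrow>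
      vnorm V (x \<oplus> y) \<le> vnorm V x + vnorm V y"
    and norm_scale: "x \<in> vcarrier V \<Longrightarrow> vnorm V (c \<odot> x) = \<bar>c\<bar> * vnorm V x"
    and complete: "Metric_space.mcomplete (vcarrier V) (norm_dist V)"

definition norm_top :: "('v, 'z) nspace_scheme \<Rightarrow> 'v topology"
  where "norm_top X = Metric_space.mtopology (vcarrier X) (norm_dist X)"

definition subspace_of :: "'v set \<Rightarrow> ('v, 'z) vspace_scheme \<Rightarrow> bool"
  where "subspace_of S V \<longleftrightarrow> S \<subseteq> vcarrier V \<and> \<zero>\<^bsub>V\<^esub> \<in> S \<and>
    (\<forall>x\<in>S. \<forall>y\<in>S. x \<oplus>\<^bsub>V\<^esub> y \<in> S) \<and> (\<forall>c. \<forall>x\<in>S. c \<odot>\<^bsub>V\<^esub> x \<in> S)"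

definition lincomb :: "('v, 'z) vspace_scheme \<Rightarrow> real list \<Rightarrow> 'v list \<Rightarrow> 'v"
  where "lincomb V cs vs = foldr (\<lambda>(c, v) s. (c \<odot>\<^bsub>V\<^esub> v) \<oplus>\<^bsub>V\<^esub> s) (zip cs vs) \<zero>\<^bsub>V\<^esub>"

definition is_basis :: "('v, 'z) vspace_scheme \<Rightarrow> 'v list \<Rightarrow> bool"
  where "is_basis V vs \<longleftrightarrow> set vs \<subseteq> vcarrier V \<and>
    (\<forall>v\<in>vcarrier V. \<exists>!cs. length cs = length vs \<and> lincomb V cs vs = v)"

definition fin_dim :: "('v, 'z) vspace_scheme \<Rightarrow> bool"
  where "fin_dim V \<longleftrightarrow> (\<exists>vs. is_basis V vs)"

definition vdim :: "('v, 'z) vspace_scheme \<Rightarrow> nat"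
  where "vdim V = (THE n. \<exists>vs. is_basis V vs \<and> length vs = n)"

definition linear_on :: "('v, 'z) vspace_scheme \<Rightarrow> ('w, 'y) vspace_scheme \<Rightarrow> ('v \<Rightarrow> 'w) \<Rightarrow> bool"
  where "linear_on V W f \<longleftrightarrow>
    (\<forall>x\<in>vcarrier V. \<forall>y\<in>vcarrier V. f (x \<oplus>\<^bsub>V\<^esub> y) = f x \<oplus>\<^bsub>W\<^esub> f y) \<and>
    (\<forall>c. \<forall>x\<in>vcarrier V. f (c \<odot>\<^bsub>V\<^esub> x) = c \<odot>\<^bsub>W\<^esub> f x)"

definition functional_on :: "('v, 'z) vspace_scheme \<Rightarrow> ('v \<Rightarrow> real) \<Rightarrow> bool"
  where "functional_on V f \<longleftrightarrow>
    (\<forall>x\<in>vcarrier V. \<forall>y\<in>vcarrier V. f (x \<oplus>\<^bsub>V\<^esub> y) = f x + f y) \<and>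
    (\<forall>c. \<forall>x\<in>vcarrier V. f (c \<odot>\<^bsub>V\<^esub> x) = c * f x)"


section \<open>Duals, tensor products and top exterior powers\<close>

definition fun_space :: "'x set \<Rightarrow> ('x \<Rightarrow> real) set \<Rightarrow> ('x \<Rightarrow> real) vspace"
  where "fun_space A F = \<lparr>vcarrier = F,
    vadd = (\<lambda>f g. \<lambda>x\<in>A. f x + g x),
    vzero = (\<lambda>x\<in>A. 0),
    vscale = (\<lambda>c f. \<lambda>x\<in>A. c * f x)\<rparr>"

definition dual :: "('v, 'z) vspace_scheme \<Rightarrow> ('v \<Rightarrow> real) vspace"
  where "dual V = fun_space (vcarrier V) {f \<in> extensional (vcarrier V). functional_on V f}"

text \<open>For \<open>v \<noteq> 0\<close> in a line \<open>L\<close>: the element \<open>v\<^sup>*\<close> of the dual line with value \<open>1\<close> on \<open>v\<close>.\<close>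

definition dual_elt :: "('v, 'z) vspace_scheme \<Rightarrow> 'v \<Rightarrow> 'v \<Rightarrow> real"
  where "dual_elt L v = (THE f. f \<in> vcarrier (dual L) \<and> f v = 1)"

text \<open>For finite-dimensional spaces, \<open>U \<otimes> W\<close> is the dual of the space of bilinear forms on
  \<open>U \<times> W\<close>, with \<open>u \<otimes> w\<close> the evaluation at \<open>(u, w)\<close>. Likewise \<open>\<Lambda>\<^sup>n V\<close> is
  the dual of the space of alternating \<open>n\<close>-forms, with \<open>v\<^sub>1 \<and> \<dots> \<and> v\<^sub>n\<close> the evaluation
  at \<open>(v\<^sub>1, \<dots>, v\<^sub>n)\<close>; for \<open>n = 0\<close> this is the dual of the space of constants, with
  the empty wedge product playing the role of \<open>1\<close>.\<close>

definition bilinear_forms ::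
  "('u, 'y) vspace_scheme \<Rightarrow> ('w, 'z) vspace_scheme \<Rightarrow> ('u \<times> 'w \<Rightarrow> real) set"
  where "bilinear_forms U W = {\<beta> \<in> extensional (vcarrier U \<times> vcarrier W).
    (\<forall>w\<in>vcarrier W. functional_on U (\<lambda>u. \<beta> (u, w))) \<and>
    (\<forall>u\<in>vcarrier U. functional_on W (\<lambda>w. \<beta> (u, w)))}"

definition tensor ::
  "('u, 'y) vspace_scheme \<Rightarrow> ('w, 'z) vspace_scheme \<Rightarrow> (('u \<times> 'w \<Rightarrow> real) \<Rightarrow> real) vspace"
  where "tensor U W = dual (fun_space (vcarrier U \<times> vcarrier W) (bilinear_forms U W))"

definition tens ::
  "('u, 'y) vspace_scheme \<Rightarrow> ('w, 'z) vspace_scheme \<Rightarrow> 'u \<Rightarrow> 'w \<Rightarrow> ('u \<times> 'w \<Rightarrow> real) \<Rightarrow> real"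
  where "tens U W u w = (\<lambda>\<beta>\<in>bilinear_forms U W. \<beta> (u, w))"

text \<open>\<open>tensor_map\<close> is \<open>f \<otimes> g : U \<otimes> W \<rightarrow> U' \<otimes> W'\<close>, and \<open>tensor_flip\<close> is
  \<open>u \<otimes> w \<mapsto> w \<otimes> u\<close>.\<close>

definition tensor_map ::
  "('u, 'y) vspace_scheme \<Rightarrow> ('w, 'z) vspace_scheme \<Rightarrow>
   ('u1, 'y1) vspace_scheme \<Rightarrow> ('w1, 'z1) vspace_scheme \<Rightarrow>
   ('u \<Rightarrow> 'u1) \<Rightarrow> ('w \<Rightarrow> 'w1) \<Rightarrow>
   (('u \<times> 'w \<Rightarrow> real) \<Rightarrow> real) \<Rightarrow> (('u1 \<times> 'w1 \<Rightarrow> real) \<Rightarrow> real)"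
  where "tensor_map U W U' W' f g \<xi> =
    (\<lambda>\<beta>\<in>bilinear_forms U' W'. \<xi> (\<lambda>(u, w)\<in>vcarrier U \<times> vcarrier W. \<beta> (f u, g w)))"

definition tensor_flip ::
  "('u, 'y) vspace_scheme \<Rightarrow> ('w, 'z) vspace_scheme \<Rightarrow>
   (('u \<times> 'w \<Rightarrow> real) \<Rightarrow> real) \<Rightarrow> (('w \<times> 'u \<Rightarrow> real) \<Rightarrow> real)"
  where "tensor_flip U W \<xi> =
    (\<lambda>\<beta>\<in>bilinear_forms W U. \<xi> (\<lambda>(u, w)\<in>vcarrier U \<times> vcarrier W. \<beta> (w, u)))"

definition tuples :: "nat \<Rightarrow> 'v set \<Rightarrow> 'v list set"
  where "tuples n A = {xs. length xs = n \<and> set xs \<subseteq> A}"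

definition alt_forms :: "nat \<Rightarrow> ('v, 'z) vspace_scheme \<Rightarrow> ('v list \<Rightarrow> real) set"
  where "alt_forms n V = {\<omega> \<in> extensional (tuples n (vcarrier V)).
    (\<forall>xs\<in>tuples n (vcarrier V). \<forall>i<n. functional_on V (\<lambda>x. \<omega> (xs[i := x]))) \<and>
    (\<forall>xs\<in>tuples n (vcarrier V). \<not> distinct xs \<longrightarrow> \<omega> xs = 0)}"

type_synonym 'v ext = "('v list \<Rightarrow> real) \<Rightarrow> real"

definition ext_power :: "nat \<Rightarrow> ('v, 'z) vspace_scheme \<Rightarrow> 'v ext vspace"
  where "ext_power n V = dual (fun_space (tuples n (vcarrier V)) (alt_forms n V))"

definition top_ext :: "('v, 'z) vspace_scheme \<Rightarrow> 'v ext vspace"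
  where "top_ext V = ext_power (vdim V) V"

definition wedge :: "('v, 'z) vspace_scheme \<Rightarrow> 'v list \<Rightarrow> 'v ext"
  where "wedge V vs = (\<lambda>\<omega>\<in>alt_forms (vdim V) V. \<omega> vs)"

text \<open>The map \<open>v\<^sub>1 \<and> \<dots> \<and> v\<^sub>n \<mapsto> \<phi> v\<^sub>1 \<and> \<dots> \<and> \<phi> v\<^sub>n\<close>
  on top exterior powers induced by an isomorphism \<open>\<phi> : V \<rightarrow> W\<close>.\<close>

definition top_ext_map ::
  "('v, 'z) vspace_scheme \<Rightarrow> ('w, 'y) vspace_scheme \<Rightarrow> ('v \<Rightarrow> 'w) \<Rightarrow> 'v ext \<Rightarrow> 'w ext"
  where "top_ext_map V W \<phi> \<xi> =
    (\<lambda>\<omega>\<in>alt_forms (vdim W) W. \<xi> (\<lambda>vs\<in>tuples (vdim V) (vcarrier V). \<omega> (map \<phi> vs)))"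


section \<open>Operators between Banach spaces\<close>

definition bounded_ops :: "('v, 'z) nspace_scheme \<Rightarrow> ('w, 'y) nspace_scheme \<Rightarrow> ('v \<Rightarrow> 'w) set"
  where "bounded_ops X Y = {f \<in> vcarrier X \<rightarrow>\<^sub>E vcarrier Y. linear_on X Y f \<and>
    (\<exists>K. \<forall>x\<in>vcarrier X. vnorm Y (f x) \<le> K * vnorm X x)}"

definition op_dist ::
  "('v, 'z) nspace_scheme \<Rightarrow> ('w, 'y) nspace_scheme \<Rightarrow> ('v \<Rightarrow> 'w) \<Rightarrow> ('v \<Rightarrow> 'w) \<Rightarrow> real"
  where "op_dist X Y f g =
    (if f \<in> bounded_ops X Y \<and> g \<in> bounded_ops X Y
     then SUP x\<in>vcarrier X. vnorm Y (f x \<ominus>\<^bsub>Y\<^esub> g x) / vnorm X x else 0)"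

definition op_top :: "('v, 'z) nspace_scheme \<Rightarrow> ('w, 'y) nspace_scheme \<Rightarrow> ('v \<Rightarrow> 'w) topology"
  where "op_top X Y = Metric_space.mtopology (bounded_ops X Y) (op_dist X Y)"

definition is_iso :: "('v, 'z) nspace_scheme \<Rightarrow> ('w, 'y) nspace_scheme \<Rightarrow> ('v \<Rightarrow> 'w) \<Rightarrow> bool"
  where "is_iso X Y f \<longleftrightarrow> f \<in> bounded_ops X Y \<and>
    (\<exists>g\<in>bounded_ops Y X. (\<forall>x\<in>vcarrier X. g (f x) = x) \<and> (\<forall>y\<in>vcarrier Y. f (g y) = y))"

datatype 'v oper = Oper (dom: "'v nspace") (cod: "'v nspace") (fn: "'v \<Rightarrow> 'v")

definition iso_op :: "'v oper \<Rightarrow> bool"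
  where "iso_op P \<longleftrightarrow> is_iso (dom P) (cod P) (fn P)"

definition ker :: "'v oper \<Rightarrow> 'v nspace"
  where "ker P = (dom P)\<lparr>vcarrier := {x \<in> vcarrier (dom P). fn P x = \<zero>\<^bsub>cod P\<^esub>}\<rparr>"

definition coker :: "'v oper \<Rightarrow> 'v set vspace"
  where "coker P = \<lparr>vcarrier = {{y \<oplus>\<^bsub>cod P\<^esub> fn P x |x. x \<in> vcarrier (dom P)} |y. y \<in> vcarrier (cod P)},
    vadd = (\<lambda>A B. {a \<oplus>\<^bsub>cod P\<^esub> b |a b. a \<in> A \<and> b \<in> B}),
    vzero = fn P ` vcarrier (dom P),
    vscale = (\<lambda>c A. {(c \<odot>\<^bsub>cod P\<^esub> a) \<oplus>\<^bsub>cod P\<^esub> fn P x |a x. a \<in> A \<and> x \<in> vcarrier (dom P)})\<rparr>"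

text \<open>The image of a Fredholm operator is automatically closed.\<close>

definition fredholm :: "'v oper \<Rightarrow> bool"
  where "fredholm P \<longleftrightarrow> banach_space (dom P) \<and> banach_space (cod P) \<and>
    fn P \<in> bounded_ops (dom P) (cod P) \<and> fin_dim (ker P) \<and> fin_dim (coker P)"

definition fredholm_ops :: "'v nspace \<Rightarrow> 'v nspace \<Rightarrow> ('v \<Rightarrow> 'v) set"
  where "fredholm_ops X Y = {D. fredholm (Oper X Y D)}"

definition fredholm_top :: "'v nspace \<Rightarrow> 'v nspace \<Rightarrow> ('v \<Rightarrow> 'v) topology"
  where "fredholm_top X Y = subtopology (op_top X Y) (fredholm_ops X Y)"

definition surj_op :: "'v oper \<Rightarrow> bool"
  where "surj_op P \<longleftrightarrow> fn P ` vcarrier (dom P) = vcarrier (cod P)"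

definition surj_fredholm_ops :: "'v nspace \<Rightarrow> 'v nspace \<Rightarrow> ('v \<Rightarrow> 'v) set"
  where "surj_fredholm_ops X Y = {D \<in> fredholm_ops X Y. surj_op (Oper X Y D)}"

definition index :: "'v oper \<Rightarrow> int"
  where "index P = int (vdim (ker P)) - int (vdim (coker P))"

definition op_id :: "'v nspace \<Rightarrow> 'v oper"
  where "op_id X = Oper X X (\<lambda>x\<in>vcarrier X. x)"

text \<open>\<open>op_comp Q P\<close> is \<open>Q \<circ> P\<close>; it is used for \<open>cod P = dom Q\<close>.\<close>

definition op_comp :: "'v oper \<Rightarrow> 'v oper \<Rightarrow> 'v oper"
  where "op_comp Q P = Oper (dom P) (cod Q) (\<lambda>x\<in>vcarrier (dom P). fn Q (fn P x))"


section \<open>The determinant line of a Fredholm operator\<close>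

type_synonym 'v det_elt = "('v ext \<times> ('v set ext \<Rightarrow> real) \<Rightarrow> real) \<Rightarrow> real"
type_synonym 'v det2_elt = "('v det_elt \<times> 'v det_elt \<Rightarrow> real) \<Rightarrow> real"

definition det_line :: "'v oper \<Rightarrow> 'v det_elt vspace"
  where "det_line P = tensor (top_ext (ker P)) (dual (top_ext (coker P)))"

text \<open>\<open>det_vec P vs ws\<close> is
  \<open>(v\<^sub>1 \<and> \<dots> \<and> v\<^sub>k) \<otimes> (w\<^sub>1 \<and> \<dots> \<and> w\<^sub>l)\<^sup>*\<close>. In particular,
  \<open>det_vec P [] []\<close> is \<open>1 \<otimes> 1\<^sup>*\<close> if \<open>P\<close> is an isomorphism.\<close>

definition det_vec :: "'v oper \<Rightarrow> 'v list \<Rightarrow> 'v set list \<Rightarrow> 'v det_elt"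
  where "det_vec P vs ws = tens (top_ext (ker P)) (dual (top_ext (coker P)))
    (wedge (ker P) vs) (dual_elt (top_ext (coker P)) (wedge (coker P) ws))"

definition coker_map :: "'v oper \<Rightarrow> 'v oper \<Rightarrow> ('v \<Rightarrow> 'v) \<Rightarrow> 'v set \<Rightarrow> 'v set"
  where "coker_map P P' \<psi> A = {\<psi> a \<oplus>\<^bsub>cod P'\<^esub> fn P' x |a x. a \<in> A \<and> x \<in> vcarrier (dom P')}"

definition quasi_iso :: "'v oper \<Rightarrow> 'v oper \<Rightarrow> ('v \<Rightarrow> 'v) \<Rightarrow> ('v \<Rightarrow> 'v) \<Rightarrow> bool"
  where "quasi_iso P P' \<phi> \<psi> \<longleftrightarrow>
    \<phi> \<in> bounded_ops (dom P) (dom P') \<and> \<psi> \<in> bounded_ops (cod P) (cod P') \<and>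
    (\<forall>x\<in>vcarrier (dom P). fn P' (\<phi> x) = \<psi> (fn P x)) \<and>
    bij_betw \<phi> (vcarrier (ker P)) (vcarrier (ker P')) \<and>
    bij_betw (coker_map P P' \<psi>) (vcarrier (coker P)) (vcarrier (coker P'))"

definition det_map :: "'v oper \<Rightarrow> 'v oper \<Rightarrow> ('v \<Rightarrow> 'v) \<Rightarrow> ('v \<Rightarrow> 'v) \<Rightarrow> 'v det_elt \<Rightarrow> 'v det_elt"
  where "det_map P P' \<phi> \<psi> =
    tensor_map (top_ext (ker P)) (dual (top_ext (coker P)))
      (top_ext (ker P')) (dual (top_ext (coker P')))
      (top_ext_map (ker P) (ker P') \<phi>)
      (\<lambda>\<alpha>. \<lambda>\<eta>\<in>vcarrier (top_ext (coker P')).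
        \<alpha> (top_ext_map (coker P') (coker P) (inv_into (vcarrier (coker P)) (coker_map P P' \<psi>)) \<eta>))"

definition det_tensor :: "'v oper \<Rightarrow> 'v oper \<Rightarrow> 'v det2_elt vspace"
  where "det_tensor P Q = tensor (det_line P) (det_line Q)"

definition det_tens :: "'v oper \<Rightarrow> 'v oper \<Rightarrow> 'v det_elt \<Rightarrow> 'v det_elt \<Rightarrow> 'v det2_elt"
  where "det_tens P Q \<sigma> \<rho> = tens (det_line P) (det_line Q) \<sigma> \<rho>"

text \<open>The map \<open>R\<close>, and the sign in it.\<close>

definition koszul_sign :: "'v oper \<Rightarrow> 'v oper \<Rightarrow> real"
  where "koszul_sign P Q = (if odd (index P) \<and> odd (index Q) then -1 else 1)"

definition det_swap :: "'v oper \<Rightarrow> 'v oper \<Rightarrow> 'v det2_elt \<Rightarrow> 'v det2_elt"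
  where "det_swap P Q \<xi> =
    koszul_sign P Q \<odot>\<^bsub>det_tensor Q P\<^esub> tensor_flip (det_line P) (det_line Q) \<xi>"


section \<open>Orientations and line bundles\<close>

definition ray :: "('e, 'z) vspace_scheme \<Rightarrow> 'e \<Rightarrow> 'e set"
  where "ray L v = {c \<odot>\<^bsub>L\<^esub> v |c. c > 0}"

definition orientation :: "('e, 'z) vspace_scheme \<Rightarrow> 'e set \<Rightarrow> bool"
  where "orientation L os \<longleftrightarrow> (\<exists>v\<in>vcarrier L. v \<noteq> \<zero>\<^bsub>L\<^esub> \<and> os = ray L v)"

definition canonical_orientation :: "'v oper \<Rightarrow> 'v det_elt set"
  where "canonical_orientation P = ray (det_line P) (det_vec P [] [])"

text \<open>A line bundle over \<open>B\<close> is given by its fibres \<open>L b\<close> and a topology \<open>T\<close> on the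
  disjoint union of the fibres.\<close>

abbreviation total_space :: "'b set \<Rightarrow> ('b \<Rightarrow> 'e vspace) \<Rightarrow> ('b \<times> 'e) set"
  where "total_space A L \<equiv> (SIGMA b:A. vcarrier (L b))"

definition line_bundle :: "'b topology \<Rightarrow> ('b \<Rightarrow> 'e vspace) \<Rightarrow> ('b \<times> 'e) topology \<Rightarrow> bool"
  where "line_bundle B L T \<longleftrightarrow>
    (\<forall>b\<in>topspace B. vector_space_real (L b) \<and> fin_dim (L b) \<and> vdim (L b) = 1) \<and>
    topspace T = total_space (topspace B) L \<and>
    continuous_map T B fst \<and>
    (\<forall>b\<in>topspace B. \<exists>U s. openin B U \<and> b \<in> U \<and> (\<forall>u\<in>U. s u \<in> vcarrier (L u)) \<and>
      homeomorphic_map (prod_topology (subtopology B U) euclideanreal)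
        (subtopology T (total_space U L))
        (\<lambda>(u, c). (u, c \<odot>\<^bsub>L u\<^esub> s u)))"

text \<open>A continuous orientation of the pullback by \<open>f\<close> of a line bundle with total topology \<open>T\<close>
  and fibres \<open>L b\<close> over \<open>f b\<close>.\<close>

definition continuous_orientation ::
  "'b topology \<Rightarrow> ('b \<Rightarrow> 'c) \<Rightarrow> ('c \<times> 'e) topology \<Rightarrow> ('b \<Rightarrow> 'e vspace) \<Rightarrow> ('b \<Rightarrow> 'e set) \<Rightarrow> bool"
  where "continuous_orientation B f T L os \<longleftrightarrow>
    (\<forall>b\<in>topspace B. orientation (L b) (os b)) \<and>
    (\<forall>b\<in>topspace B. \<exists>U s. openin B U \<and> b \<in> U \<and>
      continuous_map (subtopology B U) T (\<lambda>u. (f u, s u)) \<and> (\<forall>u\<in>U. s u \<in> os u))"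

definition final_topology :: "'e set \<Rightarrow> ('p topology \<times> ('p \<Rightarrow> 'e)) set \<Rightarrow> 'e topology"
  where "final_topology Z \<F> = topology (\<lambda>W. W \<subseteq> Z \<and>
    (\<forall>(P, q)\<in>\<F>. openin P {p \<in> topspace P. q p \<in> W}))"

lemma istopology_final:
  "istopology (\<lambda>W. W \<subseteq> Z \<and> (\<forall>(P, q)\<in>\<F>. openin P {p \<in> topspace P. q p \<in> W}))"
proof -
  have inter: "{p \<in> topspace P. q p \<in> S \<inter> T} = {p \<in> topspace P. q p \<in> S} \<inter> {p \<in> topspace P. q p \<in> T}"
    for P :: "'p topology" and q :: "'p \<Rightarrow> 'e" and S T by blast
  have union: "{p \<in> topspace P. q p \<in> \<Union>\<K>} = \<Union>((\<lambda>K. {p \<in> topspace P. q p \<in> K}) ` \<K>)"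
    for P :: "'p topology" and q :: "'p \<Rightarrow> 'e" and \<K> by blast
  show ?thesis
    unfolding istopology_def inter union by (auto intro!: openin_Int openin_Union)
qed

text \<open>The pullback of a line bundle by \<open>f\<close>, and the tensor product of two line bundles over
  \<open>B\<close>. In the fibre of a tensor product of lines every element is a pure tensor, and since
  multiplication \<open>\<real> \<times> \<real> \<rightarrow> \<real>\<close> is an open surjection, the topology of the tensor product of line
  bundles is the quotient topology of that on the fibre product.\<close>

definition pullback_bundle_top ::
  "'b topology \<Rightarrow> ('b \<Rightarrow> 'c) \<Rightarrow> ('c \<Rightarrow> 'e vspace) \<Rightarrow> ('c \<times> 'e) topology \<Rightarrow> ('b \<times> 'e) topology"
  where "pullback_bundle_top B f L T =
    pullback_topology (total_space (topspace B) (\<lambda>b. L (f b)))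
      (\<lambda>(b, v). (b, (f b, v))) (prod_topology B T)"

definition tensor_bundle_top ::
  "'b topology \<Rightarrow> ('b \<Rightarrow> 'e vspace) \<Rightarrow> ('b \<times> 'e) topology \<Rightarrow> ('b \<Rightarrow> 'f vspace) \<Rightarrow> ('b \<times> 'f) topology \<Rightarrow>
   ('b \<times> (('e \<times> 'f \<Rightarrow> real) \<Rightarrow> real)) topology"
  where "tensor_bundle_top B L T M S =
    final_topology (total_space (topspace B) (\<lambda>b. tensor (L b) (M b)))
      {(subtopology (prod_topology T S) {((b, u), (b', w)). b = b'},
        \<lambda>((b, u), (b', w)). (b, tens (L b) (M b) u w))}"

text \<open>The top exterior power of the vector bundle \<open>{(D, x). D x = 0}\<close> over the space of surjective
  Fredholm operators: its topology is the one for which the wedge products of the local continuous frames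
  of this bundle give local trivializations.\<close>

definition kernel_frame ::
  "'v nspace \<Rightarrow> 'v nspace \<Rightarrow> ('v \<Rightarrow> 'v) set \<Rightarrow> nat \<Rightarrow> (nat \<Rightarrow> ('v \<Rightarrow> 'v) \<Rightarrow> 'v) \<Rightarrow> bool"
  where "kernel_frame X Y U n e \<longleftrightarrow>
    openin (subtopology (fredholm_top X Y) (surj_fredholm_ops X Y)) U \<and>
    (\<forall>i<n. continuous_map (subtopology (fredholm_top X Y) U) (norm_top X) (e i)) \<and>
    (\<forall>D\<in>U. is_basis (ker (Oper X Y D)) (map (\<lambda>i. e i D) [0..<n]))"

definition kernel_top_ext_top :: "'v nspace \<Rightarrow> 'v nspace \<Rightarrow> (('v \<Rightarrow> 'v) \<times> 'v ext) topology"
  where "kernel_top_ext_top X Y =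
    final_topology (total_space (surj_fredholm_ops X Y) (\<lambda>D. top_ext (ker (Oper X Y D))))
      {(prod_topology (subtopology (fredholm_top X Y) U) euclideanreal,
        \<lambda>(D, c). (D, c \<odot>\<^bsub>top_ext (ker (Oper X Y D))\<^esub>
          wedge (ker (Oper X Y D)) (map (\<lambda>i. e i D) [0..<n]))) |U n e. kernel_frame X Y U n e}"


section \<open>Complex orientations\<close>

definition complex_structure :: "'v nspace \<Rightarrow> ('v \<Rightarrow> 'v) \<Rightarrow> bool"
  where "complex_structure X J \<longleftrightarrow> J \<in> bounded_ops X X \<and>
    (\<forall>x\<in>vcarrier X. J (J x) = (-1) \<odot>\<^bsub>X\<^esub> x)"

definition complex_linear :: "'v nspace \<Rightarrow> ('v \<Rightarrow> 'v) \<Rightarrow> ('v \<Rightarrow> 'v) \<Rightarrow> ('v \<Rightarrow> 'v) \<Rightarrow> bool"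
  where "complex_linear X J K f \<longleftrightarrow> (\<forall>x\<in>vcarrier X. f (J x) = K (f x))"

text \<open>The list \<open>e\<^sub>1, i e\<^sub>1, \<dots>, e\<^sub>n, i e\<^sub>n\<close>. It is a real basis if and only if
  \<open>e\<^sub>1, \<dots>, e\<^sub>n\<close> is a complex basis.\<close>

definition realify :: "('v \<Rightarrow> 'v) \<Rightarrow> 'v list \<Rightarrow> 'v list"
  where "realify J es = concat (map (\<lambda>e. [e, J e]) es)"

definition complex_orientation :: "'v oper \<Rightarrow> ('v \<Rightarrow> 'v) \<Rightarrow> ('v \<Rightarrow> 'v) \<Rightarrow> 'v det_elt set"
  where "complex_orientation P J K =
    \<Union>{ray (det_line P) (det_vec P (realify J es) (realify (coker_map P P K) fs)) |es fs.
        is_basis (ker P) (realify J es) \<and> is_basis (coker P) (realify (coker_map P P K) fs)}"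


section \<open>Direct sums\<close>

text \<open>The binary trees with leaves in \<open>'a\<close> are closed under formal pairing. The Banach spaces whose
  vectors are such trees thus contain a copy of every Banach space carried by a subset of
  \<open>'a\<close>, where \<open>'a\<close> is arbitrary, and they are closed under direct sums.\<close>

datatype 'a tree = Leaf 'a | Pr (lft: "'a tree") (rgt: "'a tree")

definition space_sum :: "'a tree nspace \<Rightarrow> 'a tree nspace \<Rightarrow> 'a tree nspace" (infixr "\<boxplus>" 65)
  where "X \<boxplus> Y = \<lparr>vcarrier = {Pr x y |x y. x \<in> vcarrier X \<and> y \<in> vcarrier Y},
    vadd = (\<lambda>p q. Pr (lft p \<oplus>\<^bsub>X\<^esub> lft q) (rgt p \<oplus>\<^bsub>Y\<^esub> rgt q)),
    vzero = Pr \<zero>\<^bsub>X\<^esub> \<zero>\<^bsub>Y\<^esub>,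
    vscale = (\<lambda>c p. Pr (c \<odot>\<^bsub>X\<^esub> lft p) (c \<odot>\<^bsub>Y\<^esub> rgt p)),
    vnorm = (\<lambda>p. vnorm X (lft p) + vnorm Y (rgt p))\<rparr>"

definition inj1 :: "'a tree nspace \<Rightarrow> 'a tree nspace \<Rightarrow> 'a tree \<Rightarrow> 'a tree"
  where "inj1 X Y = (\<lambda>x\<in>vcarrier X. Pr x \<zero>\<^bsub>Y\<^esub>)"

definition proj1 :: "'a tree nspace \<Rightarrow> 'a tree nspace \<Rightarrow> 'a tree \<Rightarrow> 'a tree"
  where "proj1 X Y = (\<lambda>p\<in>vcarrier (X \<boxplus> Y). lft p)"

definition proj2 :: "'a tree nspace \<Rightarrow> 'a tree nspace \<Rightarrow> 'a tree \<Rightarrow> 'a tree"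
  where "proj2 X Y = (\<lambda>p\<in>vcarrier (X \<boxplus> Y). rgt p)"

definition interchange :: "'a tree nspace \<Rightarrow> 'a tree nspace \<Rightarrow> 'a tree \<Rightarrow> 'a tree"
  where "interchange X Y = (\<lambda>p\<in>vcarrier (X \<boxplus> Y). Pr (rgt p) (lft p))"

definition reassoc :: "'a tree nspace \<Rightarrow> 'a tree nspace \<Rightarrow> 'a tree nspace \<Rightarrow> 'a tree \<Rightarrow> 'a tree"
  where "reassoc X Y Z =
    (\<lambda>p\<in>vcarrier (X \<boxplus> (Y \<boxplus> Z)). Pr (Pr (lft p) (lft (rgt p))) (rgt (rgt p)))"

definition op_sum :: "'a tree oper \<Rightarrow> 'a tree oper \<Rightarrow> 'a tree oper"
  where "op_sum P Q = Oper (dom P \<boxplus> dom Q) (cod P \<boxplus> cod Q)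
    (\<lambda>p\<in>vcarrier (dom P \<boxplus> dom Q). Pr (fn P (lft p)) (fn Q (rgt p)))"


section \<open>Exact triples of Fredholm operators\<close>

definition short_exact ::
  "'v nspace \<Rightarrow> 'v nspace \<Rightarrow> 'v nspace \<Rightarrow> ('v \<Rightarrow> 'v) \<Rightarrow> ('v \<Rightarrow> 'v) \<Rightarrow> bool"
  where "short_exact X' X X'' i j \<longleftrightarrow> i \<in> bounded_ops X' X \<and> j \<in> bounded_ops X X'' \<and>
    inj_on i (vcarrier X') \<and>
    i ` vcarrier X' = {x \<in> vcarrier X. j x = \<zero>\<^bsub>X''\<^esub>} \<and>
    j ` vcarrier X = vcarrier X''"

record 'v triple =
  opL :: "'v oper"
  opC :: "'v oper"
  opR :: "'v oper"
  iX :: "'v \<Rightarrow> 'v"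
  jX :: "'v \<Rightarrow> 'v"
  iY :: "'v \<Rightarrow> 'v"
  jY :: "'v \<Rightarrow> 'v"

definition exact_triple :: "'v triple \<Rightarrow> bool"
  where "exact_triple t \<longleftrightarrow> fredholm (opL t) \<and> fredholm (opC t) \<and> fredholm (opR t) \<and>
    short_exact (dom (opL t)) (dom (opC t)) (dom (opR t)) (iX t) (jX t) \<and>
    short_exact (cod (opL t)) (cod (opC t)) (cod (opR t)) (iY t) (jY t) \<and>
    (\<forall>x\<in>vcarrier (dom (opL t)). fn (opC t) (iX t x) = iY t (fn (opL t) x)) \<and>
    (\<forall>x\<in>vcarrier (dom (opC t)). fn (opR t) (jX t x) = jY t (fn (opC t) x))"

text \<open>The spaces of a triple are part of the record; fixing them leaves the seven maps, which
  determine the topology.\<close>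

definition triple_top ::
  "'v nspace \<Rightarrow> 'v nspace \<Rightarrow> 'v nspace \<Rightarrow> 'v nspace \<Rightarrow> 'v nspace \<Rightarrow> 'v nspace \<Rightarrow> 'v triple topology"
  where "triple_top X Y X' Y' X'' Y'' = pullback_topology
    {t. exact_triple t \<and> dom (opC t) = X \<and> cod (opC t) = Y \<and>
        dom (opL t) = X' \<and> cod (opL t) = Y' \<and> dom (opR t) = X'' \<and> cod (opR t) = Y''}
    (\<lambda>t. (fn (opC t), fn (opL t), fn (opR t), iX t, jX t, iY t, jY t))
    (prod_topology (op_top X Y) (prod_topology (op_top X' Y') (prod_topology (op_top X'' Y'')
      (prod_topology (op_top X' X) (prod_topology (op_top X X'')
        (prod_topology (op_top Y' Y) (op_top Y Y'')))))))"

definition triple_quasi_iso ::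
  "'v triple \<Rightarrow> 'v triple \<Rightarrow> ('v \<Rightarrow> 'v) \<Rightarrow> ('v \<Rightarrow> 'v) \<Rightarrow> ('v \<Rightarrow> 'v) \<Rightarrow>
   ('v \<Rightarrow> 'v) \<Rightarrow> ('v \<Rightarrow> 'v) \<Rightarrow> ('v \<Rightarrow> 'v) \<Rightarrow> bool"
  where "triple_quasi_iso t b \<phi>' \<phi> \<phi>'' \<psi>' \<psi> \<psi>'' \<longleftrightarrow>
    quasi_iso (opL t) (opL b) \<phi>' \<psi>' \<and> quasi_iso (opC t) (opC b) \<phi> \<psi> \<and>
    quasi_iso (opR t) (opR b) \<phi>'' \<psi>'' \<and>
    (\<forall>x\<in>vcarrier (dom (opL t)). \<phi> (iX t x) = iX b (\<phi>' x)) \<and>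
    (\<forall>x\<in>vcarrier (dom (opC t)). \<phi>'' (jX t x) = jX b (\<phi> x)) \<and>
    (\<forall>y\<in>vcarrier (cod (opL t)). \<psi> (iY t y) = iY b (\<psi>' y)) \<and>
    (\<forall>y\<in>vcarrier (cod (opC t)). \<psi>'' (jY t y) = jY b (\<psi> y))"

definition sum_triple :: "'a tree oper \<Rightarrow> 'a tree oper \<Rightarrow> 'a tree triple"
  where "sum_triple P Q = \<lparr>opL = P, opC = op_sum P Q, opR = Q,
    iX = inj1 (dom P) (dom Q), jX = proj2 (dom P) (dom Q),
    iY = inj1 (cod P) (cod Q), jY = proj2 (cod P) (cod Q)\<rparr>"

text \<open>The triple \<open>0 \<rightarrow> P \<rightarrow> Q P \<oplus> id \<rightarrow> Q \<rightarrow> 0\<close> for \<open>cod P = dom Q\<close>.\<close>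

definition comp_triple :: "'a tree oper \<Rightarrow> 'a tree oper \<Rightarrow> 'a tree triple"
  where "comp_triple P Q = \<lparr>opL = P, opC = op_sum (op_comp Q P) (op_id (cod P)), opR = Q,
    iX = (\<lambda>x\<in>vcarrier (dom P). Pr x (fn P x)),
    jX = (\<lambda>p\<in>vcarrier (dom P \<boxplus> cod P). fn P (lft p) \<ominus>\<^bsub>cod P\<^esub> rgt p),
    iY = (\<lambda>y\<in>vcarrier (cod P). Pr (fn Q y) y),
    jY = (\<lambda>p\<in>vcarrier (cod Q \<boxplus> cod P). lft p \<ominus>\<^bsub>cod Q\<^esub> fn Q (rgt p))\<rparr>"

definition triple_comp :: "'v triple \<Rightarrow> 'v triple \<Rightarrow> 'v triple"
  where "triple_comp t1 t2 = \<lparr>opL = op_comp (opL t2) (opL t1), opC = op_comp (opC t2) (opC t1),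
    opR = op_comp (opR t2) (opR t1), iX = iX t1, jX = jX t1, iY = iY t2, jY = jY t2\<rparr>"

text \<open>For a family \<open>\<Psi>\<close> of isomorphisms \<open>\<lambda>(D') \<otimes> \<lambda>(D'') \<rightarrow> \<lambda>(D)\<close> indexed by exact triples:
  the direct sum maps and the composition maps. In the latter, \<open>\<lambda>(Q P \<oplus> id)\<close> is identified with
  \<open>\<lambda>(Q P)\<close> by the projections.\<close>

definition sum_map ::
  "('a tree triple \<Rightarrow> 'a tree det2_elt \<Rightarrow> 'a tree det_elt) \<Rightarrow>
   'a tree oper \<Rightarrow> 'a tree oper \<Rightarrow> 'a tree det2_elt \<Rightarrow> 'a tree det_elt"
  where "sum_map \<Psi> P Q = \<Psi> (sum_triple P Q)"

definition comp_map ::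
  "('a tree triple \<Rightarrow> 'a tree det2_elt \<Rightarrow> 'a tree det_elt) \<Rightarrow>
   'a tree oper \<Rightarrow> 'a tree oper \<Rightarrow> 'a tree det2_elt \<Rightarrow> 'a tree det_elt"
  where "comp_map \<Psi> P Q \<xi> =
    det_map (op_sum (op_comp Q P) (op_id (cod P))) (op_comp Q P)
      (proj1 (dom P) (cod P)) (proj1 (cod Q) (cod P)) (\<Psi> (comp_triple P Q) \<xi>)"


section \<open>Admissible systems\<close>

locale admissible_system =
  fixes det_top :: "'a tree nspace \<Rightarrow> 'a tree nspace \<Rightarrow>
      (('a tree \<Rightarrow> 'a tree) \<times> 'a tree det_elt) topology"
    and \<Psi> :: "'a tree triple \<Rightarrow> 'a tree det2_elt \<Rightarrow> 'a tree det_elt"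
  assumes det_line_bundle:
    "banach_space X \<Longrightarrow> banach_space Y \<Longrightarrow>
      line_bundle (fredholm_top X Y) (\<lambda>D. det_line (Oper X Y D)) (det_top X Y)"
    and Psi_linear:
    "exact_triple t \<Longrightarrow> linear_on (det_tensor (opL t) (opR t)) (det_line (opC t)) (\<Psi> t)"
    and Psi_bundle_iso:
    "banach_space X \<Longrightarrow> banach_space Y \<Longrightarrow> banach_space X' \<Longrightarrow> banach_space Y' \<Longrightarrow>
     banach_space X'' \<Longrightarrow> banach_space Y'' \<Longrightarrow> T = triple_top X Y X' Y' X'' Y'' \<Longrightarrow>
      homeomorphic_map
        (tensor_bundle_top T
          (\<lambda>t. det_line (opL t))
          (pullback_bundle_top T (\<lambda>t. fn (opL t)) (\<lambda>D. det_line (Oper X' Y' D)) (det_top X' Y'))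
          (\<lambda>t. det_line (opR t))
          (pullback_bundle_top T (\<lambda>t. fn (opR t)) (\<lambda>D. det_line (Oper X'' Y'' D)) (det_top X'' Y'')))
        (pullback_bundle_top T (\<lambda>t. fn (opC t)) (\<lambda>D. det_line (Oper X Y D)) (det_top X Y))
        (\<lambda>(t, \<xi>). (t, \<Psi> t \<xi>))"
    and naturality_I:
    "banach_space X \<Longrightarrow> banach_space Y \<Longrightarrow> banach_space X' \<Longrightarrow> banach_space Y' \<Longrightarrow>
     is_iso X X' \<phi> \<Longrightarrow> is_iso Y Y' \<psi> \<Longrightarrow>
     \<I> = (\<lambda>D. \<lambda>x\<in>vcarrier X'. \<psi> (D (inv_into (vcarrier X) \<phi> x))) \<Longrightarrow>
      continuous_map (det_top X Y)
        (pullback_bundle_top (fredholm_top X Y) \<I> (\<lambda>D. det_line (Oper X' Y' D)) (det_top X' Y'))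
        (\<lambda>(D, \<sigma>). (D, det_map (Oper X Y D) (Oper X' Y' (\<I> D)) \<phi> \<psi> \<sigma>))"
    and complex_orientations:
    "banach_space X \<Longrightarrow> banach_space Y \<Longrightarrow> complex_structure X J \<Longrightarrow> complex_structure Y K \<Longrightarrow>
      continuous_orientation (subtopology (fredholm_top X Y) {D. complex_linear X J K D}) (\<lambda>D. D)
        (det_top X Y) (\<lambda>D. det_line (Oper X Y D)) (\<lambda>D. complex_orientation (Oper X Y D) J K)"
    and normalization_I:
    "banach_space X \<Longrightarrow> banach_space Y \<Longrightarrow>
      homeomorphic_map (kernel_top_ext_top X Y)
        (subtopology (det_top X Y)
          (total_space (surj_fredholm_ops X Y) (\<lambda>D. det_line (Oper X Y D))))
        (\<lambda>(D, x). (D, tens (top_ext (ker (Oper X Y D))) (dual (top_ext (coker (Oper X Y D)))) x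
          (dual_elt (top_ext (coker (Oper X Y D))) (wedge (coker (Oper X Y D)) []))))"
    and naturality_II:
    "exact_triple t \<Longrightarrow> exact_triple b \<Longrightarrow> triple_quasi_iso t b \<phi>' \<phi> \<phi>'' \<psi>' \<psi> \<psi>'' \<Longrightarrow>
     \<xi> \<in> vcarrier (det_tensor (opL t) (opR t)) \<Longrightarrow>
      det_map (opC t) (opC b) \<phi> \<psi> (\<Psi> t \<xi>) =
      \<Psi> b (tensor_map (det_line (opL t)) (det_line (opR t)) (det_line (opL b)) (det_line (opR b))
        (det_map (opL t) (opL b) \<phi>' \<psi>') (det_map (opR t) (opR b) \<phi>'' \<psi>'') \<xi>)"
    and normalization_II:
    "exact_triple t \<Longrightarrow> surj_op (opL t) \<Longrightarrow> surj_op (opR t) \<Longrightarrow>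
     vs' \<in> tuples (vdim (ker (opL t))) (vcarrier (ker (opL t))) \<Longrightarrow>
     vs \<in> tuples (vdim (ker (opR t))) (vcarrier (ker (opC t))) \<Longrightarrow>
      \<Psi> t (det_tens (opL t) (opR t) (det_vec (opL t) vs' []) (det_vec (opR t) (map (jX t) vs) [])) =
      det_vec (opC t) (map (iX t) vs' @ vs) []"
    and normalization_III_left:
    "exact_triple t \<Longrightarrow> iso_op (opL t) \<Longrightarrow> \<sigma> \<in> vcarrier (det_line (opR t)) \<Longrightarrow>
      \<Psi> t (det_tens (opL t) (opR t) (det_vec (opL t) [] []) \<sigma>) =
      inv_into (vcarrier (det_line (opC t))) (det_map (opC t) (opR t) (jX t) (jY t)) \<sigma>"
    and normalization_III_right:
    "exact_triple t \<Longrightarrow> iso_op (opR t) \<Longrightarrow> \<sigma> \<in> vcarrier (det_line (opL t)) \<Longrightarrow>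
      \<Psi> t (det_tens (opL t) (opR t) \<sigma> (det_vec (opR t) [] [])) =
      det_map (opL t) (opC t) (iX t) (iY t) \<sigma>"
    and direct_sums_I:
    "fredholm P \<Longrightarrow> fredholm Q \<Longrightarrow> \<xi> \<in> vcarrier (det_tensor P Q) \<Longrightarrow>
      det_map (op_sum P Q) (op_sum Q P)
        (interchange (dom P) (dom Q)) (interchange (cod P) (cod Q)) (sum_map \<Psi> P Q \<xi>) =
      sum_map \<Psi> Q P (det_swap P Q \<xi>)"
    and direct_sums_II:
    "fredholm P \<Longrightarrow> fredholm Q \<Longrightarrow> fredholm R \<Longrightarrow> \<sigma> \<in> vcarrier (det_line P) \<Longrightarrow>
     \<rho> \<in> vcarrier (det_line Q) \<Longrightarrow> \<tau> \<in> vcarrier (det_line R) \<Longrightarrow>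
      det_map (op_sum P (op_sum Q R)) (op_sum (op_sum P Q) R)
        (reassoc (dom P) (dom Q) (dom R)) (reassoc (cod P) (cod Q) (cod R))
        (sum_map \<Psi> P (op_sum Q R)
          (det_tens P (op_sum Q R) \<sigma> (sum_map \<Psi> Q R (det_tens Q R \<rho> \<tau>)))) =
      sum_map \<Psi> (op_sum P Q) R
        (det_tens (op_sum P Q) R (sum_map \<Psi> P Q (det_tens P Q \<sigma> \<rho>)) \<tau>)"
    and compositions_I:
    "fredholm P \<Longrightarrow> fredholm Q \<Longrightarrow> fredholm R \<Longrightarrow> cod P = dom Q \<Longrightarrow> cod Q = dom R \<Longrightarrow>
     \<sigma> \<in> vcarrier (det_line P) \<Longrightarrow> \<rho> \<in> vcarrier (det_line Q) \<Longrightarrow> \<tau> \<in> vcarrier (det_line R) \<Longrightarrow>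
      comp_map \<Psi> P (op_comp R Q)
        (det_tens P (op_comp R Q) \<sigma> (comp_map \<Psi> Q R (det_tens Q R \<rho> \<tau>))) =
      comp_map \<Psi> (op_comp Q P) R
        (det_tens (op_comp Q P) R (comp_map \<Psi> P Q (det_tens P Q \<sigma> \<rho>)) \<tau>)"
    and compositions_II:
    "exact_triple t1 \<Longrightarrow> exact_triple t2 \<Longrightarrow>
     cod (opL t1) = dom (opL t2) \<Longrightarrow> cod (opC t1) = dom (opC t2) \<Longrightarrow> cod (opR t1) = dom (opR t2) \<Longrightarrow>
     iY t1 = iX t2 \<Longrightarrow> jY t1 = jX t2 \<Longrightarrow>
     \<sigma>1 \<in> vcarrier (det_line (opL t1)) \<Longrightarrow> \<rho>1 \<in> vcarrier (det_line (opR t1)) \<Longrightarrow>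
     \<sigma>2 \<in> vcarrier (det_line (opL t2)) \<Longrightarrow> \<rho>2 \<in> vcarrier (det_line (opR t2)) \<Longrightarrow>
     t = triple_comp t1 t2 \<Longrightarrow>
      comp_map \<Psi> (opC t1) (opC t2)
        (det_tens (opC t1) (opC t2)
          (\<Psi> t1 (det_tens (opL t1) (opR t1) \<sigma>1 \<rho>1))
          (\<Psi> t2 (det_tens (opL t2) (opR t2) \<sigma>2 \<rho>2))) =
      koszul_sign (opR t1) (opL t2) \<odot>\<^bsub>det_line (opC t)\<^esub>
        \<Psi> t (det_tens (opL t) (opR t)
          (comp_map \<Psi> (opL t1) (opL t2) (det_tens (opL t1) (opL t2) \<sigma>1 \<sigma>2))
          (comp_map \<Psi> (opR t1) (opR t2) (det_tens (opR t1) (opR t2) \<rho>1 \<rho>2)))"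
    and complex_exact_triples:
    "exact_triple t \<Longrightarrow>
     complex_structure (dom (opL t)) J' \<Longrightarrow> complex_structure (cod (opL t)) K' \<Longrightarrow>
     complex_structure (dom (opC t)) J \<Longrightarrow> complex_structure (cod (opC t)) K \<Longrightarrow>
     complex_structure (dom (opR t)) J'' \<Longrightarrow> complex_structure (cod (opR t)) K'' \<Longrightarrow>
     complex_linear (dom (opL t)) J' K' (fn (opL t)) \<Longrightarrow>
     complex_linear (dom (opC t)) J K (fn (opC t)) \<Longrightarrow>
     complex_linear (dom (opR t)) J'' K'' (fn (opR t)) \<Longrightarrow>
     complex_linear (dom (opL t)) J' J (iX t) \<Longrightarrow> complex_linear (dom (opC t)) J J'' (jX t) \<Longrightarrow>
     complex_linear (cod (opL t)) K' K (iY t) \<Longrightarrow> complex_linear (cod (opC t)) K K'' (jY t) \<Longrightarrow>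
     \<sigma>' \<in> complex_orientation (opL t) J' K' \<Longrightarrow> \<sigma>'' \<in> complex_orientation (opR t) J'' K'' \<Longrightarrow>
      \<Psi> t (det_tens (opL t) (opR t) \<sigma>' \<sigma>'') \<in> complex_orientation (opC t) J K"


section \<open>Transverse degenerations\<close>

definition degenerations :: "'v nspace \<Rightarrow> 'v nspace \<Rightarrow> (real \<Rightarrow> 'v \<Rightarrow> 'v) \<Rightarrow> real set"
  where "degenerations X Y D = {t \<in> {0..1}. \<not> is_iso X Y (D t)}"

text \<open>Here \<open>S\<close> is the complement \<open>X\<close> with a dot on top, and ``near \<open>t0\<close>'' means on the interval
  \<open>(t0 - \<delta>, t0 + \<delta>)\<close>.\<close>

definition transverse_at :: "'v nspace \<Rightarrow> 'v nspace \<Rightarrow> (real \<Rightarrow> 'v \<Rightarrow> 'v) \<Rightarrow> real \<Rightarrow> bool"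
  where "transverse_at X Y D t0 \<longleftrightarrow>
    vdim (coker (Oper X Y (D t0))) = 1 \<and>
    (\<exists>x0 y0 S \<delta> B f.
      x0 \<in> vcarrier (ker (Oper X Y (D t0))) \<and> x0 \<noteq> \<zero>\<^bsub>X\<^esub> \<and>
      y0 \<in> vcarrier Y - D t0 ` vcarrier X \<and>
      subspace_of S X \<and> closedin (norm_top X) S \<and>
      is_iso (X\<lparr>vcarrier := S\<rparr>) (Y\<lparr>vcarrier := D t0 ` vcarrier X\<rparr>) (restrict (D t0) S) \<and>
      \<delta> > 0 \<and> {t0 - \<delta> <..< t0 + \<delta>} \<subseteq> {0..1} \<and>
      (\<forall>t\<in>{t0 - \<delta> <..< t0 + \<delta>}. \<forall>y\<in>vcarrier Y.
        \<exists>!p. fst p \<in> D t ` S \<and> y = fst p \<oplus>\<^bsub>Y\<^esub> (snd p \<odot>\<^bsub>Y\<^esub> y0)) \<and>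
      B ` {t0 - \<delta> <..< t0 + \<delta>} \<subseteq> S \<and>
      continuous_map (top_of_set {t0 - \<delta> <..< t0 + \<delta>}) (norm_top X) B \<and>
      continuous_on {t0 - \<delta> <..< t0 + \<delta>} f \<and>
      (\<forall>t\<in>{t0 - \<delta> <..< t0 + \<delta>}. D t x0 = D t (B t) \<oplus>\<^bsub>Y\<^esub> (f t \<odot>\<^bsub>Y\<^esub> y0)) \<and>
      (\<forall>s t. t0 - \<delta> < s \<and> s < t0 \<and> t0 < t \<and> t < t0 + \<delta> \<longrightarrow> f s * f t < 0))"

end

theory Submission
  imports Defs
begin

text \<open>
  The determinant line of an isomorphism has the canonical generator \<open>1 \<otimes> 1\<^sup>*\<close>. Over the parameters at
  which \<open>D t\<close> is an isomorphism it is a continuous section of the determinant bundle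
  (\<open>canonical_vector_continuous\<close>), since by the first normalization axiom the bundle over surjective
  operators is the top exterior power of the kernel bundle. The theorem amounts to the fact that
  this generator changes sign at each transverse degeneration: a continuous section without zeros is a positive
  multiple of it on one side and a negative multiple on the other.

  Near a degeneration \<open>t0\<close>, no kernel bundle is available because \<open>D t0\<close> is not surjective. Therefore
  \<open>D t\<close> is stabilized to \<open>X \<oplus> \<real> y0 \<rightarrow> Y\<close>, \<open>(x, l) \<mapsto> D t x + l\<close>, where \<open>y0\<close> spans a complement of
  the image of \<open>D t0\<close>. The stabilized operators are surjective near \<open>t0\<close>, and their kernels are lines with
  a continuous generator \<open>e t\<close>. This is a perturbation argument for an operator with a bounded right inverse
  (locale \<open>right_inverse\<close>), which rests on the contraction principle. The equation
  \<open>D t x0 = D t (B t) + f t y0\<close> of the transversality condition shows that \<open>e t\<close> has component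
  \<open>- f t y0\<close> in the added line.

  The exact triple from \<open>D t\<close> through its stabilization to the zero map \<open>N\<close> on \<open>\<real> y0\<close> varies continuously
  with \<open>t\<close>, so its isomorphism \<open>\<Psi>\<close> compares continuous sections. When \<open>D t\<close> is an isomorphism, all
  three operators are surjective, and the second normalization axiom gives
  \<open>\<Psi> ((1 \<otimes> 1\<^sup>*) \<otimes> (- f t) \<nu>) = e t \<otimes> 1\<^sup>*\<close> for the fixed generator \<open>\<nu>\<close> of the determinant line
  of \<open>N\<close>. The right hand side is continuous and not zero even at \<open>t0\<close>, and \<open>f\<close> changes sign there, so
  \<open>1 \<otimes> 1\<^sup>*\<close> does (\<open>section_vs_kernel_vector\<close>, \<open>sign_change_at_degeneration\<close>).

  Globally, multiply \<open>1 \<otimes> 1\<^sup>*\<close> by \<open>-1\<close> for each degeneration already passed. The resulting rays extend to a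
  continuous orientation (\<open>signed_orientation_continuous\<close>), and, because \<open>[0, 1]\<close> is connected, every continuous
  orientation that starts with the same ray is equal to it at the other end (\<open>orientation_is_signed\<close>). At
  \<open>1\<close> the sign is \<open>-1\<close> to the number of degenerations.
\<close>

section \<open>Vector spaces on carrier sets\<close>

context vector_space_real
begin

lemma zero_add: "x \<in> vcarrier V \<Longrightarrow> \<zero> \<oplus> x = x"
  using add_commute[of \<zero> x] by (simp add: add_zero zero_closed)

lemma add_left_commute:
  "x \<in> vcarrier V \<Longrightarrow> y \<in> vcarrier V \<Longrightarrow> z \<in> vcarrier V \<Longrightarrow> x \<oplus> (y \<oplus> z) = y \<oplus> (x \<oplus> z)"
  using add_assoc[of x y z] add_assoc[of y x z] add_commute[of x y] by simp

lemmas add_ac = add_assoc add_commute add_left_commute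

lemma minus_closed: "x \<in> vcarrier V \<Longrightarrow> y \<in> vcarrier V \<Longrightarrow> x \<ominus> y \<in> vcarrier V"
  unfolding vminus_def by (simp add: add_closed scale_closed)

lemma minus_self: "x \<in> vcarrier V \<Longrightarrow> x \<ominus> x = \<zero>"
  unfolding vminus_def by (rule add_neg)

lemma add_left_cancel:
  assumes "x \<in> vcarrier V" "y \<in> vcarrier V" "z \<in> vcarrier V" "z \<oplus> x = z \<oplus> y"
  shows "x = y"
proof -
  have *: "((-1) \<odot> z) \<oplus> (z \<oplus> u) = u" if "u \<in> vcarrier V" for u
  proof -
    have "((-1) \<odot> z) \<oplus> (z \<oplus> u) = (((-1) \<odot> z) \<oplus> z) \<oplus> u"
      using that assms by (simp add: add_assoc scale_closed)
    also have "\<dots> = u"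
      using that assms add_commute[of "(-1) \<odot> z" z] by (simp add: add_neg scale_closed zero_add)
    finally show ?thesis .
  qed
  show ?thesis by (metis * assms)
qed

lemma scale_zero: "x \<in> vcarrier V \<Longrightarrow> 0 \<odot> x = \<zero>"
  by (rule add_left_cancel[of _ _ "0 \<odot> x"])
     (simp_all add: scale_closed zero_closed add_zero flip: scale_add_left)

lemma scale_zero_right: "c \<odot> \<zero> = \<zero>"
  using scale_scale[OF zero_closed, of c 0] by (simp add: scale_zero zero_closed)

lemma scale_eq_zeroD: "x \<in> vcarrier V \<Longrightarrow> c \<odot> x = \<zero> \<Longrightarrow> x \<noteq> \<zero> \<Longrightarrow> c = 0"
  by (metis left_inverse scale_one scale_scale scale_zero_right)

lemma scale_right_cancel: "x \<in> vcarrier V \<Longrightarrow> x \<noteq> \<zero> \<Longrightarrow> a \<odot> x = b \<odot> x \<Longrightarrow> a = b"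
proof -
  assume x: "x \<in> vcarrier V" "x \<noteq> \<zero>" and eq: "a \<odot> x = b \<odot> x"
  have "(a + - b) \<odot> x = (b + - b) \<odot> x"
    using x eq by (simp only: scale_add_left)
  then have "(a + - b) \<odot> x = \<zero>" using x by (simp add: scale_zero)
  with x scale_eq_zeroD[of x "a + - b"] show ?thesis by simp
qed

lemma minus_zero: "x \<in> vcarrier V \<Longrightarrow> x \<ominus> \<zero> = x"
  unfolding vminus_def by (simp add: scale_zero_right add_zero)

lemma minus_add_cancel: "x \<in> vcarrier V \<Longrightarrow> y \<in> vcarrier V \<Longrightarrow> (x \<ominus> y) \<oplus> y = x"
  unfolding vminus_def
  by (simp add: add_assoc add_commute[of _ y] add_neg add_zero scale_closed)

lemma add_minus_cancel: "x \<in> vcarrier V \<Longrightarrow> y \<in> vcarrier V \<Longrightarrow> (x \<oplus> y) \<ominus> y = x"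
  unfolding vminus_def
  by (simp add: add_assoc add_neg add_zero scale_closed)

lemma minus_eq_iff:
  "x \<in> vcarrier V \<Longrightarrow> y \<in> vcarrier V \<Longrightarrow> z \<in> vcarrier V \<Longrightarrow> x \<ominus> y = z \<longleftrightarrow> x = z \<oplus> y"
  using minus_add_cancel add_minus_cancel by metis

lemma minus_eq_zero_iff: "x \<in> vcarrier V \<Longrightarrow> y \<in> vcarrier V \<Longrightarrow> x \<ominus> y = \<zero> \<longleftrightarrow> x = y"
  by (simp add: minus_eq_iff zero_closed zero_add)

lemma minus_trans:
  "x \<in> vcarrier V \<Longrightarrow> y \<in> vcarrier V \<Longrightarrow> z \<in> vcarrier V \<Longrightarrow> (x \<ominus> y) \<oplus> (y \<ominus> z) = x \<ominus> z"
  using add_assoc[of "x \<ominus> y" y "(-1) \<odot> z"] minus_add_cancel[of x y]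
  by (simp add: vminus_def scale_closed add_closed)

lemma scale_minus: "x \<in> vcarrier V \<Longrightarrow> y \<in> vcarrier V \<Longrightarrow> c \<odot> (x \<ominus> y) = (c \<odot> x) \<ominus> (c \<odot> y)"
  unfolding vminus_def by (simp add: scale_add_right scale_closed scale_scale)

lemma scale_minus_left: "x \<in> vcarrier V \<Longrightarrow> (a - b) \<odot> x = (a \<odot> x) \<ominus> (b \<odot> x)"
  unfolding vminus_def using scale_add_left[of x a "- b"] by (simp add: scale_scale)

lemma minus_swap: "x \<in> vcarrier V \<Longrightarrow> y \<in> vcarrier V \<Longrightarrow> (-1) \<odot> (x \<ominus> y) = y \<ominus> x"
  unfolding vminus_def
  using add_commute[of "(-1) \<odot> x" y] by (simp add: scale_add_right scale_closed scale_scale scale_one)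

lemma minus_add_minus:
  assumes "a \<in> vcarrier V" "b \<in> vcarrier V" "c \<in> vcarrier V" "d \<in> vcarrier V"
  shows "(a \<oplus> b) \<ominus> (c \<oplus> d) = (a \<ominus> c) \<oplus> (b \<ominus> d)"
  unfolding vminus_def using assms
  by (simp add: scale_add_right scale_closed add_closed add_ac)

lemma add_left_minus: 
  assumes "a \<in> vcarrier V" "b \<in> vcarrier V" "c \<in> vcarrier V"
  shows "(a \<oplus> b) \<ominus> (a \<oplus> c) = b \<ominus> c"
  using assms by (simp add: minus_add_minus minus_self zero_add minus_closed)

lemma minus_left_minus: 
  assumes "a \<in> vcarrier V" "b \<in> vcarrier V" "c \<in> vcarrier V"
  shows "(a \<ominus> b) \<ominus> (a \<ominus> c) = c \<ominus> b"
proof -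
  have "(a \<ominus> b) \<ominus> (a \<ominus> c) = ((-1) \<odot> b) \<ominus> ((-1) \<odot> c)"
    unfolding vminus_def[of _ a] using assms by (simp add: add_left_minus scale_closed)
  also have "\<dots> = (-1) \<odot> (b \<ominus> c)" using assms by (simp add: scale_minus)
  finally show ?thesis using assms by (simp add: minus_swap)
qed

lemma subspace: 
  assumes "subspace_of S V" shows "vector_space_real (V\<lparr>vcarrier := S\<rparr>)"
  using assms unfolding subspace_of_def
  by unfold_locales
     (auto simp: subset_iff add_closed zero_closed scale_closed add_ac add_zero add_neg scale_add_right
       scale_add_left scale_scale scale_one)

end

lemma (in vector_space_real) linear_on_zero:
  assumes "linear_on V W f" "vector_space_real W" "f \<zero> \<in> vcarrier W"
  shows "f \<zero> = \<zero>\<^bsub>W\<^esub>"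
proof -
  have "f \<zero> = f (0 \<odot> \<zero>)" by (simp add: scale_zero_right)
  also have "\<dots> = 0 \<odot>\<^bsub>W\<^esub> f \<zero>" using assms(1) zero_closed unfolding linear_on_def by blast
  finally show ?thesis using vector_space_real.scale_zero[OF assms(2,3)] by simp
qed

lemma (in vector_space_real) linear_on_minus:
  assumes "linear_on V W f" "x \<in> vcarrier V" "y \<in> vcarrier V"
  shows "f (x \<ominus> y) = f x \<ominus>\<^bsub>W\<^esub> f y"
  using assms scale_closed unfolding linear_on_def vminus_def by metis

subsection \<open>Bases of length at most one\<close>

lemma lincomb_Nil [simp]: "lincomb V cs [] = \<zero>\<^bsub>V\<^esub>" "lincomb V [] vs = \<zero>\<^bsub>V\<^esub>"
  by (simp_all add: lincomb_def)

lemma lincomb_Cons [simp]: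
  "lincomb V (c # cs) (v # vs) = (c \<odot>\<^bsub>V\<^esub> v) \<oplus>\<^bsub>V\<^esub> lincomb V cs vs"
  by (simp add: lincomb_def)

context vector_space_real
begin

lemma lincomb_zeros: "set vs \<subseteq> vcarrier V \<Longrightarrow> lincomb V (replicate n 0) vs = \<zero>"
proof (induction vs arbitrary: n)
  case (Cons v vs)
  then show ?case by (cases n) (simp_all add: scale_zero add_zero zero_closed)
qed simp

lemma basis_unique_zero:
  assumes "is_basis V vs" "length cs = length vs" "lincomb V cs vs = \<zero>"
  shows "cs = replicate (length vs) 0"
proof -
  have "\<exists>!cs. length cs = length vs \<and> lincomb V cs vs = \<zero>"
    using assms(1) zero_closed unfolding is_basis_def by blast
  moreover have "lincomb V (replicate (length vs) 0) vs = \<zero>"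
    using assms(1) by (intro lincomb_zeros) (simp add: is_basis_def)
  ultimately show ?thesis using assms(2,3) by (metis length_replicate)
qed

lemma is_basis_Nil: "is_basis V [] \<longleftrightarrow> vcarrier V = {\<zero>}"
  using zero_closed unfolding is_basis_def by auto

lemma basis_of_trivial:
  assumes "vcarrier V = {\<zero>}" "is_basis V ws" shows "ws = []"
proof (cases ws)
  case (Cons w ws')
  have "w = \<zero>" "set ws' \<subseteq> vcarrier V" using assms Cons by (auto simp: is_basis_def)
  then have "lincomb V (1 # replicate (length ws') 0) ws = \<zero>"
    using Cons zero_closed by (simp add: lincomb_zeros add_zero scale_one)
  from basis_unique_zero[OF assms(2) _ this] Cons show ?thesis by simp
qed

lemma vdim_trivial: "vcarrier V = {\<zero>} \<Longrightarrow> vdim V = 0"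
  unfolding vdim_def by (rule the_equality) (use is_basis_Nil basis_of_trivial in auto)

lemma is_basis_singleton:
  assumes "v \<in> vcarrier V" "v \<noteq> \<zero>" "\<And>x. x \<in> vcarrier V \<Longrightarrow> \<exists>c. x = c \<odot> v"
  shows "is_basis V [v]"
  unfolding is_basis_def
proof (intro conjI ballI)
  fix x assume "x \<in> vcarrier V"
  then obtain c where c: "x = c \<odot> v" using assms by blast
  show "\<exists>!cs. length cs = length [v] \<and> lincomb V cs [v] = x"
  proof (rule ex1I[of _ "[c]"])
    show "length [c] = length [v] \<and> lincomb V [c] [v] = x"
      using c assms by (simp add: add_zero scale_closed)
    fix cs assume cs: "length cs = length [v] \<and> lincomb V cs [v] = x"
    then obtain d where "cs = [d]" by (auto simp: length_Suc_conv)
    with cs c assms show "cs = [c]" using scale_right_cancel[of v d c]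
      by (simp add: add_zero scale_closed)
  qed
qed (use assms in simp)

lemma is_basis_singletonD:
  assumes "is_basis V [v]"
  shows "v \<in> vcarrier V" "v \<noteq> \<zero>" "x \<in> vcarrier V \<Longrightarrow> \<exists>c. x = c \<odot> v"
proof -
  show v: "v \<in> vcarrier V" using assms by (simp add: is_basis_def)
  show "v \<noteq> \<zero>"
  proof
    assume "v = \<zero>"
    then have "lincomb V [1] [v] = \<zero>" using v by (simp add: add_zero scale_one)
    from basis_unique_zero[OF assms _ this] show False by simp
  qed
  assume "x \<in> vcarrier V"
  then obtain cs where cs: "length cs = length [v]" "lincomb V cs [v] = x"
    using assms unfolding is_basis_def by blast
  then obtain d where "cs = [d]" by (auto simp: length_Suc_conv)
  then show "\<exists>c. x = c \<odot> v" using cs v by (auto simp: add_zero scale_closed)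
qed

text \<open>If a basis began with two multiples \<open>a \<odot> v\<close> and \<open>b \<odot> v\<close> of one vector, the relation between
  them with coefficients \<open>b\<close> and \<open>- a\<close> would have to be trivial, and then the first of them would be
  zero.\<close>

lemma basis_length_singleton:
  assumes "is_basis V [v]" "is_basis V ws" shows "length ws = 1"
proof -
  note v = is_basis_singletonD[OF assms(1)] and ws = assms(2)
  have in_V: "set ws \<subseteq> vcarrier V" using ws by (simp add: is_basis_def)
  show ?thesis
  proof (cases ws)
    case Nil
    then show ?thesis using ws v by (simp add: is_basis_Nil)
  next
    case (Cons w1 us)
    show ?thesis
    proof (cases us)
      case Nil then show ?thesis using Cons by simp
    next
      case (Cons w2 rs)
      note ws_eq = \<open>ws = w1 # us\<close> Cons
      obtain a b where ab: "w1 = a \<odot> v" "w2 = b \<odot> v" using v(3)[of w1] v(3)[of w2] in_V ws_eq by auto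
      have rs: "lincomb V (replicate (length rs) 0) rs = \<zero>"
        using in_V ws_eq by (intro lincomb_zeros) auto
      have "lincomb V (b # (- a) # replicate (length rs) 0) ws = \<zero>"
        using ab v(1) rs ws_eq
        by (simp add: scale_scale add_zero scale_closed mult.commute scale_zero flip: scale_add_left)
      from basis_unique_zero[OF ws _ this] ws_eq have "a = 0" by simp
      then have "lincomb V (1 # 0 # replicate (length rs) 0) ws = \<zero>"
        using ab v(1) rs ws_eq
        by (simp add: scale_scale add_zero scale_closed scale_zero scale_zero_right zero_closed)
      from basis_unique_zero[OF ws _ this] ws_eq show ?thesis by simp
    qed
  qed
qed

lemma vdim_singleton: "is_basis V [v] \<Longrightarrow> vdim V = 1"
  unfolding vdim_def by (rule the_equality) (auto dest: basis_length_singleton intro!: exI[of _ "[v]"])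

lemma basis_length_unique:
  assumes "is_basis V vs" "is_basis V ws" "length vs \<le> 1" shows "length ws = length vs"
proof (cases vs)
  case Nil
  then show ?thesis using assms basis_of_trivial by (simp add: is_basis_Nil)
next
  case (Cons v us)
  then show ?thesis using assms basis_length_singleton by simp
qed

end

section \<open>Duals, tensor products and wedge products\<close>

lemma functional_on_eq_linear:
  "functional_on V f \<Longrightarrow> x \<in> vcarrier V \<Longrightarrow> y \<in> vcarrier V \<Longrightarrow> f (x \<oplus>\<^bsub>V\<^esub> y) = f x + f y"
  "functional_on V f \<Longrightarrow> x \<in> vcarrier V \<Longrightarrow> f (c \<odot>\<^bsub>V\<^esub> x) = c * f x"
  by (simp_all add: functional_on_def)

lemma fun_space_simps [simp]:
  "vcarrier (fun_space A F) = F" "vadd (fun_space A F) f g = (\<lambda>x\<in>A. f x + g x)"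
  "vzero (fun_space A F) = (\<lambda>x\<in>A. 0)" "vscale (fun_space A F) c f = (\<lambda>x\<in>A. c * f x)"
  by (simp_all add: fun_space_def)

lemma vector_space_fun_space:
  assumes "F \<subseteq> extensional A" "(\<lambda>x\<in>A. 0) \<in> F"
    and "\<And>f g. f \<in> F \<Longrightarrow> g \<in> F \<Longrightarrow> (\<lambda>x\<in>A. f x + g x) \<in> F"
    and "\<And>c f. f \<in> F \<Longrightarrow> (\<lambda>x\<in>A. c * f x) \<in> F"
  shows "vector_space_real (fun_space A F)"
proof
  fix f assume "f \<in> vcarrier (fun_space A F)"
  then have f: "f \<in> extensional A" using assms(1) by auto
  show "f \<oplus>\<^bsub>fun_space A F\<^esub> \<zero>\<^bsub>fun_space A F\<^esub> = f" "1 \<odot>\<^bsub>fun_space A F\<^esub> f = f"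
    using f by (auto intro!: extensionalityI[of _ A])
qed (use assms in \<open>auto simp: fun_eq_iff algebra_simps\<close>)

lemma functional_on_fun_spaceI:
  assumes "\<And>f g. f \<in> F \<Longrightarrow> g \<in> F \<Longrightarrow> T (\<lambda>x\<in>A. f x + g x) = T f + T g"
    and "\<And>c f. f \<in> F \<Longrightarrow> T (\<lambda>x\<in>A. c * f x) = c * T f"
  shows "functional_on (fun_space A F) T"
  using assms by (simp add: functional_on_def)

lemma vcarrier_dual:
  "vcarrier (dual V) = {f \<in> extensional (vcarrier V). functional_on V f}"
  by (simp add: dual_def)

lemma dual_simps [simp]:
  "vadd (dual V) f g = (\<lambda>x\<in>vcarrier V. f x + g x)"
  "vzero (dual V) = (\<lambda>x\<in>vcarrier V. 0)" "vscale (dual V) c f = (\<lambda>x\<in>vcarrier V. c * f x)"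
  by (simp_all add: dual_def)

lemma functional_on_evaluation: "x \<in> vcarrier V \<Longrightarrow> functional_on (dual V) (\<lambda>f. f x)"
  by (simp add: functional_on_def)

lemma vector_space_dual:
  assumes "vector_space_real V" shows "vector_space_real (dual V)"
proof -
  interpret vector_space_real V by fact
  show ?thesis unfolding dual_def
    by (rule vector_space_fun_space)
       (auto simp: functional_on_def add_closed scale_closed algebra_simps)
qed

lemma restrict_in_dual:
  assumes "vector_space_real V" "functional_on V f"
  shows "restrict f (vcarrier V) \<in> vcarrier (dual V)"
proof -
  interpret vector_space_real V by fact
  show ?thesis using assms(2)
    by (auto simp: vcarrier_dual functional_on_def add_closed scale_closed)
qed

lemma coordinate_functional:
  assumes "vector_space_real V" "is_basis V [v]"
  obtains f where "functional_on V f" "f v = 1"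
proof -
  interpret vector_space_real V by fact
  note v = is_basis_singletonD[OF assms(2)]
  define f where "f x = (THE c. x = c \<odot>\<^bsub>V\<^esub> v)" for x
  have f: "f (c \<odot>\<^bsub>V\<^esub> v) = c" for c
    unfolding f_def by (rule the_equality) (use scale_right_cancel[OF v(1,2)] in auto)
  show thesis
  proof
    show "functional_on V f" unfolding functional_on_def
    proof (intro conjI ballI allI)
      fix x y assume "x \<in> vcarrier V" "y \<in> vcarrier V"
      then obtain a b where "x = a \<odot>\<^bsub>V\<^esub> v" "y = b \<odot>\<^bsub>V\<^esub> v" using v(3) by blast
      then show "f (x \<oplus>\<^bsub>V\<^esub> y) = f x + f y" using v(1) by (simp add: f flip: scale_add_left)
    next
      fix c x assume "x \<in> vcarrier V"
      then obtain a where "x = a \<odot>\<^bsub>V\<^esub> v" using v(3) by blast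
      then show "f (c \<odot>\<^bsub>V\<^esub> x) = c * f x" using v(1) by (simp add: f scale_scale)
    qed
    show "f v = 1" using f[of 1] v(1) by (simp add: scale_one)
  qed
qed

subsection \<open>Tensor products\<close>

lemma vector_space_bilinear_forms:
  assumes "vector_space_real U" "vector_space_real W"
  shows "vector_space_real (fun_space (vcarrier U \<times> vcarrier W) (bilinear_forms U W))"
proof -
  interpret U: vector_space_real U by fact
  interpret W: vector_space_real W by fact
  show ?thesis
    by (rule vector_space_fun_space)
       (auto simp: bilinear_forms_def functional_on_def U.add_closed U.scale_closed W.add_closed
         W.scale_closed algebra_simps)
qed

lemma vector_space_tensor:
  "vector_space_real U \<Longrightarrow> vector_space_real W \<Longrightarrow> vector_space_real (tensor U W)"
  unfolding tensor_def by (intro vector_space_dual vector_space_bilinear_forms)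

lemma tens_closed:
  assumes "vector_space_real U" "vector_space_real W" "u \<in> vcarrier U" "w \<in> vcarrier W"
  shows "tens U W u w \<in> vcarrier (tensor U W)"
proof -
  have "restrict (\<lambda>\<beta>. \<beta> (u, w)) (bilinear_forms U W) \<in> vcarrier (tensor U W)"
    unfolding tensor_def
    using restrict_in_dual[OF vector_space_bilinear_forms[OF assms(1,2)], of "\<lambda>\<beta>. \<beta> (u, w)"] assms
    by (simp add: functional_on_fun_spaceI)
  then show ?thesis by (simp add: tens_def)
qed

lemma tens_scale_left:
  assumes "u \<in> vcarrier U" "w \<in> vcarrier W"
  shows "tens U W (c \<odot>\<^bsub>U\<^esub> u) w = c \<odot>\<^bsub>tensor U W\<^esub> tens U W u w"
  using assms by (auto simp: tens_def tensor_def bilinear_forms_def functional_on_def)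

lemma tens_scale_right:
  assumes "u \<in> vcarrier U" "w \<in> vcarrier W"
  shows "tens U W u (c \<odot>\<^bsub>W\<^esub> w) = c \<odot>\<^bsub>tensor U W\<^esub> tens U W u w"
  using assms by (auto simp: tens_def tensor_def bilinear_forms_def functional_on_def)

text \<open>The bilinear form that detects \<open>u \<otimes> w\<close> is the product of the two functionals.\<close>

lemma tens_nonzero:
  assumes "vector_space_real U" "vector_space_real W" "u \<in> vcarrier U" "w \<in> vcarrier W"
    and "functional_on U f" "functional_on W g" "f u \<noteq> 0" "g w \<noteq> 0"
  shows "tens U W u w \<noteq> \<zero>\<^bsub>tensor U W\<^esub>"
proof -
  interpret U: vector_space_real U by fact
  interpret W: vector_space_real W by fact
  define \<beta> where "\<beta> = (\<lambda>(u, w)\<in>vcarrier U \<times> vcarrier W. f u * g w)"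
  have \<beta>: "\<beta> \<in> bilinear_forms U W" using assms(5,6)
    unfolding bilinear_forms_def \<beta>_def functional_on_def
    by (auto simp: U.add_closed U.scale_closed W.add_closed W.scale_closed algebra_simps)
  have "tens U W u w \<beta> \<noteq> 0" using \<beta> assms by (simp add: tens_def) (simp add: \<beta>_def)
  moreover have "\<zero>\<^bsub>tensor U W\<^esub> \<beta> = 0" using \<beta> by (simp add: tensor_def)
  ultimately show ?thesis by metis
qed

subsection \<open>Wedge products in spaces of dimension at most one\<close>

lemma update_in_tuples: "xs \<in> tuples n A \<Longrightarrow> x \<in> A \<Longrightarrow> xs[i := x] \<in> tuples n A"
  using set_update_subset_insert[of xs i x] by (auto simp: tuples_def)

lemma vector_space_alt_forms:
  assumes "vector_space_real V"
  shows "vector_space_real (fun_space (tuples n (vcarrier V)) (alt_forms n V))"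
proof -
  interpret V: vector_space_real V by fact
  show ?thesis
    by (rule vector_space_fun_space)
       (auto simp: alt_forms_def functional_on_def V.add_closed V.scale_closed algebra_simps
         update_in_tuples)
qed

lemma vector_space_top_ext: "vector_space_real V \<Longrightarrow> vector_space_real (top_ext V)"
  unfolding top_ext_def ext_power_def by (intro vector_space_dual vector_space_alt_forms)

lemma functional_on_top_ext:
  "\<omega> \<in> alt_forms (vdim V) V \<Longrightarrow> functional_on (top_ext V) (\<lambda>\<xi>. \<xi> \<omega>)"
  unfolding top_ext_def ext_power_def by (rule functional_on_evaluation) simp

lemma wedge_closed:
  assumes "vector_space_real V" "vs \<in> tuples (vdim V) (vcarrier V)"
  shows "wedge V vs \<in> vcarrier (top_ext V)"
  using restrict_in_dual[OF vector_space_alt_forms[OF assms(1), of "vdim V"], of "\<lambda>\<omega>. \<omega> vs"] assms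
  by (simp add: functional_on_fun_spaceI top_ext_def ext_power_def wedge_def)

lemma wedge_singleton_scale:
  assumes "vdim V = 1" "v \<in> vcarrier V"
  shows "wedge V [c \<odot>\<^bsub>V\<^esub> v] = c \<odot>\<^bsub>top_ext V\<^esub> wedge V [v]"
proof -
  have "\<omega> [c \<odot>\<^bsub>V\<^esub> v] = c * \<omega> [v]" if "\<omega> \<in> alt_forms 1 V" for \<omega>
  proof -
    have "[v] \<in> tuples 1 (vcarrier V)" using assms by (simp add: tuples_def)
    then have "functional_on V (\<lambda>x. \<omega> ([v][0 := x]))" using that unfolding alt_forms_def by blast
    then show ?thesis using assms by (simp add: functional_on_def)
  qed
  then show ?thesis using assms by (auto simp: wedge_def top_ext_def ext_power_def)
qed

lemma tuples_0 [simp]: "tuples 0 A = {[]}"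
  by (auto simp: tuples_def)

lemma alt_forms_0: "alt_forms 0 V = extensional {[]}"
  by (auto simp: alt_forms_def)

text \<open>The alternating form is the constant \<open>1\<close> for the empty basis and the coordinate functional for a
  basis of length one. It shows that the wedge product of the basis is not zero.\<close>

lemma alt_form_detects_basis:
  assumes "vector_space_real V" "is_basis V vs" "length vs \<le> 1"
  obtains \<omega> where "\<omega> \<in> alt_forms (vdim V) V" "\<omega> vs = 1" "vs \<in> tuples (vdim V) (vcarrier V)"
proof -
  interpret V: vector_space_real V by fact
  show thesis
  proof (cases vs)
    case Nil
    then have "vdim V = 0" using assms(2) by (simp add: V.is_basis_Nil V.vdim_trivial)
    with Nil show thesis by (intro that[of "\<lambda>x\<in>{[]}. 1"]) (auto simp: alt_forms_0)
  next
    case (Cons v ws)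
    then have v: "vs = [v]" using assms(3) by simp
    then have b: "is_basis V [v]" and dim: "vdim V = 1" using assms(2) V.vdim_singleton by auto
    obtain f where f: "functional_on V f" "f v = 1" by (rule coordinate_functional[OF assms(1) b])
    define \<omega> where "\<omega> = (\<lambda>xs\<in>tuples 1 (vcarrier V). f (hd xs))"
    have *: "\<exists>x. xs = [x] \<and> x \<in> vcarrier V" if "xs \<in> tuples 1 (vcarrier V)" for xs
      using that by (auto simp: tuples_def length_Suc_conv)
    have "\<omega> \<in> alt_forms 1 V" unfolding alt_forms_def
    proof (intro CollectI conjI ballI allI impI)
      show "\<omega> \<in> extensional (tuples 1 (vcarrier V))" by (simp add: \<omega>_def)
    next
      fix xs i assume "xs \<in> tuples 1 (vcarrier V)" "i < (1::nat)"
      then show "functional_on V (\<lambda>x. \<omega> (xs[i := x]))"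
        using *[of xs] f(1) by (auto simp: \<omega>_def functional_on_def tuples_def V.add_closed V.scale_closed)
    next
      fix xs assume "xs \<in> tuples 1 (vcarrier V)" "\<not> distinct xs"
      then show "\<omega> xs = 0" using * by fastforce
    qed
    then show thesis
      using that[of \<omega>] v dim f(2) V.is_basis_singletonD(1)[OF b] by (simp add: \<omega>_def tuples_def)
  qed
qed

text \<open>The top exterior power of the zero space is the dual of the constants on the empty tuple. It is spanned by
  the empty wedge product, and evaluation at the constant \<open>1\<close> is the only functional with value \<open>1\<close> on it.
  This is what makes the definite description in \<open>dual_elt\<close> meaningful.\<close>

lemma dual_elt_trivial:
  assumes "vector_space_real V" "vcarrier V = {\<zero>\<^bsub>V\<^esub>}"
  shows "dual_elt (top_ext V) (wedge V []) \<in> vcarrier (dual (top_ext V))"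
    and "dual_elt (top_ext V) (wedge V []) (wedge V []) = 1"
proof -
  interpret V: vector_space_real V by fact
  have dim: "vdim V = 0" using assms(2) by (rule V.vdim_trivial)
  define one where "one = (\<lambda>x\<in>{[]::'a list}. 1::real)"
  define E where "E = fun_space {[]::'a list} (extensional {[]})"
  have top: "top_ext V = dual E" by (simp add: top_ext_def ext_power_def dim E_def alt_forms_0)
  have one: "one \<in> vcarrier E" by (simp add: one_def E_def)
  have wedge: "wedge V [] = (\<lambda>\<omega>\<in>vcarrier E. \<omega> [])" by (simp add: wedge_def dim E_def alt_forms_0)
  have wedge_one: "wedge V [] one = 1" using one by (simp add: wedge) (simp add: one_def)
  have in_top: "wedge V [] \<in> vcarrier (top_ext V)" by (rule wedge_closed) (use assms dim in simp_all)
  have gen: "\<xi> = \<xi> one \<odot>\<^bsub>top_ext V\<^esub> wedge V []" if "\<xi> \<in> vcarrier (top_ext V)" for \<xi>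
  proof -
    have \<xi>: "functional_on E \<xi>" "\<xi> \<in> extensional (vcarrier E)" using that by (auto simp: top vcarrier_dual)
    have "\<xi> \<omega> = \<xi> one * \<omega> []" if "\<omega> \<in> vcarrier E" for \<omega>
    proof -
      have "\<omega> = \<omega> [] \<odot>\<^bsub>E\<^esub> one" using that unfolding E_def one_def by (auto simp: extensional_def)
      then show ?thesis using functional_on_eq_linear(2)[OF \<xi>(1) one] by (metis mult.commute)
    qed
    then show ?thesis using \<xi>(2) by (auto simp: top wedge extensional_def)
  qed
  have "dual_elt (top_ext V) (wedge V []) = (\<lambda>\<xi>\<in>vcarrier (top_ext V). \<xi> one)" (is "_ = ?f")
    unfolding dual_elt_def
  proof (rule the_equality)
    show "?f \<in> vcarrier (dual (top_ext V)) \<and> ?f (wedge V []) = 1"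
      using restrict_in_dual[OF vector_space_top_ext[OF assms(1)], of "\<lambda>\<xi>. \<xi> one"] in_top wedge_one
        functional_on_evaluation[OF one] by (simp add: top)
    fix g assume g: "g \<in> vcarrier (dual (top_ext V)) \<and> g (wedge V []) = 1"
    then have "g \<xi> = \<xi> one" if "\<xi> \<in> vcarrier (top_ext V)" for \<xi>
      using functional_on_eq_linear(2)[of "top_ext V" g "wedge V []" "\<xi> one"] gen[OF that] in_top
      by (simp add: vcarrier_dual)
    then show "g = ?f" using g by (auto simp: vcarrier_dual extensional_def)
  qed
  then show "dual_elt (top_ext V) (wedge V []) \<in> vcarrier (dual (top_ext V))"
    "dual_elt (top_ext V) (wedge V []) (wedge V []) = 1"
    using restrict_in_dual[OF vector_space_top_ext[OF assms(1)], of "\<lambda>\<xi>. \<xi> one"] in_top wedge_one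
        functional_on_evaluation[OF one] by (simp_all add: top)
qed

subsection \<open>Determinant lines of surjective operators\<close>

text \<open>Every coset of the image of a surjective operator is the whole target.\<close>

lemma coker_trivial:
  assumes "vector_space_real (cod P)" "surj_op P"
  shows "vector_space_real (coker P)" "vcarrier (coker P) = {\<zero>\<^bsub>coker P\<^esub>}"
proof -
  interpret Y: vector_space_real "cod P" by fact
  have zero: "\<zero>\<^bsub>coker P\<^esub> = vcarrier (cod P)" using assms(2) by (simp add: coker_def surj_op_def)
  have coset: "{y \<oplus>\<^bsub>cod P\<^esub> fn P x |x. x \<in> vcarrier (dom P)} = vcarrier (cod P)"
    if "y \<in> vcarrier (cod P)" for y
  proof -
    have "{y \<oplus>\<^bsub>cod P\<^esub> fn P x |x. x \<in> vcarrier (dom P)}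
        = (\<lambda>z. y \<oplus>\<^bsub>cod P\<^esub> z) ` (fn P ` vcarrier (dom P))" by auto
    also have "\<dots> = (\<lambda>z. y \<oplus>\<^bsub>cod P\<^esub> z) ` vcarrier (cod P)"
      using assms(2) by (simp only: surj_op_def)
    also have "\<dots> = vcarrier (cod P)"
    proof (intro equalityI subsetI)
      fix z assume "z \<in> vcarrier (cod P)"
      then show "z \<in> (\<lambda>z. y \<oplus>\<^bsub>cod P\<^esub> z) ` vcarrier (cod P)"
        using that Y.minus_add_cancel[of z y] Y.add_commute[of y "z \<ominus>\<^bsub>cod P\<^esub> y"] Y.minus_closed[of z y]
        by (intro image_eqI[of _ _ "z \<ominus>\<^bsub>cod P\<^esub> y"]) simp_all
    qed (use that Y.add_closed in blast)
    finally show ?thesis .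
  qed
  show carrier: "vcarrier (coker P) = {\<zero>\<^bsub>coker P\<^esub>}"
    unfolding zero using coset Y.zero_closed by (auto simp: coker_def)
  have add: "\<zero>\<^bsub>coker P\<^esub> \<oplus>\<^bsub>coker P\<^esub> \<zero>\<^bsub>coker P\<^esub> = \<zero>\<^bsub>coker P\<^esub>"
  proof -
    have "{a \<oplus>\<^bsub>cod P\<^esub> b |a b. a \<in> vcarrier (cod P) \<and> b \<in> vcarrier (cod P)} = vcarrier (cod P)"
    proof (intro equalityI subsetI)
      fix z assume "z \<in> vcarrier (cod P)"
      then show "z \<in> {a \<oplus>\<^bsub>cod P\<^esub> b |a b. a \<in> vcarrier (cod P) \<and> b \<in> vcarrier (cod P)}"
        using Y.zero_closed Y.add_zero[of z] by (intro CollectI exI[of _ z] exI[of _ "\<zero>\<^bsub>cod P\<^esub>"]) simp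
    qed (use Y.add_closed in blast)
    then show ?thesis unfolding zero by (simp add: coker_def)
  qed
  have scale: "c \<odot>\<^bsub>coker P\<^esub> \<zero>\<^bsub>coker P\<^esub> = \<zero>\<^bsub>coker P\<^esub>" for c
  proof -
    have im: "fn P ` vcarrier (dom P) = vcarrier (cod P)" using assms(2) by (simp add: surj_op_def)
    have "{(c \<odot>\<^bsub>cod P\<^esub> a) \<oplus>\<^bsub>cod P\<^esub> fn P x |a x. a \<in> vcarrier (cod P) \<and> x \<in> vcarrier (dom P)} = vcarrier (cod P)"
    proof (intro equalityI subsetI)
      fix z assume "z \<in> vcarrier (cod P)"
      then obtain x where "x \<in> vcarrier (dom P)" "z = fn P x" using im by blast
      then show "z \<in> {(c \<odot>\<^bsub>cod P\<^esub> a) \<oplus>\<^bsub>cod P\<^esub> fn P x |a x. a \<in> vcarrier (cod P) \<and> x \<in> vcarrier (dom P)}"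
        using Y.zero_closed Y.zero_add[OF \<open>z \<in> _\<close>] 
        by (intro CollectI exI[of _ "\<zero>\<^bsub>cod P\<^esub>"] exI[of _ x]) (simp add: Y.scale_zero_right)
    qed (use im Y.add_closed Y.scale_closed in blast)
    then show ?thesis unfolding zero by (simp add: coker_def)
  qed
  show "vector_space_real (coker P)"
    by unfold_locales (simp_all add: carrier add scale)
qed

text \<open>The wedge product of the basis has value \<open>1\<close> at the form \<open>\<omega>\<close> that detects the basis, and the
  vector \<open>1\<^sup>*\<close> has value \<open>1\<close> at the empty wedge product. So the tensor product of the evaluations at these
  two is not zero on the determinant vector.\<close>

lemma det_vec_surj:
  assumes "vector_space_real (ker P)" "vector_space_real (cod P)" "surj_op P"
    and "is_basis (ker P) vs" "length vs \<le> 1"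
  shows "det_vec P vs [] \<in> vcarrier (det_line P)" "det_vec P vs [] \<noteq> \<zero>\<^bsub>det_line P\<^esub>"
proof -
  obtain \<omega> where \<omega>: "\<omega> \<in> alt_forms (vdim (ker P)) (ker P)" "\<omega> vs = 1"
      "vs \<in> tuples (vdim (ker P)) (vcarrier (ker P))"
    by (rule alt_form_detects_basis[OF assms(1,4,5)])
  note C = coker_trivial[OF assms(2,3)]
  note dual = dual_elt_trivial[OF C]
  have one: "wedge (coker P) [] \<in> vcarrier (top_ext (coker P))"
    by (rule wedge_closed[OF C(1)]) (simp add: vector_space_real.vdim_trivial[OF C])
  have w: "wedge (ker P) vs \<in> vcarrier (top_ext (ker P))" by (rule wedge_closed[OF assms(1) \<omega>(3)])
  show "det_vec P vs [] \<in> vcarrier (det_line P)" unfolding det_vec_def det_line_def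
    by (intro tens_closed vector_space_top_ext vector_space_dual assms(1) C w dual)
  show "det_vec P vs [] \<noteq> \<zero>\<^bsub>det_line P\<^esub>" unfolding det_vec_def det_line_def
    by (rule tens_nonzero[where f = "\<lambda>\<xi>. \<xi> \<omega>" and g = "\<lambda>\<eta>. \<eta> (wedge (coker P) [])"])
       (use \<omega> dual one w in \<open>simp_all add: vector_space_top_ext vector_space_dual assms(1) C
          functional_on_top_ext functional_on_evaluation, simp add: wedge_def\<close>)
qed

lemma det_vec_singleton_scale:
  assumes "vector_space_real (ker P)" "vector_space_real (cod P)" "surj_op P"
    and "is_basis (ker P) [v]"
  shows "det_vec P [c \<odot>\<^bsub>ker P\<^esub> v] [] = c \<odot>\<^bsub>det_line P\<^esub> det_vec P [v] []"
proof -
  interpret K: vector_space_real "ker P" by fact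
  note C = coker_trivial[OF assms(2,3)]
  have v: "v \<in> vcarrier (ker P)" "vdim (ker P) = 1"
    using K.is_basis_singletonD[OF assms(4)] K.vdim_singleton[OF assms(4)] by auto
  have w: "wedge (ker P) [v] \<in> vcarrier (top_ext (ker P))"
    by (rule wedge_closed[OF assms(1)]) (use v in \<open>simp add: tuples_def\<close>)
  show ?thesis unfolding det_vec_def det_line_def
    by (simp add: wedge_singleton_scale[OF v(2,1)] tens_scale_left[OF w dual_elt_trivial(1)[OF C]])
qed

section \<open>Normed spaces and bounded operators\<close>

text \<open>Completeness refers to a metric, so the metric axioms are derived before it is assumed; the spaces
  constructed below are first shown to be normed and then to be complete.\<close>

locale normed_vspace = vector_space_real V for V :: "('v, 'z) nspace_scheme" (structure) +
  assumes norm_eq_zero: "x \<in> vcarrier V \<Longrightarrow> vnorm V x = 0 \<longleftrightarrow> x = \<zero>"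
    and norm_triangle: "x \<in> vcarrier V \<Longrightarrow> y \<in> vcarrier V \<Longrightarrow>
      vnorm V (x \<oplus> y) \<le> vnorm V x + vnorm V y"
    and norm_scale: "x \<in> vcarrier V \<Longrightarrow> vnorm V (c \<odot> x) = \<bar>c\<bar> * vnorm V x"

sublocale banach_space \<subseteq> normed_vspace
  by unfold_locales (rule norm_eq_zero norm_triangle norm_scale; assumption)+

lemma vminus_update_carrier [simp]: "vminus (V\<lparr>vcarrier := S\<rparr>) = vminus V"
  by (simp add: vminus_def fun_eq_iff)

context normed_vspace
begin

lemma norm_zero: "vnorm V \<zero> = 0"
  by (simp add: norm_eq_zero zero_closed)

lemma norm_minus_commute:
  "x \<in> vcarrier V \<Longrightarrow> y \<in> vcarrier V \<Longrightarrow> vnorm V (x \<ominus> y) = vnorm V (y \<ominus> x)"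
  using norm_scale[OF minus_closed, of x y "-1"] by (simp add: minus_swap)

lemma norm_nonneg: "x \<in> vcarrier V \<Longrightarrow> 0 \<le> vnorm V x"
  using norm_triangle[of x "(-1) \<odot> x"] norm_scale[of x "-1"]
  by (simp add: scale_closed add_neg norm_zero)

lemma norm_triangle_minus:
  "x \<in> vcarrier V \<Longrightarrow> y \<in> vcarrier V \<Longrightarrow> z \<in> vcarrier V \<Longrightarrow>
    vnorm V (x \<ominus> z) \<le> vnorm V (x \<ominus> y) + vnorm V (y \<ominus> z)"
  using norm_triangle[of "x \<ominus> y" "y \<ominus> z"] by (simp add: minus_trans minus_closed)

lemma norm_minus_le:
  "x \<in> vcarrier V \<Longrightarrow> y \<in> vcarrier V \<Longrightarrow> vnorm V (x \<ominus> y) \<le> vnorm V x + vnorm V y"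
  using norm_triangle[of x "(-1) \<odot> y"] norm_scale[of y "-1"] by (simp add: vminus_def scale_closed)

lemma norm_le_minus:
  "x \<in> vcarrier V \<Longrightarrow> y \<in> vcarrier V \<Longrightarrow> vnorm V x \<le> vnorm V (x \<ominus> y) + vnorm V y"
  using norm_triangle[of "x \<ominus> y" y] by (simp add: minus_add_cancel minus_closed)

sublocale metric: Metric_space "vcarrier V" "norm_dist V"
proof
  fix x y z assume "x \<in> vcarrier V" "y \<in> vcarrier V" "z \<in> vcarrier V"
  then show "norm_dist V x z \<le> norm_dist V x y + norm_dist V y z"
    by (simp add: norm_dist_def norm_triangle_minus)
qed (auto simp: norm_dist_def norm_nonneg minus_closed norm_minus_commute norm_eq_zero minus_eq_zero_iff)

lemma mcomplete_iff:
  "metric.mcomplete \<longleftrightarrow> (\<forall>\<sigma>. (\<forall>n::nat. \<sigma> n \<in> vcarrier V) \<longrightarrow>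
    (\<forall>\<epsilon>>0. \<exists>N. \<forall>m\<ge>N. \<forall>n\<ge>N. vnorm V (\<sigma> m \<ominus> \<sigma> n) < \<epsilon>) \<longrightarrow>
    (\<exists>l\<in>vcarrier V. \<forall>\<epsilon>>0. \<exists>N. \<forall>n\<ge>N. vnorm V (\<sigma> n \<ominus> l) < \<epsilon>))"
proof -
  have 1: "metric.MCauchy \<sigma> \<longleftrightarrow> (\<forall>n. \<sigma> n \<in> vcarrier V) \<and>
      (\<forall>\<epsilon>>0. \<exists>N. \<forall>m\<ge>N. \<forall>n\<ge>N. vnorm V (\<sigma> m \<ominus> \<sigma> n) < \<epsilon>)" for \<sigma>
    unfolding metric.MCauchy_def by (auto simp: norm_dist_def image_subset_iff; meson)
  have 2: "(\<forall>n. \<sigma> n \<in> vcarrier V) \<Longrightarrow> limitin metric.mtopology \<sigma> l sequentially \<longleftrightarrow>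
      l \<in> vcarrier V \<and> (\<forall>\<epsilon>>0. \<exists>N. \<forall>n\<ge>N. vnorm V (\<sigma> n \<ominus> l) < \<epsilon>)" for \<sigma> l
    unfolding metric.limit_metric_sequentially by (auto simp: norm_dist_def)
  show ?thesis unfolding metric.mcomplete_def using 1 2 by (simp add: Bex_def) blast
qed

lemma subspace_normed:
  assumes "subspace_of S V" shows "normed_vspace (V\<lparr>vcarrier := S\<rparr>)"
proof -
  interpret S: vector_space_real "V\<lparr>vcarrier := S\<rparr>" by (rule subspace[OF assms])
  show ?thesis using assms unfolding subspace_of_def
    by unfold_locales (auto simp: subset_iff norm_eq_zero norm_triangle norm_scale)
qed

lemma banach_spaceI:
  assumes "\<And>\<sigma>. (\<And>n::nat. \<sigma> n \<in> vcarrier V) \<Longrightarrow>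
      (\<And>\<epsilon>. \<epsilon> > 0 \<Longrightarrow> \<exists>N. \<forall>m\<ge>N. \<forall>n\<ge>N. vnorm V (\<sigma> m \<ominus> \<sigma> n) < \<epsilon>) \<Longrightarrow>
      \<exists>l\<in>vcarrier V. \<forall>\<epsilon>>0. \<exists>N. \<forall>n\<ge>N. vnorm V (\<sigma> n \<ominus> l) < \<epsilon>"
  shows "banach_space V"
proof
  show "metric.mcomplete" unfolding mcomplete_iff using assms by blast
qed (rule norm_eq_zero norm_triangle norm_scale; assumption)+

lemma subspace_line: 
  assumes "v \<in> vcarrier V" shows "subspace_of (range (\<lambda>c. c \<odot> v)) V"
  unfolding subspace_of_def
proof (intro conjI ballI allI)
  show "\<zero> \<in> range (\<lambda>c. c \<odot> v)" using scale_zero[OF assms] by (metis rangeI)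
qed (use assms in \<open>auto simp: scale_closed scale_scale simp flip: scale_add_left\<close>)

text \<open>The coordinates of a Cauchy sequence on a line form a Cauchy sequence of reals.\<close>

lemma banach_line:
  assumes "v \<in> vcarrier V" "v \<noteq> \<zero>"
  shows "banach_space (V\<lparr>vcarrier := range (\<lambda>c. c \<odot> v)\<rparr>)" (is "banach_space ?L")
proof -
  interpret L: normed_vspace ?L by (rule subspace_normed[OF subspace_line[OF assms(1)]])
  have pos: "vnorm V v > 0" using norm_nonneg norm_eq_zero assms by fastforce
  have dist: "vnorm V ((a \<odot> v) \<ominus> (b \<odot> v)) = \<bar>a - b\<bar> * vnorm V v" for a b
    using assms(1) by (simp add: norm_scale flip: scale_minus_left)
  show ?thesis
  proof (rule L.banach_spaceI)
    fix \<sigma> :: "nat \<Rightarrow> 'v"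
    assume in_L: "\<And>n. \<sigma> n \<in> vcarrier ?L"
      and cauchy: "\<And>\<epsilon>. \<epsilon> > 0 \<Longrightarrow> \<exists>N. \<forall>m\<ge>N. \<forall>n\<ge>N. vnorm ?L (\<sigma> m \<ominus>\<^bsub>?L\<^esub> \<sigma> n) < \<epsilon>"
    have "\<exists>c. \<sigma> n = c \<odot> v" for n using in_L[of n] by auto
    then obtain c where c: "\<And>n. \<sigma> n = c n \<odot> v" by metis
    have "Cauchy c" unfolding Cauchy_def dist_real_def
    proof (intro allI impI)
      fix \<epsilon> :: real assume "\<epsilon> > 0"
      with cauchy[of "\<epsilon> * vnorm V v"] pos
      show "\<exists>M. \<forall>m\<ge>M. \<forall>n\<ge>M. \<bar>c m - c n\<bar> < \<epsilon>" by (simp add: c dist)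
    qed
    then obtain l where l: "c \<longlonglongrightarrow> l" using Cauchy_convergent convergent_def by blast
    have "\<exists>N. \<forall>n\<ge>N. \<bar>c n - l\<bar> * vnorm V v < \<epsilon>" if "\<epsilon> > 0" for \<epsilon>
      using LIMSEQ_D[OF l, of "\<epsilon> / vnorm V v"] that pos by (simp add: field_simps)
    then show "\<exists>l\<in>vcarrier ?L. \<forall>\<epsilon>>0. \<exists>N. \<forall>n\<ge>N. vnorm ?L (\<sigma> n \<ominus>\<^bsub>?L\<^esub> l) < \<epsilon>"
      by (intro bexI[of _ "l \<odot> v"]) (simp_all add: c dist)
  qed
qed

lemma banach_zero: "banach_space (V\<lparr>vcarrier := {\<zero>}\<rparr>)" (is "banach_space ?Z")
proof -
  have "subspace_of {\<zero>} V"
    by (auto simp: subspace_of_def zero_closed add_zero scale_zero_right)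
  then interpret Z: normed_vspace ?Z by (rule subspace_normed)
  show ?thesis
    by (rule Z.banach_spaceI) (simp add: minus_self zero_closed norm_zero)
qed

end

lemma (in banach_space) cauchy_converges:
  assumes "\<And>n::nat. \<sigma> n \<in> vcarrier V"
    and "\<And>\<epsilon>. \<epsilon> > 0 \<Longrightarrow> \<exists>N. \<forall>m\<ge>N. \<forall>n\<ge>N. vnorm V (\<sigma> m \<ominus> \<sigma> n) < \<epsilon>"
  obtains l where "l \<in> vcarrier V" "\<And>\<epsilon>. \<epsilon> > 0 \<Longrightarrow> \<exists>N. \<forall>n\<ge>N. vnorm V (\<sigma> n \<ominus> l) < \<epsilon>"
proof -
  have "\<exists>l\<in>vcarrier V. \<forall>\<epsilon>>0. \<exists>N. \<forall>n\<ge>N. vnorm V (\<sigma> n \<ominus> l) < \<epsilon>"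
    using complete[unfolded mcomplete_iff, rule_format, of \<sigma>] assms by blast
  then show thesis using that by blast
qed

subsection \<open>Direct sums\<close>

lemma space_sum_simps [simp]:
  "vcarrier (X \<boxplus> Y) = {Pr x y |x y. x \<in> vcarrier X \<and> y \<in> vcarrier Y}"
  "vadd (X \<boxplus> Y) p q = Pr (lft p \<oplus>\<^bsub>X\<^esub> lft q) (rgt p \<oplus>\<^bsub>Y\<^esub> rgt q)"
  "vzero (X \<boxplus> Y) = Pr \<zero>\<^bsub>X\<^esub> \<zero>\<^bsub>Y\<^esub>"
  "vscale (X \<boxplus> Y) c p = Pr (c \<odot>\<^bsub>X\<^esub> lft p) (c \<odot>\<^bsub>Y\<^esub> rgt p)"
  "vnorm (X \<boxplus> Y) p = vnorm X (lft p) + vnorm Y (rgt p)"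
  "vminus (X \<boxplus> Y) p q = Pr (lft p \<ominus>\<^bsub>X\<^esub> lft q) (rgt p \<ominus>\<^bsub>Y\<^esub> rgt q)"
  by (simp_all add: space_sum_def vminus_def)

lemma banach_space_sum:
  assumes "banach_space X" "banach_space Y"
  shows "banach_space (X \<boxplus> Y)"
proof -
  interpret X: banach_space X by fact
  interpret Y: banach_space Y by fact
  interpret vector_space_real "X \<boxplus> Y"
    by unfold_locales
       (auto simp: X.add_closed Y.add_closed X.zero_closed Y.zero_closed X.scale_closed Y.scale_closed
         X.add_assoc Y.add_assoc X.add_zero Y.add_zero X.add_neg Y.add_neg X.scale_add_right Y.scale_add_right
         X.scale_add_left Y.scale_add_left X.scale_scale Y.scale_scale X.scale_one Y.scale_one
         intro: X.add_commute Y.add_commute)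
  interpret normed_vspace "X \<boxplus> Y"
  proof
    fix p q c assume p: "p \<in> vcarrier (X \<boxplus> Y)"
    then obtain x y where xy: "p = Pr x y" "x \<in> vcarrier X" "y \<in> vcarrier Y" by auto
    show "(vnorm (X \<boxplus> Y) p = 0) = (p = \<zero>\<^bsub>X \<boxplus> Y\<^esub>)"
      using xy X.norm_nonneg[of x] Y.norm_nonneg[of y] X.norm_eq_zero[of x] Y.norm_eq_zero[of y] by auto
    show "vnorm (X \<boxplus> Y) (c \<odot>\<^bsub>X \<boxplus> Y\<^esub> p) = \<bar>c\<bar> * vnorm (X \<boxplus> Y) p"
      using xy by (simp add: X.norm_scale Y.norm_scale distrib_left)
    assume "q \<in> vcarrier (X \<boxplus> Y)"
    then obtain x' y' where "q = Pr x' y'" "x' \<in> vcarrier X" "y' \<in> vcarrier Y" by auto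
    then show "vnorm (X \<boxplus> Y) (p \<oplus>\<^bsub>X \<boxplus> Y\<^esub> q) \<le> vnorm (X \<boxplus> Y) p + vnorm (X \<boxplus> Y) q"
      using xy X.norm_triangle[of x x'] Y.norm_triangle[of y y'] by simp
  qed
  show ?thesis
  proof (rule banach_spaceI)
    fix \<sigma> :: "nat \<Rightarrow> 'a tree"
    assume \<sigma>: "\<And>n. \<sigma> n \<in> vcarrier (X \<boxplus> Y)"
      and cauchy: "\<And>\<epsilon>. \<epsilon> > 0 \<Longrightarrow> \<exists>N. \<forall>m\<ge>N. \<forall>n\<ge>N. vnorm (X \<boxplus> Y) (\<sigma> m \<ominus>\<^bsub>X \<boxplus> Y\<^esub> \<sigma> n) < \<epsilon>"
    have in_XY: "lft (\<sigma> n) \<in> vcarrier X" "rgt (\<sigma> n) \<in> vcarrier Y" for n using \<sigma>[of n] by auto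
    have cauchy': "\<exists>N. \<forall>m\<ge>N. \<forall>n\<ge>N. vnorm X (lft (\<sigma> m) \<ominus>\<^bsub>X\<^esub> lft (\<sigma> n)) < \<epsilon> \<and>
        vnorm Y (rgt (\<sigma> m) \<ominus>\<^bsub>Y\<^esub> rgt (\<sigma> n)) < \<epsilon>" if "\<epsilon> > 0" for \<epsilon>
    proof -
      obtain N where N: "\<And>m n. m \<ge> N \<Longrightarrow> n \<ge> N \<Longrightarrow>
          vnorm X (lft (\<sigma> m) \<ominus>\<^bsub>X\<^esub> lft (\<sigma> n)) + vnorm Y (rgt (\<sigma> m) \<ominus>\<^bsub>Y\<^esub> rgt (\<sigma> n)) < \<epsilon>"
        using cauchy[OF \<open>\<epsilon> > 0\<close>] by auto
      have nonneg: "vnorm X (lft (\<sigma> m) \<ominus>\<^bsub>X\<^esub> lft (\<sigma> n)) \<ge> 0"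
          "vnorm Y (rgt (\<sigma> m) \<ominus>\<^bsub>Y\<^esub> rgt (\<sigma> n)) \<ge> 0" for m n
        using in_XY by (simp_all add: X.norm_nonneg X.minus_closed Y.norm_nonneg Y.minus_closed)
      have "vnorm X (lft (\<sigma> m) \<ominus>\<^bsub>X\<^esub> lft (\<sigma> n)) < \<epsilon>" "vnorm Y (rgt (\<sigma> m) \<ominus>\<^bsub>Y\<^esub> rgt (\<sigma> n)) < \<epsilon>"
        if "m \<ge> N" "n \<ge> N" for m n using N[OF that] nonneg[of m n] by linarith+
      then show ?thesis by blast
    qed
    obtain l where l: "l \<in> vcarrier X" "\<And>\<epsilon>. \<epsilon> > 0 \<Longrightarrow> \<exists>N. \<forall>n\<ge>N. vnorm X (lft (\<sigma> n) \<ominus>\<^bsub>X\<^esub> l) < \<epsilon>"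
      by (rule X.cauchy_converges[of "\<lambda>n. lft (\<sigma> n)"]) (use in_XY cauchy' in \<open>auto, meson\<close>)
    obtain k where k: "k \<in> vcarrier Y" "\<And>\<epsilon>. \<epsilon> > 0 \<Longrightarrow> \<exists>N. \<forall>n\<ge>N. vnorm Y (rgt (\<sigma> n) \<ominus>\<^bsub>Y\<^esub> k) < \<epsilon>"
      by (rule Y.cauchy_converges[of "\<lambda>n. rgt (\<sigma> n)"]) (use in_XY cauchy' in \<open>auto, meson\<close>)
    have "\<exists>N. \<forall>n\<ge>N. vnorm (X \<boxplus> Y) (\<sigma> n \<ominus>\<^bsub>X \<boxplus> Y\<^esub> Pr l k) < \<epsilon>" if pos: "\<epsilon> > 0" for \<epsilon>
    proof -
      obtain N N' where "\<forall>n\<ge>N. vnorm X (lft (\<sigma> n) \<ominus>\<^bsub>X\<^esub> l) < \<epsilon> / 2"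
          "\<forall>n\<ge>N'. vnorm Y (rgt (\<sigma> n) \<ominus>\<^bsub>Y\<^esub> k) < \<epsilon> / 2"
        using l(2)[of "\<epsilon> / 2"] k(2)[of "\<epsilon> / 2"] half_gt_zero[OF pos] by blast
      then show ?thesis by (intro exI[of _ "max N N'"]) fastforce
    qed
    then show "\<exists>l\<in>vcarrier (X \<boxplus> Y). \<forall>\<epsilon>>0. \<exists>N. \<forall>n\<ge>N. vnorm (X \<boxplus> Y) (\<sigma> n \<ominus>\<^bsub>X \<boxplus> Y\<^esub> l) < \<epsilon>"
      using l(1) k(1) by (intro bexI[of _ "Pr l k"]) auto
  qed
qed

subsection \<open>Bounded operators and their distance\<close>

lemma bounded_opsD:
  assumes "f \<in> bounded_ops X Y"
  shows "x \<in> vcarrier X \<Longrightarrow> f x \<in> vcarrier Y" "linear_on X Y f" "f \<in> extensional (vcarrier X)"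
  using assms by (auto simp: bounded_ops_def PiE_def)

lemma bounded_ops_linear:
  assumes "f \<in> bounded_ops X Y"
  shows "x \<in> vcarrier X \<Longrightarrow> y \<in> vcarrier X \<Longrightarrow> f (x \<oplus>\<^bsub>X\<^esub> y) = f x \<oplus>\<^bsub>Y\<^esub> f y"
    "x \<in> vcarrier X \<Longrightarrow> f (c \<odot>\<^bsub>X\<^esub> x) = c \<odot>\<^bsub>Y\<^esub> f x"
  using bounded_opsD(2)[OF assms] unfolding linear_on_def by blast+

lemma bounded_ops_zero:
  assumes "f \<in> bounded_ops X Y" "vector_space_real X" "vector_space_real Y"
  shows "f \<zero>\<^bsub>X\<^esub> = \<zero>\<^bsub>Y\<^esub>"
  using vector_space_real.linear_on_zero[OF assms(2) bounded_opsD(2)[OF assms(1)] assms(3)]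
    bounded_opsD(1)[OF assms(1)] vector_space_real.zero_closed[OF assms(2)] by blast

lemma bounded_ops_minus:
  assumes "f \<in> bounded_ops X Y" "vector_space_real X" "x \<in> vcarrier X" "y \<in> vcarrier X"
  shows "f (x \<ominus>\<^bsub>X\<^esub> y) = f x \<ominus>\<^bsub>Y\<^esub> f y"
  using vector_space_real.linear_on_minus[OF assms(2) bounded_opsD(2)[OF assms(1)] assms(3,4)] .

lemma bounded_ops_bound:
  assumes "f \<in> bounded_ops X Y" "normed_vspace X"
  obtains K where "K > 0" "\<And>x. x \<in> vcarrier X \<Longrightarrow> vnorm Y (f x) \<le> K * vnorm X x"
proof -
  interpret X: normed_vspace X by fact
  obtain K where K: "\<And>x. x \<in> vcarrier X \<Longrightarrow> vnorm Y (f x) \<le> K * vnorm X x"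
    using assms(1) unfolding bounded_ops_def by blast
  show thesis
  proof
    show "max K 1 > 0" by simp
    fix x assume x: "x \<in> vcarrier X"
    then have "K * vnorm X x \<le> max K 1 * vnorm X x"
      using X.norm_nonneg by (intro mult_right_mono) auto
    then show "vnorm Y (f x) \<le> max K 1 * vnorm X x" using K[OF x] by linarith
  qed
qed

lemma restrict_bounded_ops:
  assumes "vector_space_real X" "\<And>x. x \<in> vcarrier X \<Longrightarrow> f x \<in> vcarrier Y"
    and "\<And>x y. x \<in> vcarrier X \<Longrightarrow> y \<in> vcarrier X \<Longrightarrow> f (x \<oplus>\<^bsub>X\<^esub> y) = f x \<oplus>\<^bsub>Y\<^esub> f y"
    and "\<And>c x. x \<in> vcarrier X \<Longrightarrow> f (c \<odot>\<^bsub>X\<^esub> x) = c \<odot>\<^bsub>Y\<^esub> f x"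
    and "\<And>x. x \<in> vcarrier X \<Longrightarrow> vnorm Y (f x) \<le> K * vnorm X x"
  shows "restrict f (vcarrier X) \<in> bounded_ops X Y"
proof -
  interpret vector_space_real X by fact
  have "linear_on X Y (restrict f (vcarrier X))"
    using assms by (simp add: linear_on_def add_closed scale_closed)
  then show ?thesis using assms(2,5) unfolding bounded_ops_def by auto
qed

locale two_normed = X: normed_vspace X + Y: normed_vspace Y
  for X :: "('v, 'z) nspace_scheme" and Y :: "('w, 'y) nspace_scheme"
begin

lemma op_dist_bdd:
  assumes "f \<in> bounded_ops X Y" "g \<in> bounded_ops X Y"
  shows "bdd_above ((\<lambda>x. vnorm Y (f x \<ominus>\<^bsub>Y\<^esub> g x) / vnorm X x) ` vcarrier X)"
proof -
  obtain K where K: "K > 0" "\<And>x. x \<in> vcarrier X \<Longrightarrow> vnorm Y (f x) \<le> K * vnorm X x"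
    using bounded_ops_bound[OF assms(1) X.normed_vspace_axioms] by blast
  obtain L where L: "L > 0" "\<And>x. x \<in> vcarrier X \<Longrightarrow> vnorm Y (g x) \<le> L * vnorm X x"
    using bounded_ops_bound[OF assms(2) X.normed_vspace_axioms] by blast
  show ?thesis
  proof (rule bdd_aboveI2)
    fix x assume x: "x \<in> vcarrier X"
    have "vnorm Y (f x \<ominus>\<^bsub>Y\<^esub> g x) \<le> vnorm Y (f x) + vnorm Y (g x)"
      using bounded_opsD(1)[OF assms(1) x] bounded_opsD(1)[OF assms(2) x] by (rule Y.norm_minus_le)
    also have "\<dots> \<le> (K + L) * vnorm X x" using K(2)[OF x] L(2)[OF x] by (simp add: distrib_right)
    finally show "vnorm Y (f x \<ominus>\<^bsub>Y\<^esub> g x) / vnorm X x \<le> K + L"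
      using X.norm_nonneg[OF x] K(1) L(1)
      by (cases "vnorm X x = 0") (simp_all add: pos_divide_le_eq)
  qed
qed

lemma op_dist_bound:
  assumes "f \<in> bounded_ops X Y" "g \<in> bounded_ops X Y" "x \<in> vcarrier X"
  shows "vnorm Y (f x \<ominus>\<^bsub>Y\<^esub> g x) \<le> op_dist X Y f g * vnorm X x"
proof (cases "x = \<zero>\<^bsub>X\<^esub>")
  case True
  then show ?thesis using assms bounded_ops_zero[OF _ X.vector_space_real_axioms Y.vector_space_real_axioms, of f]
      bounded_ops_zero[OF _ X.vector_space_real_axioms Y.vector_space_real_axioms, of g]
    by (simp add: Y.minus_self Y.zero_closed Y.norm_zero X.norm_zero)
next
  case False
  then have "vnorm X x > 0" using X.norm_nonneg X.norm_eq_zero assms(3) by fastforce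
  moreover have "vnorm Y (f x \<ominus>\<^bsub>Y\<^esub> g x) / vnorm X x \<le> op_dist X Y f g"
    using cSUP_upper[OF assms(3) op_dist_bdd[OF assms(1,2)]] assms(1,2) by (simp add: op_dist_def)
  ultimately show ?thesis by (simp add: field_simps)
qed

lemma op_dist_le:
  assumes "f \<in> bounded_ops X Y" "g \<in> bounded_ops X Y" "d \<ge> 0"
    and "\<And>x. x \<in> vcarrier X \<Longrightarrow> vnorm Y (f x \<ominus>\<^bsub>Y\<^esub> g x) \<le> d * vnorm X x"
  shows "op_dist X Y f g \<le> d"
proof -
  have "vnorm Y (f x \<ominus>\<^bsub>Y\<^esub> g x) / vnorm X x \<le> d" if "x \<in> vcarrier X" for x
    using assms(3) assms(4)[OF that] X.norm_nonneg[OF that]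
    by (cases "vnorm X x = 0") (simp_all add: pos_divide_le_eq)
  then show ?thesis using assms(1,2) X.zero_closed by (auto simp: op_dist_def intro!: cSUP_least)
qed

lemma op_dist_nonneg: "op_dist X Y f g \<ge> 0"
proof (cases "f \<in> bounded_ops X Y \<and> g \<in> bounded_ops X Y")
  case True
  have "0 \<le> vnorm Y (f \<zero>\<^bsub>X\<^esub> \<ominus>\<^bsub>Y\<^esub> g \<zero>\<^bsub>X\<^esub>) / vnorm X \<zero>\<^bsub>X\<^esub>" by (simp add: X.norm_zero)
  also have "\<dots> \<le> op_dist X Y f g"
    using cSUP_upper[OF X.zero_closed op_dist_bdd] True by (simp add: op_dist_def)
  finally show ?thesis .
qed (auto simp: op_dist_def)

sublocale ops: Metric_space "bounded_ops X Y" "op_dist X Y"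
proof
  show "0 \<le> op_dist X Y f g" for f g by (rule op_dist_nonneg)
  show "op_dist X Y f g = op_dist X Y g f" for f g
  proof (cases "f \<in> bounded_ops X Y \<and> g \<in> bounded_ops X Y")
    case True
    then have "vnorm Y (f x \<ominus>\<^bsub>Y\<^esub> g x) = vnorm Y (g x \<ominus>\<^bsub>Y\<^esub> f x)" if "x \<in> vcarrier X" for x
      using bounded_opsD(1)[of f X Y, OF _ that] bounded_opsD(1)[of g X Y, OF _ that]
      by (intro Y.norm_minus_commute) auto
    with True show ?thesis by (simp add: op_dist_def cong: SUP_cong)
  qed (auto simp: op_dist_def)
next
  fix f g assume fg: "f \<in> bounded_ops X Y" "g \<in> bounded_ops X Y"
  show "op_dist X Y f g = 0 \<longleftrightarrow> f = g"
  proof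
    assume 0: "op_dist X Y f g = 0"
    have "f x = g x" if "x \<in> vcarrier X" for x
    proof -
      note in_Y = bounded_opsD(1)[OF fg(1) that] bounded_opsD(1)[OF fg(2) that]
      have "vnorm Y (f x \<ominus>\<^bsub>Y\<^esub> g x) = 0"
        using op_dist_bound[OF fg that] 0 Y.norm_nonneg[of "f x \<ominus>\<^bsub>Y\<^esub> g x"] in_Y by (simp add: Y.minus_closed)
      then show ?thesis using in_Y
        by (simp add: Y.norm_eq_zero Y.minus_closed Y.minus_eq_zero_iff)
    qed
    then show "f = g" 
      by (intro extensionalityI[OF fg[THEN bounded_opsD(3)]])
  next
    assume "f = g"
    then have "op_dist X Y f g \<le> 0" using fg
      by (intro op_dist_le) (simp_all add: bounded_opsD(1)[OF fg(1)] bounded_opsD(1)[OF fg(2)] Y.minus_self Y.norm_zero)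
    then show "op_dist X Y f g = 0" using op_dist_nonneg[of f g] by simp
  qed
next
  fix f g h assume fgh: "f \<in> bounded_ops X Y" "g \<in> bounded_ops X Y" "h \<in> bounded_ops X Y"
  show "op_dist X Y f h \<le> op_dist X Y f g + op_dist X Y g h"
  proof (rule op_dist_le)
    fix x assume x: "x \<in> vcarrier X"
    have "vnorm Y (f x \<ominus>\<^bsub>Y\<^esub> h x) \<le> vnorm Y (f x \<ominus>\<^bsub>Y\<^esub> g x) + vnorm Y (g x \<ominus>\<^bsub>Y\<^esub> h x)"
      by (intro Y.norm_triangle_minus fgh[THEN bounded_opsD(1)] x)
    then show "vnorm Y (f x \<ominus>\<^bsub>Y\<^esub> h x) \<le> (op_dist X Y f g + op_dist X Y g h) * vnorm X x"
      using op_dist_bound[OF fgh(1,2) x] op_dist_bound[OF fgh(2,3) x] by (simp add: distrib_right)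
  qed (use fgh op_dist_nonneg in \<open>simp_all add: add_nonneg_nonneg\<close>)
qed

lemma topspace_op_top [simp]: "topspace (op_top X Y) = bounded_ops X Y"
  by (simp add: op_top_def)

lemma continuous_map_op_top:
  "continuous_map T (op_top X Y) F \<longleftrightarrow> F \<in> topspace T \<rightarrow> bounded_ops X Y \<and>
    (\<forall>t\<in>topspace T. \<forall>\<epsilon>>0. \<exists>U. openin T U \<and> t \<in> U \<and> (\<forall>s\<in>U. op_dist X Y (F t) (F s) < \<epsilon>))"
proof -
  have in_ball: "(\<forall>s\<in>U. F s \<in> ops.mball (F t) \<epsilon>) \<longleftrightarrow> (\<forall>s\<in>U. op_dist X Y (F t) (F s) < \<epsilon>)"
    if "openin T U" "t \<in> U" "F \<in> topspace T \<rightarrow> bounded_ops X Y" for U t \<epsilon>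
    using that openin_subset[OF that(1)] by (auto simp: Pi_iff subset_iff)
  show ?thesis
  proof (cases "F \<in> topspace T \<rightarrow> bounded_ops X Y")
    case True
    have "(\<exists>U. openin T U \<and> t \<in> U \<and> (\<forall>s\<in>U. F s \<in> ops.mball (F t) \<epsilon>)) \<longleftrightarrow>
        (\<exists>U. openin T U \<and> t \<in> U \<and> (\<forall>s\<in>U. op_dist X Y (F t) (F s) < \<epsilon>))" for t \<epsilon>
      using in_ball[OF _ _ True] by (intro ex_cong1) blast
    then show ?thesis using True by (simp add: op_top_def ops.continuous_map_to_metric)
  next
    case False
    then show ?thesis using continuous_map_image_subset_topspace[of T "op_top X Y" F] by auto
  qed
qed

end

section \<open>Kernel bundles near a surjective operator\<close>

lemma (in vector_space_real) minus_minus_minus: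
  assumes "a \<in> vcarrier V" "b \<in> vcarrier V" "c \<in> vcarrier V" "d \<in> vcarrier V"
  shows "(a \<ominus> b) \<ominus> (c \<ominus> d) = (a \<ominus> c) \<ominus> (b \<ominus> d)"
proof -
  have "(a \<ominus> b) \<ominus> (c \<ominus> d) = (a \<ominus> c) \<oplus> (((-1) \<odot> b) \<ominus> ((-1) \<odot> d))"
    unfolding vminus_def[of _ a b] vminus_def[of _ c d] using assms
    by (intro minus_add_minus) (simp_all add: scale_closed)
  also have "((-1) \<odot> b) \<ominus> ((-1) \<odot> d) = (-1) \<odot> (b \<ominus> d)"
    using assms by (simp add: scale_minus)
  finally show ?thesis by (simp add: vminus_def[of V "a \<ominus> c"])
qed

lemma ker_simps [simp]:
  "vcarrier (ker P) = {x \<in> vcarrier (dom P). fn P x = \<zero>\<^bsub>cod P\<^esub>}"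
  "vadd (ker P) = vadd (dom P)" "vzero (ker P) = vzero (dom P)" "vscale (ker P) = vscale (dom P)"
  by (simp_all add: ker_def)

lemma vector_space_ker:
  assumes "normed_vspace (dom P)" "normed_vspace (cod P)" "fn P \<in> bounded_ops (dom P) (cod P)"
  shows "vector_space_real (ker P)"
proof -
  interpret X: normed_vspace "dom P" by fact
  interpret Y: normed_vspace "cod P" by fact
  have "subspace_of {x \<in> vcarrier (dom P). fn P x = \<zero>\<^bsub>cod P\<^esub>} (dom P)"
    unfolding subspace_of_def
    using bounded_ops_linear[OF assms(3)]
      bounded_ops_zero[OF assms(3) X.vector_space_real_axioms Y.vector_space_real_axioms]
    by (auto simp: X.zero_closed X.add_closed X.scale_closed Y.zero_closed Y.add_zero Y.scale_zero_right)
  then show ?thesis unfolding ker_def by (rule X.subspace)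
qed

text \<open>A surjective operator whose kernel has a basis is Fredholm: its cokernel is trivial.\<close>

lemma fredholm_surj:
  assumes "banach_space X" "banach_space Y" "E \<in> bounded_ops X Y"
    and "is_basis (ker (Oper X Y E)) vs" "surj_op (Oper X Y E)"
  shows "fredholm (Oper X Y E)"
proof -
  interpret X: banach_space X by fact
  interpret Y: banach_space Y by fact
  note C = coker_trivial[of "Oper X Y E", OF _ assms(5)]
  have "is_basis (coker (Oper X Y E)) []"
    using C Y.vector_space_real_axioms vector_space_real.is_basis_Nil by auto
  then show ?thesis using assms by (auto simp: fredholm_def fin_dim_def)
qed

lemma openin_surj_ball:
  assumes "normed_vspace X" "normed_vspace Y" "E0 \<in> bounded_ops X Y"
  shows "openin (subtopology (fredholm_top X Y) (surj_fredholm_ops X Y))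
    {E \<in> surj_fredholm_ops X Y. op_dist X Y E0 E < r}"
proof -
  interpret two_normed X Y by (simp add: two_normed_def assms)
  have "{E \<in> surj_fredholm_ops X Y. op_dist X Y E0 E < r}
      = (ops.mball E0 r \<inter> fredholm_ops X Y) \<inter> surj_fredholm_ops X Y"
    using assms(3) by (auto simp: surj_fredholm_ops_def fredholm_ops_def fredholm_def)
  then show ?thesis unfolding fredholm_top_def op_top_def
    by (metis openin_subtopology_Int ops.openin_mball)
qed

text \<open>An operator close to one with a bounded right inverse \<open>R\<close> is invertible along \<open>R\<close>: for each
  \<open>y\<close>, the equation \<open>E (R w) = y\<close> says that \<open>w\<close> is a fixed point of
  \<open>w \<mapsto> y + (w - E (R w))\<close>, which is a contraction of \<open>Y\<close>.\<close>

locale right_inverse =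
  fixes W :: "'v nspace" and Y :: "'v nspace" and E0 R :: "'v \<Rightarrow> 'v" and K :: real
  assumes W: "banach_space W" and Y: "banach_space Y" and E0: "E0 \<in> bounded_ops W Y"
    and R_linear: "linear_on Y W R" and R_closed: "y \<in> vcarrier Y \<Longrightarrow> R y \<in> vcarrier W"
    and R_bound: "y \<in> vcarrier Y \<Longrightarrow> vnorm W (R y) \<le> K * vnorm Y y" and K: "K > 0"
    and R_inverse: "y \<in> vcarrier Y \<Longrightarrow> E0 (R y) = y"
begin

interpretation W: banach_space W by (rule W)
interpretation Y: banach_space Y by (rule Y)
interpretation two_normed W Y ..

lemma R_minus: "y \<in> vcarrier Y \<Longrightarrow> z \<in> vcarrier Y \<Longrightarrow> R (y \<ominus>\<^bsub>Y\<^esub> z) = R y \<ominus>\<^bsub>W\<^esub> R z"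
  by (rule Y.linear_on_minus[OF R_linear])

text \<open>The radius makes \<open>1 / 2\<close> a contraction constant.\<close>

definition near :: "('v \<Rightarrow> 'v) set"
  where "near = {E \<in> bounded_ops W Y. op_dist W Y E0 E < 1 / (2 * K)}"

lemma near_bounded: "E \<in> near \<Longrightarrow> E \<in> bounded_ops W Y"
  by (simp add: near_def)

lemma E0_near: "E0 \<in> near"
  using E0 K by (simp add: near_def)

lemma near_defect:
  assumes "E \<in> near" "u \<in> vcarrier Y"
  shows "vnorm Y (u \<ominus>\<^bsub>Y\<^esub> E (R u)) \<le> 1 / 2 * vnorm Y u"
proof -
  have "vnorm Y (u \<ominus>\<^bsub>Y\<^esub> E (R u)) \<le> op_dist W Y E0 E * vnorm W (R u)"
    using op_dist_bound[OF E0 near_bounded[OF assms(1)] R_closed[OF assms(2)]] assms(2)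
    by (simp add: R_inverse)
  also have "\<dots> \<le> 1 / (2 * K) * (K * vnorm Y u)"
    using assms R_bound[OF assms(2)] W.norm_nonneg[OF R_closed[OF assms(2)]] K
    by (intro mult_mono) (auto simp: near_def)
  also have "\<dots> = 1 / 2 * vnorm Y u" using K by simp
  finally show ?thesis .
qed

lemma near_lower_bound:
  assumes "E \<in> near" "u \<in> vcarrier Y"
  shows "vnorm Y u \<le> 2 * vnorm Y (E (R u))"
  using near_defect[OF assms]
    Y.norm_le_minus[OF assms(2) bounded_opsD(1)[OF near_bounded[OF assms(1)] R_closed[OF assms(2)]]]
  by simp

lemma near_surj:
  assumes E: "E \<in> near" and y: "y \<in> vcarrier Y"
  shows "\<exists>w\<in>vcarrier Y. E (R w) = y"
proof -
  note Eb = near_bounded[OF E]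
  have ER: "E (R u) \<in> vcarrier Y" if "u \<in> vcarrier Y" for u
    by (rule bounded_opsD(1)[OF Eb R_closed[OF that]])
  define g where "g w = y \<oplus>\<^bsub>Y\<^esub> (w \<ominus>\<^bsub>Y\<^esub> E (R w))" for w
  have g_closed: "g w \<in> vcarrier Y" if "w \<in> vcarrier Y" for w
    using that y by (simp add: g_def Y.add_closed Y.minus_closed ER)
  have contraction: "norm_dist Y (g w) (g w') \<le> 1 / 2 * norm_dist Y w w'"
    if w: "w \<in> vcarrier Y" "w' \<in> vcarrier Y" for w w'
  proof -
    let ?u = "w \<ominus>\<^bsub>Y\<^esub> w'"
    have u: "?u \<in> vcarrier Y" using w by (rule Y.minus_closed)
    have "g w \<ominus>\<^bsub>Y\<^esub> g w' = (w \<ominus>\<^bsub>Y\<^esub> E (R w)) \<ominus>\<^bsub>Y\<^esub> (w' \<ominus>\<^bsub>Y\<^esub> E (R w'))"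
      unfolding g_def using y w by (intro Y.add_left_minus) (simp_all add: Y.minus_closed ER)
    also have "\<dots> = ?u \<ominus>\<^bsub>Y\<^esub> E (R ?u)"
      using w bounded_ops_minus[OF Eb W.vector_space_real_axioms R_closed R_closed, of w w']
      by (simp add: R_minus Y.minus_minus_minus ER)
    finally show ?thesis using near_defect[OF E u] w g_closed by (simp add: norm_dist_def)
  qed
  obtain w where w: "w \<in> vcarrier Y" "g w = w"
    by (rule Y.metric.Banach_fixedpoint_thm[OF Y.complete _ _ _ contraction])
       (use y g_closed in auto)
  have "y \<oplus>\<^bsub>Y\<^esub> (w \<ominus>\<^bsub>Y\<^esub> E (R w)) = E (R w) \<oplus>\<^bsub>Y\<^esub> (w \<ominus>\<^bsub>Y\<^esub> E (R w))"
    using w by (simp add: g_def Y.minus_add_cancel ER Y.minus_closed Y.add_commute[of "E (R w)"])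
  then have "y = E (R w)"
    using Y.add_left_cancel[of y "E (R w)" "w \<ominus>\<^bsub>Y\<^esub> E (R w)"] w y
    by (simp add: ER Y.minus_closed Y.add_commute[of "w \<ominus>\<^bsub>Y\<^esub> E (R w)"])
  with w show ?thesis by blast
qed

lemma near_surj_op:
  assumes "E \<in> near" shows "surj_op (Oper W Y E)"
  unfolding surj_op_def
proof (intro equalityI subsetI)
  fix y assume "y \<in> vcarrier (cod (Oper W Y E))"
  then obtain w where "w \<in> vcarrier Y" "E (R w) = y" using near_surj[OF assms] by auto
  then show "y \<in> fn (Oper W Y E) ` vcarrier (dom (Oper W Y E))" using R_closed by force
qed (use bounded_opsD(1)[OF near_bounded[OF assms]] in auto)

text \<open>If the kernel of \<open>E0\<close> is spanned by \<open>k0\<close>, then nearby kernels are spanned by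
  \<open>k0 - R w\<close>, where \<open>w\<close> solves \<open>E (R w) = E k0\<close>.\<close>

definition correction :: "'v \<Rightarrow> ('v \<Rightarrow> 'v) \<Rightarrow> 'v"
  where "correction k0 E = (SOME w. w \<in> vcarrier Y \<and> E (R w) = E k0)"

definition kernel_vector :: "'v \<Rightarrow> ('v \<Rightarrow> 'v) \<Rightarrow> 'v"
  where "kernel_vector k0 E = k0 \<ominus>\<^bsub>W\<^esub> R (correction k0 E)"

context
  fixes k0
  assumes k0: "k0 \<in> vcarrier W" "k0 \<noteq> \<zero>\<^bsub>W\<^esub>" "E0 k0 = \<zero>\<^bsub>Y\<^esub>"
    and span: "x \<in> vcarrier W \<Longrightarrow> \<exists>c. x = R (E0 x) \<oplus>\<^bsub>W\<^esub> (c \<odot>\<^bsub>W\<^esub> k0)"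
begin

lemma correction:
  assumes "E \<in> near"
  shows "correction k0 E \<in> vcarrier Y" "E (R (correction k0 E)) = E k0"
proof -
  have "\<exists>w. w \<in> vcarrier Y \<and> E (R w) = E k0"
    using near_surj[OF assms bounded_opsD(1)[OF near_bounded[OF assms] k0(1)]] by blast
  from someI_ex[OF this] show "correction k0 E \<in> vcarrier Y" "E (R (correction k0 E)) = E k0"
    unfolding correction_def by auto
qed

lemma kernel_vector_closed: "E \<in> near \<Longrightarrow> kernel_vector k0 E \<in> vcarrier W"
  unfolding kernel_vector_def by (intro W.minus_closed R_closed correction k0)

lemma kernel_vector_zero:
  assumes "E \<in> near" shows "E (kernel_vector k0 E) = \<zero>\<^bsub>Y\<^esub>"
  using bounded_ops_minus[OF near_bounded[OF assms] W.vector_space_real_axioms k0(1)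
      R_closed[OF correction(1)[OF assms]]] correction(2)[OF assms]
    bounded_opsD(1)[OF near_bounded[OF assms] k0(1)]
  by (simp add: kernel_vector_def Y.minus_self)

lemma kernel_vector_nonzero:
  assumes "E \<in> near" shows "kernel_vector k0 E \<noteq> \<zero>\<^bsub>W\<^esub>"
proof
  note w = correction(1)[OF assms]
  assume "kernel_vector k0 E = \<zero>\<^bsub>W\<^esub>"
  then have k0_eq: "k0 = R (correction k0 E)"
    using w k0(1) by (simp add: kernel_vector_def W.minus_eq_zero_iff R_closed)
  then have "correction k0 E = \<zero>\<^bsub>Y\<^esub>" using R_inverse[OF w] k0(3) by simp
  then have "k0 = \<zero>\<^bsub>W\<^esub>"
    using k0_eq Y.linear_on_zero[OF R_linear W.vector_space_real_axioms R_closed[OF Y.zero_closed]] by simp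
  with k0(2) show False by contradiction
qed

text \<open>By the splitting along \<open>R\<close>, a vector \<open>x\<close> of the kernel of \<open>E\<close> differs from a multiple of the
  kernel vector by some \<open>R u\<close>. Then \<open>E (R u) = 0\<close>, and \<open>u = 0\<close> because \<open>E\<close> is bounded below
  along \<open>R\<close>.\<close>

lemma kernel_vector_basis:
  assumes "E \<in> near" shows "is_basis (ker (Oper W Y E)) [kernel_vector k0 E]"
proof -
  note Eb = near_bounded[OF assms]
  note w = correction(1)[OF assms]
  let ?e = "kernel_vector k0 E"
  have "vector_space_real (ker (Oper W Y E))"
    by (rule vector_space_ker) (simp_all add: Eb W.normed_vspace_axioms Y.normed_vspace_axioms)
  then interpret ker: vector_space_real "ker (Oper W Y E)" .
  show ?thesis
  proof (rule ker.is_basis_singleton)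
    show "?e \<in> vcarrier (ker (Oper W Y E))"
      using kernel_vector_closed kernel_vector_zero assms by simp
    show "?e \<noteq> \<zero>\<^bsub>ker (Oper W Y E)\<^esub>" using kernel_vector_nonzero assms by simp
    fix x assume "x \<in> vcarrier (ker (Oper W Y E))"
    then have x: "x \<in> vcarrier W" "E x = \<zero>\<^bsub>Y\<^esub>" by auto
    obtain c where c: "x = R (E0 x) \<oplus>\<^bsub>W\<^esub> (c \<odot>\<^bsub>W\<^esub> k0)" using span[OF x(1)] by blast
    let ?w = "correction k0 E"
    define u where "u = E0 x \<oplus>\<^bsub>Y\<^esub> (c \<odot>\<^bsub>Y\<^esub> ?w)"
    have E0x: "E0 x \<in> vcarrier Y" by (rule bounded_opsD(1)[OF E0 x(1)])
    have u: "u \<in> vcarrier Y" unfolding u_def by (intro Y.add_closed Y.scale_closed w E0x)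
    have ce: "c \<odot>\<^bsub>W\<^esub> ?e \<in> vcarrier W" by (intro W.scale_closed kernel_vector_closed assms)
    have "R u = R (E0 x) \<oplus>\<^bsub>W\<^esub> (c \<odot>\<^bsub>W\<^esub> R ?w)"
      using R_linear E0x w unfolding u_def linear_on_def by (simp add: Y.scale_closed)
    also have "\<dots> \<oplus>\<^bsub>W\<^esub> (c \<odot>\<^bsub>W\<^esub> ?e) = x"
    proof -
      have "(c \<odot>\<^bsub>W\<^esub> R ?w) \<oplus>\<^bsub>W\<^esub> (c \<odot>\<^bsub>W\<^esub> ?e) = c \<odot>\<^bsub>W\<^esub> k0"
        using k0(1) R_closed[OF w] kernel_vector_closed[OF assms]
        by (simp add: kernel_vector_def W.minus_add_cancel W.add_commute[of "R ?w"]
              flip: W.scale_add_right)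
      then show ?thesis using c E0x w ce by (simp add: W.add_assoc R_closed W.scale_closed)
    qed
    finally have x_eq: "R u \<oplus>\<^bsub>W\<^esub> (c \<odot>\<^bsub>W\<^esub> ?e) = x" .
    have "E (R u \<oplus>\<^bsub>W\<^esub> (c \<odot>\<^bsub>W\<^esub> ?e)) = E (R u)"
      using bounded_ops_linear[OF Eb] R_closed[OF u] ce kernel_vector_closed[OF assms]
        bounded_opsD(1)[OF Eb R_closed[OF u]]
      by (simp add: kernel_vector_zero[OF assms] Y.scale_zero_right Y.add_zero)
    then have "E (R u) = \<zero>\<^bsub>Y\<^esub>" using x x_eq by simp
    then have "u = \<zero>\<^bsub>Y\<^esub>"
      using near_lower_bound[OF assms u] Y.norm_nonneg[OF u] Y.norm_eq_zero[OF u] by (simp add: Y.norm_zero)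
    then have "R u = \<zero>\<^bsub>W\<^esub>"
      using Y.linear_on_zero[OF R_linear W.vector_space_real_axioms R_closed[OF Y.zero_closed]] by simp
    then have "x = c \<odot>\<^bsub>W\<^esub> ?e" using x_eq ce by (simp add: W.zero_add)
    then show "\<exists>c. x = c \<odot>\<^bsub>ker (Oper W Y E)\<^esub> ?e" by auto
  qed
qed

text \<open>The difference \<open>u\<close> of the two corrections satisfies \<open>E' (R u) = E' e = (E' - E) e\<close>, where \<open>e\<close> is
  the kernel vector of \<open>E\<close>. So it is controlled by the operator distance, and the kernel vector is continuous
  in \<open>E\<close>.\<close>

lemma kernel_vector_dist:
  assumes "E \<in> near" "E' \<in> near"
  shows "vnorm W (kernel_vector k0 E \<ominus>\<^bsub>W\<^esub> kernel_vector k0 E')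
    \<le> 2 * K * vnorm W (kernel_vector k0 E) * op_dist W Y E E'"
proof -
  note Eb' = near_bounded[OF assms(2)]
  note w = correction(1)[OF assms(1)] and w' = correction(1)[OF assms(2)]
  let ?u = "correction k0 E' \<ominus>\<^bsub>Y\<^esub> correction k0 E" and ?e = "kernel_vector k0 E"
  note e = kernel_vector_closed[OF assms(1)]
  have u: "?u \<in> vcarrier Y" by (rule Y.minus_closed[OF w' w])
  have "E' (R ?u) = E' k0 \<ominus>\<^bsub>Y\<^esub> E' (R (correction k0 E))"
    using bounded_ops_minus[OF Eb' W.vector_space_real_axioms R_closed[OF w'] R_closed[OF w]]
      correction(2)[OF assms(2)] w w' by (simp add: R_minus)
  also have "\<dots> = E' ?e"
    unfolding kernel_vector_def
    using bounded_ops_minus[OF Eb' W.vector_space_real_axioms k0(1) R_closed[OF w]] by simp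
  finally have "vnorm Y (E' (R ?u)) = vnorm Y (E ?e \<ominus>\<^bsub>Y\<^esub> E' ?e)"
    using Y.norm_minus_commute[OF Y.zero_closed bounded_opsD(1)[OF Eb' e]]
    by (simp add: kernel_vector_zero[OF assms(1)] Y.minus_zero bounded_opsD(1)[OF Eb' e])
  then have "vnorm Y ?u \<le> 2 * vnorm Y (E ?e \<ominus>\<^bsub>Y\<^esub> E' ?e)"
    using near_lower_bound[OF assms(2) u] by simp
  also have "\<dots> \<le> 2 * (op_dist W Y E E' * vnorm W ?e)"
    using op_dist_bound[OF near_bounded[OF assms(1)] Eb' e] by simp
  finally have u_le: "vnorm Y ?u \<le> 2 * (op_dist W Y E E' * vnorm W ?e)" .
  have "?e \<ominus>\<^bsub>W\<^esub> kernel_vector k0 E' = R ?u"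
    unfolding kernel_vector_def using W.minus_left_minus[OF k0(1) R_closed[OF w] R_closed[OF w']] w w'
    by (simp add: R_minus)
  then have "vnorm W (?e \<ominus>\<^bsub>W\<^esub> kernel_vector k0 E') \<le> K * vnorm Y ?u" using R_bound[OF u] by simp
  also have "\<dots> \<le> K * (2 * (op_dist W Y E E' * vnorm W ?e))"
    using u_le K by (intro mult_left_mono) auto
  finally show ?thesis by (simp add: mult_ac)
qed

lemma kernel_line_frame:
  "kernel_frame W Y (surj_fredholm_ops W Y \<inter> near) 1 (\<lambda>_. kernel_vector k0)"
  unfolding kernel_frame_def
proof (intro conjI allI impI ballI)
  have "surj_fredholm_ops W Y \<inter> near = {E \<in> surj_fredholm_ops W Y. op_dist W Y E0 E < 1 / (2 * K)}"
    by (auto simp: near_def surj_fredholm_ops_def fredholm_ops_def fredholm_def)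
  then show "openin (subtopology (fredholm_top W Y) (surj_fredholm_ops W Y)) (surj_fredholm_ops W Y \<inter> near)"
    using openin_surj_ball[OF W.normed_vspace_axioms Y.normed_vspace_axioms E0] by simp
  show "is_basis (ker (Oper W Y E)) (map (\<lambda>i. kernel_vector k0 E) [0..<1])"
    if "E \<in> surj_fredholm_ops W Y \<inter> near" for E
    using that kernel_vector_basis by simp
  have "continuous_map (subtopology ops.mtopology near) (norm_top W) (kernel_vector k0)"
    unfolding norm_top_def W.metric.continuous_map_to_metric
  proof (intro ballI allI impI)
    fix E and \<epsilon> :: real assume "E \<in> topspace (subtopology ops.mtopology near)" "\<epsilon> > 0"
    then have E: "E \<in> near" "E \<in> bounded_ops W Y" by auto
    let ?C = "2 * K * vnorm W (kernel_vector k0 E)"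
    have C: "?C > 0" using K kernel_vector_nonzero[OF E(1)] kernel_vector_closed[OF E(1)]
        W.norm_nonneg[OF kernel_vector_closed[OF E(1)]] W.norm_eq_zero[OF kernel_vector_closed[OF E(1)]]
      by (simp add: less_le)
    show "\<exists>U. openin (subtopology ops.mtopology near) U \<and> E \<in> U \<and>
        (\<forall>E'\<in>U. kernel_vector k0 E' \<in> W.metric.mball (kernel_vector k0 E) \<epsilon>)"
    proof (intro exI conjI ballI)
      show "openin (subtopology ops.mtopology near) (near \<inter> ops.mball E (\<epsilon> / ?C))"
        by (rule openin_subtopology_Int2) simp
      show "E \<in> near \<inter> ops.mball E (\<epsilon> / ?C)" using E \<open>\<epsilon> > 0\<close> C by simp
      fix E' assume "E' \<in> near \<inter> ops.mball E (\<epsilon> / ?C)"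
      then have E': "E' \<in> near" "op_dist W Y E E' < \<epsilon> / ?C" by auto
      have "?C * op_dist W Y E E' < \<epsilon>" using E'(2) C by (simp add: pos_less_divide_eq mult.commute)
      then show "kernel_vector k0 E' \<in> W.metric.mball (kernel_vector k0 E) \<epsilon>"
        using kernel_vector_dist[OF E(1) E'(1)] kernel_vector_closed E(1) E'(1) by (simp add: norm_dist_def)
    qed
  qed
  moreover have "subtopology (fredholm_top W Y) (surj_fredholm_ops W Y \<inter> near)
      = subtopology (subtopology ops.mtopology near) (surj_fredholm_ops W Y)"
    unfolding fredholm_top_def op_top_def subtopology_subtopology
    by (rule arg_cong[of _ _ "subtopology _"]) (auto simp: surj_fredholm_ops_def)
  ultimately show "continuous_map (subtopology (fredholm_top W Y) (surj_fredholm_ops W Y \<inter> near))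
      (norm_top W) (kernel_vector k0)"
    by (simp add: continuous_map_from_subtopology)
qed

end

end

text \<open>Injectivity with a lower bound is an open condition, so kernels stay trivial near an isomorphism.\<close>

lemma trivial_kernel_near_iso:
  assumes "banach_space X" "banach_space Y" "is_iso X Y E0"
  obtains r where "r > 0"
    "\<And>E. E \<in> bounded_ops X Y \<Longrightarrow> op_dist X Y E0 E < r \<Longrightarrow> is_basis (ker (Oper X Y E)) []"
proof -
  interpret X: banach_space X by fact
  interpret Y: banach_space Y by fact
  interpret two_normed X Y ..
  obtain g where g: "g \<in> bounded_ops Y X" "\<And>x. x \<in> vcarrier X \<Longrightarrow> g (E0 x) = x"
    and E0: "E0 \<in> bounded_ops X Y" using assms(3) unfolding is_iso_def by blast
  obtain K where K: "K > 0" "\<And>y. y \<in> vcarrier Y \<Longrightarrow> vnorm X (g y) \<le> K * vnorm Y y"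
    using bounded_ops_bound[OF g(1) Y.normed_vspace_axioms] by blast
  show thesis
  proof
    show "1 / K > 0" using K by simp
    fix E assume E: "E \<in> bounded_ops X Y" "op_dist X Y E0 E < 1 / K"
    have "vector_space_real (ker (Oper X Y E))"
      by (rule vector_space_ker) (simp_all add: E X.normed_vspace_axioms Y.normed_vspace_axioms)
    then interpret ker: vector_space_real "ker (Oper X Y E)" .
    have "x = \<zero>\<^bsub>X\<^esub>" if x: "x \<in> vcarrier X" "E x = \<zero>\<^bsub>Y\<^esub>" for x
    proof (rule ccontr)
      assume "x \<noteq> \<zero>\<^bsub>X\<^esub>"
      then have pos: "vnorm X x > 0" using X.norm_nonneg[OF x(1)] X.norm_eq_zero[OF x(1)] by simp
      have E0x: "E0 x \<in> vcarrier Y" by (rule bounded_opsD(1)[OF E0 x(1)])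
      have "vnorm X x \<le> K * vnorm Y (E0 x)" using K(2)[OF E0x] g(2)[OF x(1)] by simp
      also have "\<dots> \<le> K * (op_dist X Y E0 E * vnorm X x)"
        using op_dist_bound[OF E0 E(1) x(1)] K(1) x(2) E0x by (simp add: Y.minus_zero)
      also have "\<dots> < K * (1 / K * vnorm X x)"
        using E(2) K(1) pos by (intro mult_strict_left_mono mult_strict_right_mono) auto
      also have "\<dots> = vnorm X x" using K(1) by simp
      finally show False by simp
    qed
    then have "vcarrier (ker (Oper X Y E)) = {\<zero>\<^bsub>ker (Oper X Y E)\<^esub>}"
      using ker.zero_closed by auto
    then show "is_basis (ker (Oper X Y E)) []" by (simp add: ker.is_basis_Nil)
  qed
qed

section \<open>Sections of line bundles along a path\<close>

lemma restrict_top_of_set: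
  fixes A :: "'t::topological_space set"
  shows "openin (top_of_set A) V \<Longrightarrow> subtopology (top_of_set A) V = top_of_set V"
  by (metis inf.absorb2 openin_imp_subset subtopology_subtopology)

text \<open>The homeomorphism of a local trivialization and its inverse translate between sections along a path
  and real functions.\<close>

lemma line_bundle_frame:
  assumes "line_bundle B L T" "b \<in> topspace B"
  obtains U e where "openin B U" "b \<in> U"
    "\<And>u. u \<in> U \<Longrightarrow> vector_space_real (L u) \<and> is_basis (L u) [e u]"
    "\<And>S \<gamma> k. continuous_map S B \<gamma> \<Longrightarrow> \<gamma> \<in> topspace S \<rightarrow> U \<Longrightarrow> continuous_map S euclideanreal k \<Longrightarrow>
      continuous_map S T (\<lambda>t. (\<gamma> t, k t \<odot>\<^bsub>L (\<gamma> t)\<^esub> e (\<gamma> t)))"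
    "\<And>S \<gamma> s. continuous_map S T (\<lambda>t. (\<gamma> t, s t)) \<Longrightarrow> \<gamma> \<in> topspace S \<rightarrow> U \<Longrightarrow>
      \<exists>k. continuous_map S euclideanreal k \<and> (\<forall>t\<in>topspace S. s t = k t \<odot>\<^bsub>L (\<gamma> t)\<^esub> e (\<gamma> t))"
proof -
  obtain U e where U: "openin B U" "b \<in> U" and e: "\<And>u. u \<in> U \<Longrightarrow> e u \<in> vcarrier (L u)"
    and homeo: "homeomorphic_map (prod_topology (subtopology B U) euclideanreal)
        (subtopology T (total_space U L)) (\<lambda>(u, c). (u, c \<odot>\<^bsub>L u\<^esub> e u))"
    using assms(1)[unfolded line_bundle_def, THEN conjunct2, THEN conjunct2, THEN conjunct2,
        rule_format, OF assms(2)] by blast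
  let ?h = "\<lambda>(u, c). (u, c \<odot>\<^bsub>L u\<^esub> e u)"
  have UB: "U \<subseteq> topspace B" using U(1) by (rule openin_subset)
  have vs: "vector_space_real (L u)" if "u \<in> U" for u using assms(1) UB that unfolding line_bundle_def by auto
  have topT: "topspace T = total_space (topspace B) L" using assms(1) unfolding line_bundle_def by auto
  have top_prod: "topspace (prod_topology (subtopology B U) euclideanreal) = U \<times> UNIV" using UB by auto
  have top_sub: "topspace (subtopology T (total_space U L)) = total_space U L" using UB topT by auto
  have surj: "?h ` (U \<times> UNIV) = total_space U L"
    using homeomorphic_imp_surjective_map[OF homeo] by (simp only: top_prod top_sub)
  have inj: "inj_on ?h (U \<times> UNIV)"
    using homeomorphic_imp_injective_map[OF homeo] by (simp only: top_prod)
  obtain h' where h': "homeomorphic_maps (prod_topology (subtopology B U) euclideanreal)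
      (subtopology T (total_space U L)) ?h h'"
    using homeo homeomorphic_map_maps by blast
  have basis: "is_basis (L u) [e u]" if "u \<in> U" for u
  proof -
    interpret vector_space_real "L u" by (rule vs[OF that])
    show ?thesis
    proof (rule is_basis_singleton)
      show "e u \<in> vcarrier (L u)" by (rule e[OF that])
      show "e u \<noteq> \<zero>\<^bsub>L u\<^esub>"
      proof
        assume "e u = \<zero>\<^bsub>L u\<^esub>"
        then have "?h (u, 0) = ?h (u, 1)" by (simp add: scale_zero_right)
        then show False using inj_onD[OF inj, of "(u, 0)" "(u, 1)"] that by simp
      qed
      fix x assume "x \<in> vcarrier (L u)"
      then have "(u, x) \<in> ?h ` (U \<times> UNIV)" using surj that by simp
      then show "\<exists>c. x = c \<odot>\<^bsub>L u\<^esub> e u" by auto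
    qed
  qed
  show thesis
  proof (rule that[OF U])
    show "vector_space_real (L u) \<and> is_basis (L u) [e u]" if "u \<in> U" for u
      using vs basis that by blast
  next
    fix S :: "'c topology" and \<gamma> k
    assume \<gamma>: "continuous_map S B \<gamma>" "\<gamma> \<in> topspace S \<rightarrow> U" and k: "continuous_map S euclideanreal k"
    have "continuous_map S (prod_topology (subtopology B U) euclideanreal) (\<lambda>t. (\<gamma> t, k t))"
      using \<gamma> k by (intro continuous_map_pairedI continuous_map_into_subtopology)
    then have "continuous_map S (subtopology T (total_space U L)) (?h \<circ> (\<lambda>t. (\<gamma> t, k t)))"
      by (rule continuous_map_compose) (rule homeomorphic_imp_continuous_map[OF homeo])
    then show "continuous_map S T (\<lambda>t. (\<gamma> t, k t \<odot>\<^bsub>L (\<gamma> t)\<^esub> e (\<gamma> t)))"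
      by (simp add: o_def continuous_map_in_subtopology)
  next
    fix S :: "'d topology" and \<gamma> s
    assume s: "continuous_map S T (\<lambda>t. (\<gamma> t, s t))" and \<gamma>: "\<gamma> \<in> topspace S \<rightarrow> U"
    have in_L: "(\<gamma> t, s t) \<in> total_space U L" if "t \<in> topspace S" for t
      using continuous_map_image_subset_topspace[OF s] \<gamma> that topT by auto
    then have "continuous_map S (subtopology T (total_space U L)) (\<lambda>t. (\<gamma> t, s t))"
      using s by (intro continuous_map_into_subtopology) auto
    from continuous_map_compose[OF this, of _ h'] h'
    have "continuous_map S (prod_topology (subtopology B U) euclideanreal) (h' \<circ> (\<lambda>t. (\<gamma> t, s t)))"
      unfolding homeomorphic_maps_def by blast
    from continuous_map_compose[OF this continuous_map_snd]
    have k: "continuous_map S euclideanreal (\<lambda>t. snd (h' (\<gamma> t, s t)))" by (simp add: o_def)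
    have "s t = snd (h' (\<gamma> t, s t)) \<odot>\<^bsub>L (\<gamma> t)\<^esub> e (\<gamma> t)" if "t \<in> topspace S" for t
    proof -
      have "?h (h' (\<gamma> t, s t)) = (\<gamma> t, s t)"
        using h' in_L[OF that] top_sub unfolding homeomorphic_maps_def by auto
      then show ?thesis by (auto simp: case_prod_beta)
    qed
    with k show "\<exists>k. continuous_map S euclideanreal k \<and>
        (\<forall>t\<in>topspace S. s t = k t \<odot>\<^bsub>L (\<gamma> t)\<^esub> e (\<gamma> t))" by blast
  qed
qed

lemma line_bundle_fibre:
  assumes "line_bundle B L T" "b \<in> topspace B"
  shows "vector_space_real (L b)" "v \<in> vcarrier (L b) \<Longrightarrow> v \<noteq> \<zero>\<^bsub>L b\<^esub> \<Longrightarrow> is_basis (L b) [v]"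
proof -
  show "vector_space_real (L b)" using assms unfolding line_bundle_def by auto
  then interpret vector_space_real "L b" .
  have "\<exists>e. is_basis (L b) [e]"
    by (rule line_bundle_frame[OF assms]) blast
  then obtain e where "is_basis (L b) [e]" by blast
  note e = is_basis_singletonD[OF this]
  assume v: "v \<in> vcarrier (L b)" "v \<noteq> \<zero>\<^bsub>L b\<^esub>"
  then obtain a where a: "v = a \<odot>\<^bsub>L b\<^esub> e" using e(3) by blast
  with v(2) e(1) have "a \<noteq> 0" by (auto simp: scale_zero)
  show "is_basis (L b) [v]"
  proof (rule is_basis_singleton[OF v])
    fix x assume "x \<in> vcarrier (L b)"
    then obtain c where "x = c \<odot>\<^bsub>L b\<^esub> e" using e(3) by blast
    then have "x = (c / a) \<odot>\<^bsub>L b\<^esub> v" using \<open>a \<noteq> 0\<close> a e(1) by (simp add: scale_scale)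
    then show "\<exists>c. x = c \<odot>\<^bsub>L b\<^esub> v" by blast
  qed
qed

text \<open>The constant multiples are continuous too, so that the sign of \<open>\<sigma>\<close> can be adjusted.\<close>

lemma local_section:
  fixes A :: "'t::topological_space set"
  assumes "line_bundle B L T" "continuous_map (top_of_set A) B \<gamma>" "t \<in> A"
  obtains V \<sigma> where "openin (top_of_set A) V" "t \<in> V"
    "\<And>u. u \<in> V \<Longrightarrow> \<sigma> u \<in> vcarrier (L (\<gamma> u))" "\<And>u. u \<in> V \<Longrightarrow> \<sigma> u \<noteq> \<zero>\<^bsub>L (\<gamma> u)\<^esub>"
    "\<And>c. continuous_map (top_of_set V) T (\<lambda>u. (\<gamma> u, c \<odot>\<^bsub>L (\<gamma> u)\<^esub> \<sigma> u))"
proof -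
  have \<gamma>t: "\<gamma> t \<in> topspace B" using continuous_map_image_subset_topspace[OF assms(2)] assms(3) by auto
  obtain U e where U: "openin B U" "\<gamma> t \<in> U"
    and basis: "\<And>u. u \<in> U \<Longrightarrow> vector_space_real (L u) \<and> is_basis (L u) [e u]"
    and cont: "\<And>S \<gamma> k. continuous_map S B \<gamma> \<Longrightarrow> \<gamma> \<in> topspace S \<rightarrow> U \<Longrightarrow> continuous_map S euclideanreal k \<Longrightarrow>
      continuous_map (S :: 't topology) T (\<lambda>t. (\<gamma> t, k t \<odot>\<^bsub>L (\<gamma> t)\<^esub> e (\<gamma> t)))"
    and coeff: "\<And>S \<gamma> s. continuous_map S T (\<lambda>t. (\<gamma> t, s t)) \<Longrightarrow> \<gamma> \<in> topspace S \<rightarrow> U \<Longrightarrow>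
      \<exists>k. continuous_map (S :: 't topology) euclideanreal k \<and> (\<forall>t\<in>topspace S. s t = k t \<odot>\<^bsub>L (\<gamma> t)\<^esub> e (\<gamma> t))"
    by (rule line_bundle_frame[OF assms(1) \<gamma>t]) (rule that)
  let ?V = "{u \<in> A. \<gamma> u \<in> U}"
  have V: "openin (top_of_set A) ?V"
    using openin_continuous_map_preimage[OF assms(2) U(1)] by simp
  show thesis
  proof
    show "openin (top_of_set A) ?V" by (rule V)
    show "t \<in> ?V" using assms(3) U(2) by simp
    show "e (\<gamma> u) \<in> vcarrier (L (\<gamma> u))" "e (\<gamma> u) \<noteq> \<zero>\<^bsub>L (\<gamma> u)\<^esub>" if "u \<in> ?V" for u
      using basis[of "\<gamma> u"] that vector_space_real.is_basis_singletonD(1,2)[of "L (\<gamma> u)" "e (\<gamma> u)"] by auto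
    have "continuous_map (top_of_set ?V) B \<gamma>"
      using continuous_map_from_subtopology[OF assms(2), of ?V] restrict_top_of_set[OF V] by simp
    then show "continuous_map (top_of_set ?V) T (\<lambda>u. (\<gamma> u, c \<odot>\<^bsub>L (\<gamma> u)\<^esub> e (\<gamma> u)))" for c
      by (rule cont) auto
  qed
qed

text \<open>Both sections are continuous multiples of a local frame, and the coefficient of \<open>\<sigma>\<close> has no zeros
  near \<open>t\<close>.\<close>

lemma section_ratio:
  fixes A :: "'t::topological_space set"
  assumes "line_bundle B L T" "t \<in> A"
    and \<sigma>: "continuous_map (top_of_set A) T (\<lambda>u. (\<gamma> u, \<sigma> u))" "\<sigma> t \<noteq> \<zero>\<^bsub>L (\<gamma> t)\<^esub>"
    and s: "continuous_map (top_of_set A) T (\<lambda>u. (\<gamma> u, s u))"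
  obtains V k where "openin (top_of_set A) V" "t \<in> V" "continuous_on V k"
    "\<And>u. u \<in> V \<Longrightarrow> s u = k u \<odot>\<^bsub>L (\<gamma> u)\<^esub> \<sigma> u"
proof -
  have "continuous_map T B fst" using assms(1) by (simp add: line_bundle_def)
  from continuous_map_compose[OF \<sigma>(1) this]
  have \<gamma>: "continuous_map (top_of_set A) B \<gamma>" by (simp add: o_def)
  have \<gamma>t: "\<gamma> t \<in> topspace B" using continuous_map_image_subset_topspace[OF \<gamma>] assms(2) by auto
  obtain U e where U: "openin B U" "\<gamma> t \<in> U"
    and basis: "\<And>u. u \<in> U \<Longrightarrow> vector_space_real (L u) \<and> is_basis (L u) [e u]"
    and cont: "\<And>S \<gamma> k. continuous_map S B \<gamma> \<Longrightarrow> \<gamma> \<in> topspace S \<rightarrow> U \<Longrightarrow> continuous_map S euclideanreal k \<Longrightarrow>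
      continuous_map (S :: 't topology) T (\<lambda>t. (\<gamma> t, k t \<odot>\<^bsub>L (\<gamma> t)\<^esub> e (\<gamma> t)))"
    and coeff: "\<And>S \<gamma> s. continuous_map S T (\<lambda>t. (\<gamma> t, s t)) \<Longrightarrow> \<gamma> \<in> topspace S \<rightarrow> U \<Longrightarrow>
      \<exists>k. continuous_map (S :: 't topology) euclideanreal k \<and> (\<forall>t\<in>topspace S. s t = k t \<odot>\<^bsub>L (\<gamma> t)\<^esub> e (\<gamma> t))"
    by (rule line_bundle_frame[OF assms(1) \<gamma>t]) (rule that)
  let ?V = "{u \<in> A. \<gamma> u \<in> U}"
  have V: "openin (top_of_set A) ?V"
    using openin_continuous_map_preimage[OF \<gamma> U(1)] by simp
  have on_V: "continuous_map (top_of_set ?V) T f" if "continuous_map (top_of_set A) T f" for f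
    using continuous_map_from_subtopology[OF that, of ?V] restrict_top_of_set[OF V] by simp
  obtain k1 where k1: "continuous_on ?V k1" "\<And>u. u \<in> ?V \<Longrightarrow> s u = k1 u \<odot>\<^bsub>L (\<gamma> u)\<^esub> e (\<gamma> u)"
    using coeff[OF on_V[OF s]] by auto
  obtain k2 where k2: "continuous_on ?V k2" "\<And>u. u \<in> ?V \<Longrightarrow> \<sigma> u = k2 u \<odot>\<^bsub>L (\<gamma> u)\<^esub> e (\<gamma> u)"
    using coeff[OF on_V[OF \<sigma>(1)]] by auto
  let ?W = "{u \<in> ?V. k2 u \<noteq> 0}"
  have "openin (top_of_set ?V) (?V \<inter> k2 -` (- {0}))"
    by (rule continuous_openin_preimage_gen[OF k2(1)]) auto
  moreover have "?V \<inter> k2 -` (- {0}) = ?W" by auto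
  ultimately have W: "openin (top_of_set ?V) ?W" by simp
  show thesis
  proof
    show "openin (top_of_set A) ?W" using W V openin_trans by blast
    have "k2 t \<noteq> 0"
    proof
      assume "k2 t = 0"
      then have "\<sigma> t = \<zero>\<^bsub>L (\<gamma> t)\<^esub>"
        using k2(2)[of t] assms(2) U(2) basis[of "\<gamma> t"] vector_space_real.scale_zero
          vector_space_real.is_basis_singletonD(1) by fastforce
      with \<sigma>(2) show False by contradiction
    qed
    then show "t \<in> ?W" using assms(2) U(2) by simp
    show "continuous_on ?W (\<lambda>u. k1 u / k2 u)"
      by (intro continuous_on_divide continuous_on_subset[OF k1(1)] continuous_on_subset[OF k2(1)]) auto
    fix u assume u: "u \<in> ?W"
    then have "vector_space_real (L (\<gamma> u))" "e (\<gamma> u) \<in> vcarrier (L (\<gamma> u))"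
      using basis[of "\<gamma> u"] vector_space_real.is_basis_singletonD(1) by auto
    then show "s u = (k1 u / k2 u) \<odot>\<^bsub>L (\<gamma> u)\<^esub> \<sigma> u"
      using u k1(2)[of u] k2(2)[of u] vector_space_real.scale_scale by fastforce
  qed
qed

lemma basis_in_tuples:
  assumes "vector_space_real V" "is_basis V vs" "length vs \<le> 1"
  shows "vs \<in> tuples (vdim V) (vcarrier V)"
  by (rule alt_form_detects_basis[OF assms])

section \<open>Continuous sections of determinant line bundles\<close>

lemma openin_final_topology:
  "openin (final_topology Z \<F>) W \<longleftrightarrow> W \<subseteq> Z \<and> (\<forall>(P, q)\<in>\<F>. openin P {p \<in> topspace P. q p \<in> W})"
  unfolding final_topology_def by (simp add: topology_inverse'[OF istopology_final])

lemma continuous_map_final_topology: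
  assumes "(P, q) \<in> \<F>" "q \<in> topspace P \<rightarrow> topspace (final_topology Z \<F>)"
  shows "continuous_map P (final_topology Z \<F>) q"
  using assms unfolding continuous_map_def openin_final_topology by fast

text \<open>The topology of the exterior power is final for such maps, but a point belongs to it only if it lies in
  some open set. For \<open>n \<le> 1\<close> the points over operators whose kernel has a basis of length \<open>n\<close> form an
  open set: all bases of such a kernel have length \<open>n\<close>, so its preimage under a frame is everything or
  empty.\<close>

lemma continuous_map_frame_wedge:
  assumes XY: "normed_vspace X" "normed_vspace Y" and frame: "kernel_frame X Y U n e" and n: "n \<le> 1"
    and U: "U \<subseteq> surj_fredholm_ops X Y"
  shows "continuous_map (prod_topology (subtopology (fredholm_top X Y) U) euclideanreal) (kernel_top_ext_top X Y)
    (\<lambda>(D, c). (D, c \<odot>\<^bsub>top_ext (ker (Oper X Y D))\<^esub>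
      wedge (ker (Oper X Y D)) (map (\<lambda>i. e i D) [0..<n])))" (is "continuous_map ?P _ ?q")
  unfolding kernel_top_ext_top_def
proof (rule continuous_map_final_topology)
  let ?Z = "total_space (surj_fredholm_ops X Y) (\<lambda>D. top_ext (ker (Oper X Y D)))"
  let ?q' = "\<lambda>n e (D, c). (D, c \<odot>\<^bsub>top_ext (ker (Oper X Y D))\<^esub>
      wedge (ker (Oper X Y D)) (map (\<lambda>i. e i D) [0..<n]))"
  let ?P' = "\<lambda>U. prod_topology (subtopology (fredholm_top X Y) U) euclideanreal"
  let ?F = "{(?P' U, ?q' n e) |U n e. kernel_frame X Y U n e}"
  show "(?P, ?q) \<in> ?F" using frame by blast
  interpret two_normed X Y by (simp add: two_normed_def XY)
  have ker: "vector_space_real (ker (Oper X Y D))" if "D \<in> surj_fredholm_ops X Y" for D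
    using that XY by (intro vector_space_ker) (auto simp: surj_fredholm_ops_def fredholm_ops_def fredholm_def)
  have in_Z: "?q' n e (D, c) \<in> ?Z"
    if D: "D \<in> surj_fredholm_ops X Y" and basis: "is_basis (ker (Oper X Y D)) (map (\<lambda>i. e i D) [0..<n])" for e D c
  proof -
    let ?V = "ker (Oper X Y D)"
    have "map (\<lambda>i. e i D) [0..<n] \<in> tuples (vdim ?V) (vcarrier ?V)"
      using basis_in_tuples[OF ker[OF D] basis] n by simp
    then have "wedge ?V (map (\<lambda>i. e i D) [0..<n]) \<in> vcarrier (top_ext ?V)"
      by (rule wedge_closed[OF ker[OF D]])
    then show ?thesis
      using vector_space_real.scale_closed[OF vector_space_top_ext[OF ker[OF D]]] D by simp
  qed
  define W where "W = {(D, x) \<in> ?Z. \<exists>vs. is_basis (ker (Oper X Y D)) vs \<and> length vs = n}"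
  have frame_surj: "U' \<subseteq> surj_fredholm_ops X Y" if "kernel_frame X Y U' m e'" for U' m and e' :: "nat \<Rightarrow> ('a \<Rightarrow> 'a) \<Rightarrow> 'a"
    using that openin_subset unfolding kernel_frame_def by fastforce
  have "openin (final_topology ?Z ?F) W"
    unfolding openin_final_topology
  proof (intro conjI ballI)
    show "W \<subseteq> ?Z" by (auto simp: W_def)
    fix Pq assume "Pq \<in> ?F"
    then obtain U' m e' where Pq: "Pq = (?P' U', ?q' m e')" and frame': "kernel_frame X Y U' m e'" by blast
    have basis': "is_basis (ker (Oper X Y D)) (map (\<lambda>i. e' i D) [0..<m])" if "D \<in> U'" for D
      using frame' that unfolding kernel_frame_def by blast
    have eq: "{p \<in> topspace (?P' U'). ?q' m e' p \<in> W} = (if m = n then topspace (?P' U') else {})"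
    proof (cases "m = n")
      case True
      then show ?thesis using basis' in_Z frame_surj[OF frame'] by (fastforce simp: W_def)
    next
      case False
      have "?q' m e' (D, c) \<notin> W" if "D \<in> U'" for D c
      proof
        assume "?q' m e' (D, c) \<in> W"
        then obtain vs where "is_basis (ker (Oper X Y D)) vs" "length vs = n" by (auto simp: W_def)
        then have "length (map (\<lambda>i. e' i D) [0..<m]) = n"
          using vector_space_real.basis_length_unique[OF ker _ basis'] that frame_surj[OF frame'] n by fastforce
        then show False using False by simp
      qed
      then show ?thesis using False by auto
    qed
    have "openin (?P' U') {p \<in> topspace (?P' U'). ?q' m e' p \<in> W}"
      unfolding eq by (cases "m = n") (simp_all only: refl if_True if_False openin_topspace openin_empty)
    then show "case Pq of (P, q) \<Rightarrow> openin P {p \<in> topspace P. q p \<in> W}" by (simp only: Pq prod.case)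
  qed
  then have "W \<subseteq> topspace (final_topology ?Z ?F)" by (rule openin_subset)
  moreover have "?q p \<in> W" if "p \<in> topspace ?P" for p
  proof -
    obtain D c where p: "p = (D, c)" "D \<in> U" using \<open>p \<in> topspace ?P\<close> by auto
    have basis: "is_basis (ker (Oper X Y D)) (map (\<lambda>i. e i D) [0..<n])"
      using frame p unfolding kernel_frame_def by blast
    have "?q (D, c) \<in> ?Z" by (rule in_Z) (use p U basis in auto)
    moreover have "\<exists>vs. is_basis (ker (Oper X Y D)) vs \<and> length vs = n"
      using basis by (intro exI[of _ "map (\<lambda>i. e i D) [0..<n]"]) simp
    ultimately show ?thesis by (simp add: W_def p)
  qed
  ultimately show "?q \<in> topspace ?P \<rightarrow> topspace (final_topology ?Z ?F)" by blast
qed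

context admissible_system
begin

text \<open>The first normalization axiom identifies the exterior power of the kernel bundle with the determinant bundle
  over the surjective operators by \<open>x \<mapsto> x \<otimes> 1\<^sup>*\<close>, so wedge products of kernel frames are continuous
  sections of the latter.\<close>

lemma frame_section_continuous:
  assumes X: "banach_space X" and Y: "banach_space Y" and frame: "kernel_frame X Y U n e" and n: "n \<le> 1"
    and \<gamma>: "continuous_map S (fredholm_top X Y) \<gamma>" "\<gamma> \<in> topspace S \<rightarrow> U"
  shows "continuous_map S (det_top X Y)
    (\<lambda>t. (\<gamma> t, det_vec (Oper X Y (\<gamma> t)) (map (\<lambda>i. e i (\<gamma> t)) [0..<n]) []))"
proof -
  interpret X: banach_space X by (rule X)
  interpret Y: banach_space Y by (rule Y)
  have U: "U \<subseteq> surj_fredholm_ops X Y"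
    using frame openin_subset unfolding kernel_frame_def by fastforce
  let ?h = "\<lambda>(D, x). (D, tens (top_ext (ker (Oper X Y D))) (dual (top_ext (coker (Oper X Y D)))) x
          (dual_elt (top_ext (coker (Oper X Y D))) (wedge (coker (Oper X Y D)) [])))"
  let ?q = "\<lambda>(D, c). (D, c \<odot>\<^bsub>top_ext (ker (Oper X Y D))\<^esub>
      wedge (ker (Oper X Y D)) (map (\<lambda>i. e i D) [0..<n]))"
  have "continuous_map S (prod_topology (subtopology (fredholm_top X Y) U) euclideanreal) (\<lambda>t. (\<gamma> t, 1))"
    using \<gamma> by (intro continuous_map_pairedI continuous_map_into_subtopology) auto
  from continuous_map_compose[OF continuous_map_compose[OF this
        continuous_map_frame_wedge[OF X.normed_vspace_axioms Y.normed_vspace_axioms frame n U]]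
      homeomorphic_imp_continuous_map[OF normalization_I[OF X Y]]]
  have *: "continuous_map S (det_top X Y) (\<lambda>t. ?h (?q (\<gamma> t, 1)))"
    by (simp add: continuous_map_in_subtopology o_def)
  have "?h (?q (\<gamma> t, 1)) = (\<gamma> t, det_vec (Oper X Y (\<gamma> t)) (map (\<lambda>i. e i (\<gamma> t)) [0..<n]) [])"
    if t: "t \<in> topspace S" for t
  proof -
    let ?V = "ker (Oper X Y (\<gamma> t))"
    have D: "\<gamma> t \<in> U" using \<gamma>(2) t by auto
    have V: "vector_space_real ?V"
      using D U X.normed_vspace_axioms Y.normed_vspace_axioms
      by (intro vector_space_ker) (auto simp: surj_fredholm_ops_def fredholm_ops_def fredholm_def)
    have "is_basis ?V (map (\<lambda>i. e i (\<gamma> t)) [0..<n])"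
      using frame D unfolding kernel_frame_def by blast
    then have "map (\<lambda>i. e i (\<gamma> t)) [0..<n] \<in> tuples (vdim ?V) (vcarrier ?V)"
      by (rule basis_in_tuples[OF V]) (use n in simp)
    from vector_space_real.scale_one[OF vector_space_top_ext[OF V] wedge_closed[OF V this]]
    show ?thesis by (simp add: det_vec_def)
  qed
  then show ?thesis using continuous_map_eq[OF *] by simp
qed

end

lemma banach_normed: "banach_space X \<Longrightarrow> normed_vspace X"
proof -
  assume "banach_space X"
  then interpret banach_space X .
  show ?thesis by (rule normed_vspace_axioms)
qed

lemma topspace_fredholm_top:
  assumes "banach_space X" "banach_space Y"
  shows "topspace (fredholm_top X Y) = fredholm_ops X Y"
proof -
  interpret two_normed X Y using assms by (simp add: two_normed_def banach_normed)
  show ?thesis by (auto simp: fredholm_top_def fredholm_ops_def fredholm_def)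
qed

context admissible_system
begin

section \<open>Continuity of the isomorphisms of exact triples\<close>

lemma topspace_det_top:
  assumes "banach_space X" "banach_space Y"
  shows "topspace (det_top X Y) = total_space (fredholm_ops X Y) (\<lambda>D. det_line (Oper X Y D))"
  using det_line_bundle[OF assms] topspace_fredholm_top[OF assms] by (simp add: line_bundle_def)

lemma det_line_fibre:
  fixes P :: "'a tree oper"
  assumes "fredholm P"
  shows "vector_space_real (det_line P)"
    "v \<in> vcarrier (det_line P) \<Longrightarrow> v \<noteq> \<zero>\<^bsub>det_line P\<^esub> \<Longrightarrow> is_basis (det_line P) [v]"
proof -
  have b: "banach_space (dom P)" "banach_space (cod P)" using assms by (auto simp: fredholm_def)
  have "fn P \<in> topspace (fredholm_top (dom P) (cod P))"
    using assms by (simp add: topspace_fredholm_top[OF b] fredholm_ops_def)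
  from line_bundle_fibre[OF det_line_bundle[OF b] this]
  show "vector_space_real (det_line P)"
    "v \<in> vcarrier (det_line P) \<Longrightarrow> v \<noteq> \<zero>\<^bsub>det_line P\<^esub> \<Longrightarrow> is_basis (det_line P) [v]" by auto
qed

lemma det_tens_nonzero:
  fixes P Q :: "'a tree oper"
  assumes "fredholm P" "fredholm Q"
    and "\<sigma> \<in> vcarrier (det_line P)" "\<sigma> \<noteq> \<zero>\<^bsub>det_line P\<^esub>"
    and "\<rho> \<in> vcarrier (det_line Q)" "\<rho> \<noteq> \<zero>\<^bsub>det_line Q\<^esub>"
  shows "det_tens P Q \<sigma> \<rho> \<noteq> \<zero>\<^bsub>det_tensor P Q\<^esub>"
proof -
  obtain f where f: "functional_on (det_line P) f" "f \<sigma> = 1"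
    by (rule coordinate_functional[OF det_line_fibre(1)[OF assms(1)] det_line_fibre(2)[OF assms(1,3,4)]])
  obtain g where g: "functional_on (det_line Q) g" "g \<rho> = 1"
    by (rule coordinate_functional[OF det_line_fibre(1)[OF assms(2)] det_line_fibre(2)[OF assms(2,5,6)]])
  show ?thesis unfolding det_tens_def det_tensor_def
    by (rule tens_nonzero[of _ _ _ _ f g]) (use f g assms in \<open>simp_all add: det_line_fibre\<close>)
qed

lemma det_tens_closed:
  fixes P Q :: "'a tree oper"
  shows "fredholm P \<Longrightarrow> fredholm Q \<Longrightarrow> \<sigma> \<in> vcarrier (det_line P) \<Longrightarrow> \<rho> \<in> vcarrier (det_line Q) \<Longrightarrow>
    det_tens P Q \<sigma> \<rho> \<in> vcarrier (det_tensor P Q)"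
  unfolding det_tens_def det_tensor_def by (intro tens_closed det_line_fibre)

context
  fixes X Y X' Y' X'' Y'' :: "'a tree nspace" and T :: "'a tree triple topology"
  assumes X: "banach_space X" and Y: "banach_space Y" and X': "banach_space X'" and Y': "banach_space Y'"
    and X'': "banach_space X''" and Y'': "banach_space Y''" and T: "T = triple_top X Y X' Y' X'' Y''"
begin

abbreviation (input) "left_top \<equiv>
  pullback_bundle_top T (\<lambda>t. fn (opL t)) (\<lambda>D. det_line (Oper X' Y' D)) (det_top X' Y')"
abbreviation (input) "right_top \<equiv>
  pullback_bundle_top T (\<lambda>t. fn (opR t)) (\<lambda>D. det_line (Oper X'' Y'' D)) (det_top X'' Y'')"
abbreviation (input) "middle_top \<equiv>
  pullback_bundle_top T (\<lambda>t. fn (opC t)) (\<lambda>D. det_line (Oper X Y D)) (det_top X Y)"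
abbreviation (input) "source_top \<equiv>
  tensor_bundle_top T (\<lambda>t. det_line (opL t)) left_top (\<lambda>t. det_line (opR t)) right_top"

lemma triple_in_T:
  assumes "t \<in> topspace T"
  shows "exact_triple t" "Oper X Y (fn (opC t)) = opC t" "Oper X' Y' (fn (opL t)) = opL t"
    "Oper X'' Y'' (fn (opR t)) = opR t"
  using assms by (auto simp: T triple_top_def topspace_pullback_topology)

lemma triple_fredholm:
  assumes "t \<in> topspace T" shows "fredholm (opL t)" "fredholm (opC t)" "fredholm (opR t)"
  using triple_in_T(1)[OF assms] by (auto simp: exact_triple_def)

lemma in_left_top: "(t, \<sigma>) \<in> topspace left_top \<longleftrightarrow> t \<in> topspace T \<and> \<sigma> \<in> vcarrier (det_line (opL t))"
  using triple_in_T(3)[of t] triple_fredholm(1)[of t]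
  by (auto simp: pullback_bundle_top_def topspace_pullback_topology topspace_det_top[OF X' Y'] fredholm_ops_def)

lemma in_right_top: "(t, \<sigma>) \<in> topspace right_top \<longleftrightarrow> t \<in> topspace T \<and> \<sigma> \<in> vcarrier (det_line (opR t))"
  using triple_in_T(4)[of t] triple_fredholm(3)[of t]
  by (auto simp: pullback_bundle_top_def topspace_pullback_topology topspace_det_top[OF X'' Y''] fredholm_ops_def)

lemma in_middle_top: "(t, \<sigma>) \<in> topspace middle_top \<longleftrightarrow> t \<in> topspace T \<and> \<sigma> \<in> vcarrier (det_line (opC t))"
  using triple_in_T(2)[of t] triple_fredholm(2)[of t]
  by (auto simp: pullback_bundle_top_def topspace_pullback_topology topspace_det_top[OF X Y] fredholm_ops_def)

text \<open>All the tensor products \<open>\<sigma> \<otimes> \<rho>\<close> lie in the total space, so the total space is itself open in the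
  final topology.\<close>

lemma topspace_source:
  "topspace source_top = total_space (topspace T) (\<lambda>t. det_tensor (opL t) (opR t))"
proof -
  have tens: "tens (det_line (opL t)) (det_line (opR t)) \<sigma> \<rho> \<in> vcarrier (tensor (det_line (opL t)) (det_line (opR t)))"
    if "(t, \<sigma>) \<in> topspace left_top" "(t, \<rho>) \<in> topspace right_top" for t \<sigma> \<rho>
    using that[unfolded in_left_top in_right_top] det_tens_closed triple_fredholm
    unfolding det_tens_def det_tensor_def by blast
  let ?P = "subtopology (prod_topology left_top right_top) {((b, u), (b', w)). b = b'}"
  let ?q = "\<lambda>((b :: 'a tree triple, u), (b' :: 'a tree triple, w)). (b, tens (det_line (opL b)) (det_line (opR b)) u w)"
  let ?Z = "total_space (topspace T) (\<lambda>t. tensor (det_line (opL t)) (det_line (opR t)))"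
  have "{p \<in> topspace ?P. ?q p \<in> ?Z} = topspace ?P"
    using tens by (auto simp: in_left_top)
  then have preimage: "openin ?P {p \<in> topspace ?P. ?q p \<in> ?Z}" by (simp only: openin_topspace)
  have "openin source_top ?Z"
    unfolding tensor_bundle_top_def openin_final_topology
  proof (intro conjI ballI subset_refl)
    fix Pq assume "Pq \<in> {(?P, ?q)}"
    then show "case Pq of (P, q) \<Rightarrow> openin P {p \<in> topspace P. q p \<in> ?Z}"
      using preimage by (simp only: singleton_iff prod.case)
  qed
  moreover have "topspace source_top \<subseteq> ?Z"
    using openin_topspace[of source_top] unfolding tensor_bundle_top_def openin_final_topology by blast
  ultimately show ?thesis using openin_subset unfolding det_tensor_def by blast
qed

text \<open>The homeomorphism of total spaces is injective, and in each fibre it is linear.\<close>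

lemma Psi_nonzero:
  assumes "t \<in> topspace T" "\<xi> \<in> vcarrier (det_tensor (opL t) (opR t))"
  shows "\<Psi> t \<xi> \<in> vcarrier (det_line (opC t))"
    "\<xi> \<noteq> \<zero>\<^bsub>det_tensor (opL t) (opR t)\<^esub> \<Longrightarrow> \<Psi> t \<xi> \<noteq> \<zero>\<^bsub>det_line (opC t)\<^esub>"
proof -
  note homeo = Psi_bundle_iso[OF X Y X' Y' X'' Y'' T]
  have closed: "\<Psi> t \<xi> \<in> vcarrier (det_line (opC t))"
    if "\<xi> \<in> vcarrier (det_tensor (opL t) (opR t))" for \<xi>
  proof -
    have "(t, \<xi>) \<in> topspace source_top" unfolding topspace_source using assms that by simp
    then have "(t, \<Psi> t \<xi>) \<in> topspace middle_top"
      using homeomorphic_imp_surjective_map[OF homeo] by force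
    then show ?thesis by (simp only: in_middle_top)
  qed
  then show "\<Psi> t \<xi> \<in> vcarrier (det_line (opC t))" using assms(2) .
  interpret tensor: vector_space_real "det_tensor (opL t) (opR t)"
    unfolding det_tensor_def by (intro vector_space_tensor det_line_fibre triple_fredholm assms)
  assume nz: "\<xi> \<noteq> \<zero>\<^bsub>det_tensor (opL t) (opR t)\<^esub>"
  have zero: "\<Psi> t \<zero>\<^bsub>det_tensor (opL t) (opR t)\<^esub> = \<zero>\<^bsub>det_line (opC t)\<^esub>"
    by (rule tensor.linear_on_zero[OF Psi_linear[OF triple_in_T(1)[OF assms(1)]]])
       (intro det_line_fibre triple_fredholm assms closed tensor.zero_closed)+
  show "\<Psi> t \<xi> \<noteq> \<zero>\<^bsub>det_line (opC t)\<^esub>"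
  proof
    assume "\<Psi> t \<xi> = \<zero>\<^bsub>det_line (opC t)\<^esub>"
    then have "(\<lambda>(t, \<xi>). (t, \<Psi> t \<xi>)) (t, \<xi>)
        = (\<lambda>(t, \<xi>). (t, \<Psi> t \<xi>)) (t, \<zero>\<^bsub>det_tensor (opL t) (opR t)\<^esub>)" using zero by simp
    moreover have "(t, \<xi>) \<in> topspace source_top" "(t, \<zero>\<^bsub>det_tensor (opL t) (opR t)\<^esub>) \<in> topspace source_top"
      unfolding topspace_source using assms tensor.zero_closed by simp_all
    ultimately have "(t, \<xi>) = (t, \<zero>\<^bsub>det_tensor (opL t) (opR t)\<^esub>)"
      using homeomorphic_imp_injective_map[OF homeo] by (meson inj_onD)
    then show False using nz by simp
  qed
qed

text \<open>Two sections along a path of triples are paired into the tensor product bundle by the quotient map that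
  defines its topology; the bundle isomorphism then carries the pairing to a section of the middle bundle.\<close>

lemma Psi_continuous:
  assumes \<tau>: "continuous_map S T \<tau>"
    and \<sigma>: "continuous_map S (det_top X' Y') (\<lambda>s. (fn (opL (\<tau> s)), \<sigma> s))"
    and \<rho>: "continuous_map S (det_top X'' Y'') (\<lambda>s. (fn (opR (\<tau> s)), \<rho> s))"
  shows "continuous_map S (det_top X Y)
    (\<lambda>s. (fn (opC (\<tau> s)), \<Psi> (\<tau> s) (det_tens (opL (\<tau> s)) (opR (\<tau> s)) (\<sigma> s) (\<rho> s))))"
proof -
  have in_T: "\<tau> s \<in> topspace T" if "s \<in> topspace S" for s
    using continuous_map_image_subset_topspace[OF \<tau>] that by auto
  have \<sigma>_in: "\<sigma> s \<in> vcarrier (det_line (Oper X' Y' (fn (opL (\<tau> s)))))" if "s \<in> topspace S" for s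
    using continuous_map_image_subset_topspace[OF \<sigma>] that by (auto simp: topspace_det_top[OF X' Y'])
  have \<rho>_in: "\<rho> s \<in> vcarrier (det_line (Oper X'' Y'' (fn (opR (\<tau> s)))))" if "s \<in> topspace S" for s
    using continuous_map_image_subset_topspace[OF \<rho>] that by (auto simp: topspace_det_top[OF X'' Y''])
  have left: "continuous_map S left_top (\<lambda>s. (\<tau> s, \<sigma> s))"
    unfolding pullback_bundle_top_def
    by (rule continuous_map_pullback')
       (use in_T \<sigma>_in in \<open>auto simp: o_def intro: continuous_map_pairedI \<tau> \<sigma>\<close>)
  have right: "continuous_map S right_top (\<lambda>s. (\<tau> s, \<rho> s))"
    unfolding pullback_bundle_top_def
    by (rule continuous_map_pullback')
       (use in_T \<rho>_in in \<open>auto simp: o_def intro: continuous_map_pairedI \<tau> \<rho>\<close>)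
  let ?P = "subtopology (prod_topology left_top right_top) {((b, u), (b', w)). b = b'}"
  let ?q = "\<lambda>((b :: 'a tree triple, u), (b' :: 'a tree triple, w)). (b, tens (det_line (opL b)) (det_line (opR b)) u w)"
  have "continuous_map S ?P (\<lambda>s. ((\<tau> s, \<sigma> s), (\<tau> s, \<rho> s)))"
    by (intro continuous_map_into_subtopology continuous_map_pairedI left right) auto
  moreover have "continuous_map ?P source_top ?q"
    unfolding tensor_bundle_top_def
  proof (rule continuous_map_final_topology)
    show "?q \<in> topspace ?P \<rightarrow> topspace (final_topology (total_space (topspace T)
        (\<lambda>b. tensor (det_line (opL b)) (det_line (opR b)))) {(?P, ?q)})"
      unfolding tensor_bundle_top_def[symmetric] topspace_source
      using det_tens_closed triple_fredholm unfolding det_tens_def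
      by (force simp: in_left_top in_right_top)
  qed simp
  ultimately have "continuous_map S source_top (?q \<circ> (\<lambda>s. ((\<tau> s, \<sigma> s), (\<tau> s, \<rho> s))))"
    by (rule continuous_map_compose)
  from continuous_map_compose[OF this
      homeomorphic_imp_continuous_map[OF Psi_bundle_iso[OF X Y X' Y' X'' Y'' T]]]
  have cont: "continuous_map S middle_top
      (\<lambda>s. (\<tau> s, \<Psi> (\<tau> s) (det_tens (opL (\<tau> s)) (opR (\<tau> s)) (\<sigma> s) (\<rho> s))))"
    by (simp add: o_def det_tens_def)
  have "continuous_map middle_top (prod_topology T (det_top X Y)) (\<lambda>(b, v). (b, (fn (opC b), v)))"
    unfolding pullback_bundle_top_def using continuous_map_pullback[OF continuous_map_id] by (metis id_comp)
  from continuous_map_compose[OF continuous_map_compose[OF cont this] continuous_map_snd]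
  show ?thesis by (simp add: o_def)
qed

end

end

section \<open>Stabilization of an operator by a line\<close>

text \<open>Adding the line \<open>L\<close> through \<open>y0\<close> to the domain of \<open>D : X \<rightarrow> Y\<close> gives
  \<open>stab D : X \<oplus> L \<rightarrow> Y\<close>. It is the middle of an exact triple with \<open>D\<close> on the left and the zero
  map \<open>N : L \<rightarrow> 0\<close> on the right, whose determinant line does not depend on \<open>D\<close>. The vectors have an
  arbitrary type, on which the real line itself need not be available as a space; the multiples of \<open>y0\<close>
  always are.\<close>

locale stabilization =
  fixes X Y :: "'a tree nspace" and y0 :: "'a tree"
  assumes X: "banach_space X" and Y: "banach_space Y"
    and y0: "y0 \<in> vcarrier Y" "y0 \<noteq> \<zero>\<^bsub>Y\<^esub>"
begin

interpretation X: banach_space X by (rule X)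
interpretation Y: banach_space Y by (rule Y)

definition L :: "'a tree nspace"
  where "L = Y\<lparr>vcarrier := range (\<lambda>c. c \<odot>\<^bsub>Y\<^esub> y0)\<rparr>"

definition Z :: "'a tree nspace"
  where "Z = Y\<lparr>vcarrier := {\<zero>\<^bsub>Y\<^esub>}\<rparr>"

definition stab :: "('a tree \<Rightarrow> 'a tree) \<Rightarrow> 'a tree \<Rightarrow> 'a tree"
  where "stab D = (\<lambda>p\<in>vcarrier (X \<boxplus> L). D (lft p) \<oplus>\<^bsub>Y\<^esub> rgt p)"

definition N :: "'a tree oper"
  where "N = Oper L Z (\<lambda>l\<in>vcarrier L. \<zero>\<^bsub>Y\<^esub>)"

definition stab_triple :: "('a tree \<Rightarrow> 'a tree) \<Rightarrow> 'a tree triple"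
  where "stab_triple D = \<lparr>opL = Oper X Y D, opC = Oper (X \<boxplus> L) Y (stab D), opR = N,
    iX = inj1 X L, jX = proj2 X L,
    iY = (\<lambda>y\<in>vcarrier Y. y), jY = (\<lambda>y\<in>vcarrier Y. \<zero>\<^bsub>Y\<^esub>)\<rparr>"

lemma L_simps [simp]:
  "vcarrier L = range (\<lambda>c. c \<odot>\<^bsub>Y\<^esub> y0)" "vadd L = vadd Y" "vzero L = vzero Y" "vscale L = vscale Y"
  "vnorm L = vnorm Y" "vminus L = vminus Y"
  by (simp_all add: L_def)

lemma Z_simps [simp]:
  "vcarrier Z = {\<zero>\<^bsub>Y\<^esub>}" "vadd Z = vadd Y" "vzero Z = vzero Y" "vscale Z = vscale Y"
  "vnorm Z = vnorm Y" "vminus Z = vminus Y"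
  by (simp_all add: Z_def)

lemma L: "banach_space L"
  unfolding L_def by (rule Y.banach_line[OF y0])

lemma Z: "banach_space Z"
  unfolding Z_def by (rule Y.banach_zero)

lemma XL: "banach_space (X \<boxplus> L)"
  by (rule banach_space_sum[OF X L])

lemma scale_y0: "c \<odot>\<^bsub>Y\<^esub> y0 \<in> vcarrier Y"
  using y0 by (simp add: Y.scale_closed)

interpretation L: banach_space L by (rule L)
interpretation Z: banach_space Z by (rule Z)
interpretation XL: banach_space "X \<boxplus> L" by (rule XL)
interpretation XY: two_normed X Y ..
interpretation XLY: two_normed "X \<boxplus> L" Y ..

lemma zero_in_L: "\<zero>\<^bsub>Y\<^esub> \<in> range (\<lambda>c. c \<odot>\<^bsub>Y\<^esub> y0)"
  using L.zero_closed by simp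

lemma stab_Pr: "x \<in> vcarrier X \<Longrightarrow> l \<in> vcarrier L \<Longrightarrow> stab D (Pr x l) = D x \<oplus>\<^bsub>Y\<^esub> l"
  by (auto simp: stab_def)

lemma stab_bounded:
  assumes "D \<in> bounded_ops X Y" shows "stab D \<in> bounded_ops (X \<boxplus> L) Y"
proof -
  obtain K where K: "K > 0" "\<And>x. x \<in> vcarrier X \<Longrightarrow> vnorm Y (D x) \<le> K * vnorm X x"
    using bounded_ops_bound[OF assms X.normed_vspace_axioms] by blast
  note D = bounded_opsD(1)[OF assms] and lin = bounded_ops_linear[OF assms]
  show ?thesis unfolding stab_def
  proof (rule restrict_bounded_ops[where K = "max K 1"])
    show "vector_space_real (X \<boxplus> L)" by (rule XL.vector_space_real_axioms)
  next
    fix p assume "p \<in> vcarrier (X \<boxplus> L)"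
    then obtain x a where p: "p = Pr x (a \<odot>\<^bsub>Y\<^esub> y0)" "x \<in> vcarrier X" by auto
    show "D (lft p) \<oplus>\<^bsub>Y\<^esub> rgt p \<in> vcarrier Y" using p D[of x] scale_y0 by (simp add: Y.add_closed)
    show "D (lft (c \<odot>\<^bsub>X \<boxplus> L\<^esub> p)) \<oplus>\<^bsub>Y\<^esub> rgt (c \<odot>\<^bsub>X \<boxplus> L\<^esub> p) = c \<odot>\<^bsub>Y\<^esub> (D (lft p) \<oplus>\<^bsub>Y\<^esub> rgt p)" for c
      using p D[of x] scale_y0 lin(2)[of x c] by (simp add: Y.scale_add_right)
    have "vnorm Y (D (lft p) \<oplus>\<^bsub>Y\<^esub> rgt p) \<le> vnorm Y (D x) + vnorm Y (a \<odot>\<^bsub>Y\<^esub> y0)"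
      using p D[of x] scale_y0 by (simp add: Y.norm_triangle)
    also have "\<dots> \<le> max K 1 * vnorm X x + max K 1 * vnorm Y (a \<odot>\<^bsub>Y\<^esub> y0)"
    proof (rule add_mono)
      show "vnorm Y (D x) \<le> max K 1 * vnorm X x"
        using K(2)[OF p(2)] mult_right_mono[of K "max K 1" "vnorm X x"] X.norm_nonneg[OF p(2)] by linarith
      show "vnorm Y (a \<odot>\<^bsub>Y\<^esub> y0) \<le> max K 1 * vnorm Y (a \<odot>\<^bsub>Y\<^esub> y0)"
        using mult_right_mono[of 1 "max K 1" "vnorm Y (a \<odot>\<^bsub>Y\<^esub> y0)"] Y.norm_nonneg[OF scale_y0[of a]] by simp
    qed
    finally show "vnorm Y (D (lft p) \<oplus>\<^bsub>Y\<^esub> rgt p) \<le> max K 1 * vnorm (X \<boxplus> L) p"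
      using p by (simp add: distrib_left)
    fix q assume "q \<in> vcarrier (X \<boxplus> L)"
    then obtain x' b where q: "q = Pr x' (b \<odot>\<^bsub>Y\<^esub> y0)" "x' \<in> vcarrier X" by auto
    show "D (lft (p \<oplus>\<^bsub>X \<boxplus> L\<^esub> q)) \<oplus>\<^bsub>Y\<^esub> rgt (p \<oplus>\<^bsub>X \<boxplus> L\<^esub> q) =
        (D (lft p) \<oplus>\<^bsub>Y\<^esub> rgt p) \<oplus>\<^bsub>Y\<^esub> (D (lft q) \<oplus>\<^bsub>Y\<^esub> rgt q)"
      using p q D[of x] D[of x'] scale_y0 lin(1)[of x x'] by (simp add: Y.add_ac Y.add_closed)
  qed
qed

lemma stab_dist:
  assumes "D \<in> bounded_ops X Y" "D' \<in> bounded_ops X Y"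
  shows "op_dist (X \<boxplus> L) Y (stab D) (stab D') \<le> op_dist X Y D D'"
proof (rule XLY.op_dist_le)
  fix p assume "p \<in> vcarrier (X \<boxplus> L)"
  then obtain x a where p: "p = Pr x (a \<odot>\<^bsub>Y\<^esub> y0)" "x \<in> vcarrier X" by auto
  have D: "D x \<in> vcarrier Y" "D' x \<in> vcarrier Y" using assms p bounded_opsD(1) by metis+
  have "stab D p \<ominus>\<^bsub>Y\<^esub> stab D' p = (D x \<oplus>\<^bsub>Y\<^esub> (a \<odot>\<^bsub>Y\<^esub> y0)) \<ominus>\<^bsub>Y\<^esub> (D' x \<oplus>\<^bsub>Y\<^esub> (a \<odot>\<^bsub>Y\<^esub> y0))"
    using p by (simp add: stab_Pr)
  also have "\<dots> = D x \<ominus>\<^bsub>Y\<^esub> D' x"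
    using D scale_y0 by (simp add: Y.minus_add_minus Y.minus_self Y.add_zero Y.minus_closed)
  finally have "vnorm Y (stab D p \<ominus>\<^bsub>Y\<^esub> stab D' p) \<le> op_dist X Y D D' * vnorm X x"
    using XY.op_dist_bound[OF assms p(2)] by simp
  also have "\<dots> \<le> op_dist X Y D D' * vnorm (X \<boxplus> L) p"
    using p Y.norm_nonneg[OF scale_y0] XY.op_dist_nonneg by (intro mult_left_mono) simp_all
  finally show "vnorm Y (stab D p \<ominus>\<^bsub>Y\<^esub> stab D' p) \<le> op_dist X Y D D' * vnorm (X \<boxplus> L) p" .
qed (intro stab_bounded assms XY.op_dist_nonneg)+

lemma stab_continuous:
  assumes "continuous_map S (op_top X Y) \<gamma>"
  shows "continuous_map S (op_top (X \<boxplus> L) Y) (\<lambda>s. stab (\<gamma> s))"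
  unfolding XLY.continuous_map_op_top
proof (intro conjI ballI allI impI)
  have \<gamma>: "\<gamma> s \<in> bounded_ops X Y" if "s \<in> topspace S" for s
    using assms that unfolding XY.continuous_map_op_top by auto
  then show "(\<lambda>s. stab (\<gamma> s)) \<in> topspace S \<rightarrow> bounded_ops (X \<boxplus> L) Y" by (simp add: stab_bounded)
  fix t and \<epsilon> :: real assume "t \<in> topspace S" "\<epsilon> > 0"
  then obtain U where U: "openin S U" "t \<in> U" "\<forall>s\<in>U. op_dist X Y (\<gamma> t) (\<gamma> s) < \<epsilon>"
    using assms unfolding XY.continuous_map_op_top by blast
  have "\<forall>s\<in>U. op_dist (X \<boxplus> L) Y (stab (\<gamma> t)) (stab (\<gamma> s)) < \<epsilon>"
    using U openin_subset[OF U(1)] stab_dist \<gamma> \<open>t \<in> topspace S\<close> by (meson le_less_trans subsetD)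
  with U show "\<exists>U. openin S U \<and> t \<in> U \<and>
      (\<forall>s\<in>U. op_dist (X \<boxplus> L) Y (stab (\<gamma> t)) (stab (\<gamma> s)) < \<epsilon>)" by blast
qed

lemma N_simps [simp]:
  "dom N = L" "cod N = Z" "fn N = (\<lambda>l\<in>vcarrier L. \<zero>\<^bsub>Y\<^esub>)"
  by (simp_all add: N_def)

lemma N_bounded: "fn N \<in> bounded_ops L Z"
proof -
  have "restrict (\<lambda>_. \<zero>\<^bsub>Y\<^esub>) (vcarrier L) \<in> bounded_ops L Z"
    by (rule restrict_bounded_ops[where K = 0])
       (auto simp: L.vector_space_real_axioms Y.add_zero Y.zero_closed Y.scale_zero_right Y.norm_zero)
  then show ?thesis by simp
qed

lemma vector_space_ker_N: "vector_space_real (ker N)"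
  by (rule vector_space_ker) (simp_all add: L.normed_vspace_axioms Z.normed_vspace_axioms N_bounded del: N_simps(3))

lemma N_basis: "is_basis (ker N) [y0]"
proof -
  interpret ker: vector_space_real "ker N" by (rule vector_space_ker_N)
  show ?thesis
  proof (rule ker.is_basis_singleton)
    show "y0 \<in> vcarrier (ker N)" using Y.scale_one[OF y0(1)] by (auto intro: rev_image_eqI[of 1])
  qed (use y0 in auto)
qed

lemma N_surj: "surj_op N"
  using zero_in_L by (force simp: surj_op_def)

lemma N_fredholm: "fredholm N"
  using fredholm_surj[OF L Z N_bounded] N_basis N_surj by (simp add: N_def)

lemma stab_triple_exact:
  assumes D: "fredholm (Oper X Y D)" and stab: "fredholm (Oper (X \<boxplus> L) Y (stab D))"
  shows "exact_triple (stab_triple D)"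
proof -
  have Db: "D \<in> bounded_ops X Y" using D by (simp add: fredholm_def)
  have inj: "inj1 X L \<in> bounded_ops X (X \<boxplus> L)" unfolding inj1_def
    by (rule restrict_bounded_ops[where K = 1])
       (auto simp: X.vector_space_real_axioms zero_in_L Y.add_zero Y.zero_closed Y.scale_zero_right Y.norm_zero)
  have proj: "proj2 X L \<in> bounded_ops (X \<boxplus> L) L" unfolding proj2_def
    by (rule restrict_bounded_ops[where K = 1])
       (auto simp: XL.vector_space_real_axioms X.norm_nonneg)
  have idY: "(\<lambda>y\<in>vcarrier Y. y) \<in> bounded_ops Y Y"
    by (rule restrict_bounded_ops[where K = 1]) (auto simp: Y.vector_space_real_axioms)
  have zeroY: "(\<lambda>y\<in>vcarrier Y. \<zero>\<^bsub>Y\<^esub>) \<in> bounded_ops Y Z"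
    by (rule restrict_bounded_ops[where K = 0])
       (auto simp: Y.vector_space_real_axioms Y.add_zero Y.zero_closed Y.scale_zero_right Y.norm_zero)
  have "short_exact X (X \<boxplus> L) L (inj1 X L) (proj2 X L)"
    unfolding short_exact_def using inj proj
  proof (intro conjI)
    show "inj_on (inj1 X L) (vcarrier X)" by (auto simp: inj_on_def inj1_def)
    show "inj1 X L ` vcarrier X = {x \<in> vcarrier (X \<boxplus> L). proj2 X L x = \<zero>\<^bsub>L\<^esub>}"
      using zero_in_L by (auto simp: inj1_def proj2_def image_iff)
    show "proj2 X L ` vcarrier (X \<boxplus> L) = vcarrier L"
      using X.zero_closed by (force simp: proj2_def image_iff)
  qed
  moreover have "short_exact Y Y Z (\<lambda>y\<in>vcarrier Y. y) (\<lambda>y\<in>vcarrier Y. \<zero>\<^bsub>Y\<^esub>)"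
    unfolding short_exact_def using idY zeroY Y.zero_closed by (auto simp: inj_on_def)
  moreover have "stab D (inj1 X L x) = (\<lambda>y\<in>vcarrier Y. y) (D x)" if "x \<in> vcarrier X" for x
    using that zero_in_L bounded_opsD(1)[OF Db that] by (simp add: inj1_def stab_Pr Y.add_zero)
  moreover have "fn N (proj2 X L p) = (\<lambda>y\<in>vcarrier Y. \<zero>\<^bsub>Y\<^esub>) (stab D p)" if "p \<in> vcarrier (X \<boxplus> L)" for p
    using that bounded_opsD(1)[OF stab_bounded[OF Db] that] by (auto simp: proj2_def)
  ultimately show ?thesis
    using D stab N_fredholm by (simp add: exact_triple_def stab_triple_def)
qed

lemma stab_triple_continuous:
  assumes \<gamma>: "continuous_map S (fredholm_top X Y) \<gamma>"
    and stab: "\<And>s. s \<in> topspace S \<Longrightarrow> fredholm (Oper (X \<boxplus> L) Y (stab (\<gamma> s)))"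
  shows "continuous_map S (triple_top (X \<boxplus> L) Y X Y L Z) (\<lambda>s. stab_triple (\<gamma> s))"
proof -
  have \<gamma>': "continuous_map S (op_top X Y) \<gamma>"
    using \<gamma> unfolding fredholm_top_def by (rule continuous_map_into_fulltopology)
  have exact: "exact_triple (stab_triple (\<gamma> s))" if "s \<in> topspace S" for s
    using stab_triple_exact[OF _ stab[OF that]] continuous_map_image_subset_topspace[OF \<gamma>] that
    by (auto simp: topspace_fredholm_top[OF X Y] fredholm_ops_def)
  show ?thesis
  proof (cases "topspace S = {}")
    case True
    then show ?thesis by (simp add: null_topspace_iff_trivial)
  next
    case False
    then obtain s where "s \<in> topspace S" by blast
    note ex = exact[OF this, unfolded exact_triple_def short_exact_def stab_triple_def, simplified]
    interpret LZ: two_normed L Z ..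
    interpret XXL: two_normed X "X \<boxplus> L" ..
    interpret XLL: two_normed "X \<boxplus> L" L ..
    interpret YY: two_normed Y Y ..
    interpret YZ: two_normed Y Z ..
    have const: "inj1 X L \<in> bounded_ops X (X \<boxplus> L)" "proj2 X L \<in> bounded_ops (X \<boxplus> L) L"
      "(\<lambda>y\<in>vcarrier Y. y) \<in> bounded_ops Y Y" "(\<lambda>y\<in>vcarrier Y. \<zero>\<^bsub>Y\<^esub>) \<in> bounded_ops Y Z"
      using ex by blast+
    show ?thesis unfolding triple_top_def
    proof (rule continuous_map_pullback')
      show "continuous_map S
          (prod_topology (op_top (X \<boxplus> L) Y) (prod_topology (op_top X Y) (prod_topology (op_top L Z)
            (prod_topology (op_top X (X \<boxplus> L)) (prod_topology (op_top (X \<boxplus> L) L)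
              (prod_topology (op_top Y Y) (op_top Y Z)))))))
          ((\<lambda>t. (fn (opC t), fn (opL t), fn (opR t), iX t, jX t, iY t, jY t)) \<circ> (\<lambda>s. stab_triple (\<gamma> s)))"
        unfolding o_def stab_triple_def using const N_bounded
        by (simp del: N_simps(3)) (intro continuous_map_pairedI stab_continuous \<gamma>'; simp)
    qed (use exact in \<open>auto simp: stab_triple_def\<close>)
  qed
qed

end

section \<open>Right inverses of stabilized operators\<close>

context stabilization
begin

interpretation X: banach_space X by (rule X)
interpretation Y: banach_space Y by (rule Y)
interpretation L: banach_space L by (rule L)
interpretation XL: banach_space "X \<boxplus> L" by (rule XL)

text \<open>If \<open>D\<close> is bounded below on a closed subspace \<open>S\<close>, then the image of \<open>S\<close> is closed, so
  a vector \<open>y0\<close> outside of it has positive distance from it. Otherwise there are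
  \<open>s n\<close> in \<open>S\<close> with \<open>D (s n) + y0\<close> tending to \<open>0\<close>; they form a Cauchy sequence,
  and \<open>D\<close> maps the negative of its limit to \<open>y0\<close>.\<close>

lemma coordinate_bound:
  assumes D: "D \<in> bounded_ops X Y" and S: "subspace_of S X" "closedin (norm_top X) S"
    and M: "M > 0" "\<And>s. s \<in> S \<Longrightarrow> vnorm X s \<le> M * vnorm Y (D s)" and y0_notin: "y0 \<notin> D ` S"
  obtains C where "C > 0" "\<And>s c. s \<in> S \<Longrightarrow> \<bar>c\<bar> \<le> C * vnorm Y (D s \<oplus>\<^bsub>Y\<^esub> (c \<odot>\<^bsub>Y\<^esub> y0))"
proof -
  note lin = bounded_ops_linear[OF D] and D_closed = bounded_opsD(1)[OF D]
  have SX: "s \<in> vcarrier X" if "s \<in> S" for s using S(1) that by (auto simp: subspace_of_def)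
  have S_scale: "c \<odot>\<^bsub>X\<^esub> s \<in> S" if "s \<in> S" for c s using S(1) that by (auto simp: subspace_of_def)
  have S_minus: "s \<ominus>\<^bsub>X\<^esub> s' \<in> S" if "s \<in> S" "s' \<in> S" for s s'
    using S(1) that by (auto simp: subspace_of_def vminus_def)
  have "\<exists>C>0. \<forall>s\<in>S. 1 \<le> C * vnorm Y (D s \<oplus>\<^bsub>Y\<^esub> y0)"
  proof (rule ccontr)
    assume contra: "\<not> ?thesis"
    have "\<exists>s\<in>S. real (Suc n) * vnorm Y (D s \<oplus>\<^bsub>Y\<^esub> y0) < 1" for n
    proof -
      have "real (Suc n) > 0" by simp
      with contra have "\<not> (\<forall>s\<in>S. 1 \<le> real (Suc n) * vnorm Y (D s \<oplus>\<^bsub>Y\<^esub> y0))" by blast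
      then show ?thesis by force
    qed
    then obtain s where s: "\<And>n. s n \<in> S" "\<And>n. real (Suc n) * vnorm Y (D (s n) \<oplus>\<^bsub>Y\<^esub> y0) < 1" by metis
    have small: "\<exists>N. \<forall>n\<ge>N. vnorm Y (D (s n) \<oplus>\<^bsub>Y\<^esub> y0) < \<epsilon>" if "\<epsilon> > 0" for \<epsilon>
    proof -
      obtain N where N: "1 / \<epsilon> < real N" using reals_Archimedean2 by blast
      have "vnorm Y (D (s n) \<oplus>\<^bsub>Y\<^esub> y0) < \<epsilon>" if "n \<ge> N" for n
      proof -
        have "1 / \<epsilon> < real (Suc n)" using N \<open>n \<ge> N\<close> by linarith
        then have "1 < real (Suc n) * \<epsilon>" using \<open>\<epsilon> > 0\<close> by (simp add: pos_divide_less_eq)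
        then have "real (Suc n) * vnorm Y (D (s n) \<oplus>\<^bsub>Y\<^esub> y0) < real (Suc n) * \<epsilon>" using s(2)[of n] by linarith
        then show ?thesis by (simp only: mult_less_cancel_left_pos of_nat_0_less_iff zero_less_Suc)
      qed
      then show ?thesis by blast
    qed
    have Ds: "D (s n) \<in> vcarrier Y" for n by (rule D_closed[OF SX[OF s(1)]])
    have diff: "vnorm X (s m \<ominus>\<^bsub>X\<^esub> s n)
        \<le> M * (vnorm Y (D (s m) \<oplus>\<^bsub>Y\<^esub> y0) + vnorm Y (D (s n) \<oplus>\<^bsub>Y\<^esub> y0))" for m n
    proof -
      have "D (s m \<ominus>\<^bsub>X\<^esub> s n) = (D (s m) \<oplus>\<^bsub>Y\<^esub> y0) \<ominus>\<^bsub>Y\<^esub> (D (s n) \<oplus>\<^bsub>Y\<^esub> y0)"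
        using bounded_ops_minus[OF D X.vector_space_real_axioms SX[OF s(1)] SX[OF s(1)]] Ds y0(1)
        by (simp add: Y.minus_add_minus Y.minus_self Y.add_zero Y.minus_closed)
      then have "vnorm Y (D (s m \<ominus>\<^bsub>X\<^esub> s n)) \<le> vnorm Y (D (s m) \<oplus>\<^bsub>Y\<^esub> y0) + vnorm Y (D (s n) \<oplus>\<^bsub>Y\<^esub> y0)"
        using Y.norm_minus_le Ds y0(1) by (simp add: Y.add_closed)
      then show ?thesis
        using M(2)[OF S_minus[OF s(1) s(1), of m n]] M(1) by (meson mult_left_mono order_trans less_imp_le)
    qed
    obtain l where l: "l \<in> vcarrier X" "\<And>\<epsilon>. \<epsilon> > 0 \<Longrightarrow> \<exists>N. \<forall>n\<ge>N. vnorm X (s n \<ominus>\<^bsub>X\<^esub> l) < \<epsilon>"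
    proof (rule X.cauchy_converges[of s])
      show "s n \<in> vcarrier X" for n by (rule SX[OF s(1)])
      fix \<epsilon> :: real assume "\<epsilon> > 0"
      then obtain N where N: "\<forall>n\<ge>N. vnorm Y (D (s n) \<oplus>\<^bsub>Y\<^esub> y0) < \<epsilon> / (2 * M)"
        using small[of "\<epsilon> / (2 * M)"] M(1) by auto
      have "vnorm X (s m \<ominus>\<^bsub>X\<^esub> s n) < \<epsilon>" if "m \<ge> N" "n \<ge> N" for m n
      proof -
        have "vnorm Y (D (s m) \<oplus>\<^bsub>Y\<^esub> y0) + vnorm Y (D (s n) \<oplus>\<^bsub>Y\<^esub> y0) < \<epsilon> / (2 * M) + \<epsilon> / (2 * M)"
          using N that by (intro add_strict_mono) auto
        then have "M * (vnorm Y (D (s m) \<oplus>\<^bsub>Y\<^esub> y0) + vnorm Y (D (s n) \<oplus>\<^bsub>Y\<^esub> y0))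
            < M * (\<epsilon> / (2 * M) + \<epsilon> / (2 * M))" using M(1) by (rule mult_strict_left_mono)
        also have "\<dots> = \<epsilon>" using M(1) by (simp add: field_simps)
        finally show ?thesis using diff[of m n] by linarith
      qed
      then show "\<exists>N. \<forall>m\<ge>N. \<forall>n\<ge>N. vnorm X (s m \<ominus>\<^bsub>X\<^esub> s n) < \<epsilon>" by blast
    qed (use that in blast)
    have "l \<in> S"
    proof (rule ccontr)
      assume "l \<notin> S"
      then obtain r where r: "r > 0" "disjnt S (X.metric.mball l r)"
        using S(2) l(1) unfolding norm_top_def X.metric.closedin_metric by blast
      obtain n where "vnorm X (s n \<ominus>\<^bsub>X\<^esub> l) < r" using l(2)[OF r(1)] by blast
      then have "s n \<in> X.metric.mball l r"
        using l(1) SX[OF s(1)[of n]] X.norm_minus_commute by (simp add: norm_dist_def)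
      then show False using r(2) s(1) by (auto simp: disjnt_iff)
    qed
    obtain K where K: "K > 0" "\<And>x. x \<in> vcarrier X \<Longrightarrow> vnorm Y (D x) \<le> K * vnorm X x"
      using bounded_ops_bound[OF D X.normed_vspace_axioms] by blast
    have Dl: "D l \<in> vcarrier Y" by (rule D_closed[OF l(1)])
    have le_\<epsilon>: "vnorm Y (D l \<oplus>\<^bsub>Y\<^esub> y0) \<le> \<epsilon>" if pos: "\<epsilon> > 0" for \<epsilon>
    proof -
      obtain N where N: "\<forall>n\<ge>N. vnorm X (s n \<ominus>\<^bsub>X\<^esub> l) < \<epsilon> / (2 * K)" 
        using l(2)[of "\<epsilon> / (2 * K)"] pos K(1) by auto
      obtain N' where N': "\<forall>n\<ge>N'. vnorm Y (D (s n) \<oplus>\<^bsub>Y\<^esub> y0) < \<epsilon> / 2" 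
        using small[of "\<epsilon> / 2"] pos by auto
      let ?n = "max N N'"
      have "D l \<oplus>\<^bsub>Y\<^esub> y0 = (D l \<ominus>\<^bsub>Y\<^esub> D (s ?n)) \<oplus>\<^bsub>Y\<^esub> (D (s ?n) \<oplus>\<^bsub>Y\<^esub> y0)"
        using Dl Ds y0(1) Y.minus_add_cancel[OF Dl Ds, of ?n]
        by (simp add: Y.minus_closed flip: Y.add_assoc)
      then have "vnorm Y (D l \<oplus>\<^bsub>Y\<^esub> y0) \<le> vnorm Y (D l \<ominus>\<^bsub>Y\<^esub> D (s ?n)) + vnorm Y (D (s ?n) \<oplus>\<^bsub>Y\<^esub> y0)"
        using Dl Ds y0(1) by (simp add: Y.norm_triangle Y.minus_closed Y.add_closed)
      also have "vnorm Y (D l \<ominus>\<^bsub>Y\<^esub> D (s ?n)) = vnorm Y (D (s ?n \<ominus>\<^bsub>X\<^esub> l))"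
        using bounded_ops_minus[OF D X.vector_space_real_axioms SX[OF s(1)] l(1)] Y.norm_minus_commute[OF Dl Ds] by simp
      also have "\<dots> \<le> K * vnorm X (s ?n \<ominus>\<^bsub>X\<^esub> l)" by (rule K(2)[OF X.minus_closed[OF SX[OF s(1)] l(1)]])
      also have "\<dots> \<le> K * (\<epsilon> / (2 * K))" using N K(1) by (intro mult_left_mono) (auto intro: less_imp_le)
      also have "\<dots> = \<epsilon> / 2" using K(1) by simp
      finally have "vnorm Y (D l \<oplus>\<^bsub>Y\<^esub> y0) \<le> \<epsilon> / 2 + vnorm Y (D (s ?n) \<oplus>\<^bsub>Y\<^esub> y0)" by simp
      moreover have "vnorm Y (D (s ?n) \<oplus>\<^bsub>Y\<^esub> y0) < \<epsilon> / 2" using N' by simp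
      ultimately show ?thesis by linarith
    qed
    have "vnorm Y (D l \<oplus>\<^bsub>Y\<^esub> y0) \<le> 0" by (rule field_le_epsilon) (simp add: le_\<epsilon>)
    then have "D l \<oplus>\<^bsub>Y\<^esub> y0 = \<zero>\<^bsub>Y\<^esub>"
      using Y.norm_nonneg[of "D l \<oplus>\<^bsub>Y\<^esub> y0"] Y.norm_eq_zero[of "D l \<oplus>\<^bsub>Y\<^esub> y0"] Dl y0(1) by (simp add: Y.add_closed)
    then have "y0 = (-1) \<odot>\<^bsub>Y\<^esub> D l"
      using Y.add_left_cancel[of y0 "(-1) \<odot>\<^bsub>Y\<^esub> D l" "D l"] Dl y0(1) by (simp add: Y.scale_closed Y.add_neg)
    then have "y0 = D ((-1) \<odot>\<^bsub>X\<^esub> l)" using lin(2)[OF l(1)] by simp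
    then show False using y0_notin S_scale[OF \<open>l \<in> S\<close>] by blast
  qed
  then obtain C where C: "C > 0" "\<And>s. s \<in> S \<Longrightarrow> 1 \<le> C * vnorm Y (D s \<oplus>\<^bsub>Y\<^esub> y0)" by blast
  show thesis
  proof (rule that[OF C(1)])
    fix s c assume s: "s \<in> S"
    have Ds: "D s \<in> vcarrier Y" by (rule D_closed[OF SX[OF s]])
    show "\<bar>c\<bar> \<le> C * vnorm Y (D s \<oplus>\<^bsub>Y\<^esub> (c \<odot>\<^bsub>Y\<^esub> y0))"
    proof (cases "c = 0")
      case True
      then show ?thesis using C(1) Y.norm_nonneg Ds y0(1) by (simp add: Y.add_closed Y.scale_closed)
    next
      case False
      have "D s \<oplus>\<^bsub>Y\<^esub> (c \<odot>\<^bsub>Y\<^esub> y0) = c \<odot>\<^bsub>Y\<^esub> (D ((1 / c) \<odot>\<^bsub>X\<^esub> s) \<oplus>\<^bsub>Y\<^esub> y0)"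
        using False Ds y0(1) lin(2)[OF SX[OF s]]
        by (simp add: Y.scale_add_right Y.scale_closed Y.scale_scale Y.scale_one)
      then have "vnorm Y (D s \<oplus>\<^bsub>Y\<^esub> (c \<odot>\<^bsub>Y\<^esub> y0)) = \<bar>c\<bar> * vnorm Y (D ((1 / c) \<odot>\<^bsub>X\<^esub> s) \<oplus>\<^bsub>Y\<^esub> y0)"
        using D_closed[OF SX[OF S_scale[OF s]]] y0(1) by (simp add: Y.norm_scale Y.add_closed)
      then have "C * vnorm Y (D s \<oplus>\<^bsub>Y\<^esub> (c \<odot>\<^bsub>Y\<^esub> y0)) = \<bar>c\<bar> * (C * vnorm Y (D ((1 / c) \<odot>\<^bsub>X\<^esub> s) \<oplus>\<^bsub>Y\<^esub> y0))"
        by simp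
      also have "\<dots> \<ge> \<bar>c\<bar> * 1" using C(2)[OF S_scale[OF s]] by (intro mult_left_mono) auto
      finally show ?thesis by simp
    qed
  qed
qed

text \<open>The decomposition \<open>Y = D S \<oplus> \<real> y0\<close> inverts \<open>stab D\<close> on \<open>S \<oplus> L\<close>. The inverse is
  bounded because the coordinate along \<open>y0\<close> is, and because \<open>D\<close> is bounded below on \<open>S\<close>.\<close>

lemma bounded_right_inverse:
  assumes D: "D \<in> bounded_ops X Y" and S: "subspace_of S X" "closedin (norm_top X) S"
    and M: "M > 0" "\<And>s. s \<in> S \<Longrightarrow> vnorm X s \<le> M * vnorm Y (D s)" and y0_notin: "y0 \<notin> D ` S"
    and decomp: "\<And>y. y \<in> vcarrier Y \<Longrightarrow> \<exists>s\<in>S. \<exists>c. y = D s \<oplus>\<^bsub>Y\<^esub> (c \<odot>\<^bsub>Y\<^esub> y0)"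
  obtains R K where "right_inverse (X \<boxplus> L) Y (stab D) R K"
    "\<And>s a. s \<in> S \<Longrightarrow> R (D s \<oplus>\<^bsub>Y\<^esub> (a \<odot>\<^bsub>Y\<^esub> y0)) = Pr s (a \<odot>\<^bsub>Y\<^esub> y0)"
proof -
  note lin = bounded_ops_linear[OF D] and D_closed = bounded_opsD(1)[OF D]
  obtain C where C: "C > 0" "\<And>s c. s \<in> S \<Longrightarrow> \<bar>c\<bar> \<le> C * vnorm Y (D s \<oplus>\<^bsub>Y\<^esub> (c \<odot>\<^bsub>Y\<^esub> y0))"
    using coordinate_bound[OF D S M y0_notin] by blast
  have SX: "s \<in> vcarrier X" if "s \<in> S" for s using S(1) that by (auto simp: subspace_of_def)
  have S_add: "s \<oplus>\<^bsub>X\<^esub> s' \<in> S" if "s \<in> S" "s' \<in> S" for s s'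
    using S(1) that by (auto simp: subspace_of_def)
  have S_scale: "c \<odot>\<^bsub>X\<^esub> s \<in> S" if "s \<in> S" for c s using S(1) that by (auto simp: subspace_of_def)
  have S_minus: "s \<ominus>\<^bsub>X\<^esub> s' \<in> S" if "s \<in> S" "s' \<in> S" for s s'
    using S(1) that by (auto simp: subspace_of_def vminus_def)
  have DS: "D s \<in> vcarrier Y" if "s \<in> S" for s by (rule D_closed[OF SX[OF that]])
  have unique: "s = s' \<and> a = a'"
    if s: "s \<in> S" "s' \<in> S" and eq: "D s \<oplus>\<^bsub>Y\<^esub> (a \<odot>\<^bsub>Y\<^esub> y0) = D s' \<oplus>\<^bsub>Y\<^esub> (a' \<odot>\<^bsub>Y\<^esub> y0)" for s s' a a'
  proof -
    have "D (s \<ominus>\<^bsub>X\<^esub> s') \<oplus>\<^bsub>Y\<^esub> ((a - a') \<odot>\<^bsub>Y\<^esub> y0)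
        = (D s \<oplus>\<^bsub>Y\<^esub> (a \<odot>\<^bsub>Y\<^esub> y0)) \<ominus>\<^bsub>Y\<^esub> (D s' \<oplus>\<^bsub>Y\<^esub> (a' \<odot>\<^bsub>Y\<^esub> y0))"
      using bounded_ops_minus[OF D X.vector_space_real_axioms SX[OF s(1)] SX[OF s(2)]] DS s y0(1)
      by (simp add: Y.minus_add_minus Y.scale_minus_left scale_y0)
    also have "\<dots> = \<zero>\<^bsub>Y\<^esub>" unfolding eq using DS s by (simp add: Y.minus_self Y.add_closed scale_y0)
    finally have zero: "D (s \<ominus>\<^bsub>X\<^esub> s') \<oplus>\<^bsub>Y\<^esub> ((a - a') \<odot>\<^bsub>Y\<^esub> y0) = \<zero>\<^bsub>Y\<^esub>" .
    with C(2)[OF S_minus[OF s], of "a - a'"] have a: "a = a'" by (simp add: Y.norm_zero)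
    with zero have "D (s \<ominus>\<^bsub>X\<^esub> s') = \<zero>\<^bsub>Y\<^esub>" using DS[OF S_minus[OF s]] y0(1) by (simp add: Y.scale_zero Y.add_zero)
    then have "vnorm X (s \<ominus>\<^bsub>X\<^esub> s') \<le> 0" using M(2)[OF S_minus[OF s]] by (simp add: Y.norm_zero)
    then have "s = s'"
      using X.norm_nonneg[of "s \<ominus>\<^bsub>X\<^esub> s'"] X.norm_eq_zero[of "s \<ominus>\<^bsub>X\<^esub> s'"] s SX
      by (simp add: X.minus_closed X.minus_eq_zero_iff)
    with a show ?thesis by simp
  qed
  define R where "R y = (SOME p. \<exists>s\<in>S. \<exists>a. p = Pr s (a \<odot>\<^bsub>Y\<^esub> y0) \<and> y = D s \<oplus>\<^bsub>Y\<^esub> (a \<odot>\<^bsub>Y\<^esub> y0))" for y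
  have R: "R (D s \<oplus>\<^bsub>Y\<^esub> (a \<odot>\<^bsub>Y\<^esub> y0)) = Pr s (a \<odot>\<^bsub>Y\<^esub> y0)" if "s \<in> S" for s a
    unfolding R_def
  proof (rule some_equality)
    show "\<exists>s'\<in>S. \<exists>a'. Pr s (a \<odot>\<^bsub>Y\<^esub> y0) = Pr s' (a' \<odot>\<^bsub>Y\<^esub> y0) \<and>
        D s \<oplus>\<^bsub>Y\<^esub> (a \<odot>\<^bsub>Y\<^esub> y0) = D s' \<oplus>\<^bsub>Y\<^esub> (a' \<odot>\<^bsub>Y\<^esub> y0)" using that by blast
    fix p assume "\<exists>s'\<in>S. \<exists>a'. p = Pr s' (a' \<odot>\<^bsub>Y\<^esub> y0) \<and>
        D s \<oplus>\<^bsub>Y\<^esub> (a \<odot>\<^bsub>Y\<^esub> y0) = D s' \<oplus>\<^bsub>Y\<^esub> (a' \<odot>\<^bsub>Y\<^esub> y0)"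
    then show "p = Pr s (a \<odot>\<^bsub>Y\<^esub> y0)" using unique[OF that] by metis
  qed
  \<comment> \<open>If \<open>y = D s + a y0\<close>, then \<open>\<bar>a\<bar> \<le> C \<parallel>y\<parallel>\<close> and \<open>\<parallel>s\<parallel> \<le> M (\<parallel>y\<parallel> + \<bar>a\<bar> \<parallel>y0\<parallel>)\<close>, and the norm of
    \<open>R y\<close> is \<open>\<parallel>s\<parallel> + \<bar>a\<bar> \<parallel>y0\<parallel>\<close>.\<close>
  define K where "K = M + (M + 1) * (C * vnorm Y y0)"
  have y0_norm: "vnorm Y y0 \<ge> 0" by (rule Y.norm_nonneg[OF y0(1)])
  have "right_inverse (X \<boxplus> L) Y (stab D) R K"
  proof
    show "K > 0" unfolding K_def using M(1) C(1) y0_norm by (intro add_pos_nonneg mult_nonneg_nonneg) auto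
    show "linear_on Y (X \<boxplus> L) R" unfolding linear_on_def
    proof (intro conjI ballI allI)
      fix y c assume "y \<in> vcarrier Y"
      then obtain s a where y: "s \<in> S" "y = D s \<oplus>\<^bsub>Y\<^esub> (a \<odot>\<^bsub>Y\<^esub> y0)" using decomp by blast
      have "c \<odot>\<^bsub>Y\<^esub> y = D (c \<odot>\<^bsub>X\<^esub> s) \<oplus>\<^bsub>Y\<^esub> ((c * a) \<odot>\<^bsub>Y\<^esub> y0)"
        using y DS[OF y(1)] y0(1) lin(2)[OF SX[OF y(1)]] by (simp add: Y.scale_add_right Y.scale_scale scale_y0)
      then show "R (c \<odot>\<^bsub>Y\<^esub> y) = c \<odot>\<^bsub>X \<boxplus> L\<^esub> R y"
        using R[OF S_scale[OF y(1)]] R[OF y(1)] y y0(1) by (simp add: Y.scale_scale)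
      fix y' assume "y' \<in> vcarrier Y"
      then obtain s' a' where y': "s' \<in> S" "y' = D s' \<oplus>\<^bsub>Y\<^esub> (a' \<odot>\<^bsub>Y\<^esub> y0)" using decomp by blast
      have sum: "y \<oplus>\<^bsub>Y\<^esub> y' = D (s \<oplus>\<^bsub>X\<^esub> s') \<oplus>\<^bsub>Y\<^esub> ((a + a') \<odot>\<^bsub>Y\<^esub> y0)"
        using y y' DS[OF y(1)] DS[OF y'(1)] y0(1) lin(1)[OF SX[OF y(1)] SX[OF y'(1)]]
        by (simp add: Y.scale_add_left Y.add_ac Y.add_closed scale_y0)
      have "R (y \<oplus>\<^bsub>Y\<^esub> y') = Pr (s \<oplus>\<^bsub>X\<^esub> s') ((a + a') \<odot>\<^bsub>Y\<^esub> y0)"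
        unfolding sum by (rule R[OF S_add[OF y(1) y'(1)]])
      then show "R (y \<oplus>\<^bsub>Y\<^esub> y') = R y \<oplus>\<^bsub>X \<boxplus> L\<^esub> R y'"
        using R[OF y(1)] R[OF y'(1)] y(2) y'(2) y0(1) by (simp add: Y.scale_add_left)
    qed
    fix y assume y_in: "y \<in> vcarrier Y"
    then obtain s a where y: "s \<in> S" "y = D s \<oplus>\<^bsub>Y\<^esub> (a \<odot>\<^bsub>Y\<^esub> y0)" using decomp by blast
    have Ry: "R y = Pr s (a \<odot>\<^bsub>Y\<^esub> y0)" using R[OF y(1)] y(2) by simp
    show "R y \<in> vcarrier (X \<boxplus> L)" using Ry SX[OF y(1)] by auto
    show "stab D (R y) = y" using Ry y SX[OF y(1)] by (simp add: stab_Pr)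
    have a: "\<bar>a\<bar> * vnorm Y y0 \<le> C * vnorm Y y * vnorm Y y0"
      using C(2)[OF y(1), of a] y(2) y0_norm by (intro mult_right_mono) auto
    have "vnorm Y (D s) \<le> vnorm Y y + \<bar>a\<bar> * vnorm Y y0"
      using Y.norm_minus_le[OF y_in scale_y0, of a] y DS[OF y(1)] y0(1)
      by (simp add: Y.add_minus_cancel scale_y0 Y.norm_scale)
    then have "vnorm Y (D s) \<le> vnorm Y y + C * vnorm Y y * vnorm Y y0" using a by linarith
    then have "M * vnorm Y (D s) \<le> M * (vnorm Y y + C * vnorm Y y * vnorm Y y0)"
      using M(1) by (intro mult_left_mono) auto
    then have "vnorm X s + \<bar>a\<bar> * vnorm Y y0
        \<le> M * (vnorm Y y + C * vnorm Y y * vnorm Y y0) + C * vnorm Y y * vnorm Y y0"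
      using M(2)[OF y(1)] a by linarith
    also have "\<dots> = K * vnorm Y y" by (simp add: K_def algebra_simps)
    finally show "vnorm (X \<boxplus> L) (R y) \<le> K * vnorm Y y" using Ry y0(1) by (simp add: Y.norm_scale)
  qed (intro XL Y stab_bounded D)+
  then show thesis using that R by blast
qed

end

section \<open>Determinant sections near a regular point and near a degeneration\<close>

lemma is_isoD:
  assumes "banach_space X" "banach_space Y" "is_iso X Y D"
  shows "D \<in> bounded_ops X Y" "surj_op (Oper X Y D)" "is_basis (ker (Oper X Y D)) []"
    "vdim (ker (Oper X Y D)) = 0" "vector_space_real (ker (Oper X Y D))" "inj_on D (vcarrier X)"
proof -
  interpret Y: banach_space Y by fact
  interpret X: banach_space X by fact
  obtain g where g: "g \<in> bounded_ops Y X" "\<And>x. x \<in> vcarrier X \<Longrightarrow> g (D x) = x"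
      "\<And>y. y \<in> vcarrier Y \<Longrightarrow> D (g y) = y" and D: "D \<in> bounded_ops X Y"
    using assms(3) unfolding is_iso_def by blast
  show "D \<in> bounded_ops X Y" by (rule D)
  show "surj_op (Oper X Y D)" unfolding surj_op_def
    using bounded_opsD(1)[OF D] bounded_opsD(1)[OF g(1)] g(3) by (force simp: image_iff)
  show "inj_on D (vcarrier X)" using g(2) by (metis inj_onI)
  show V: "vector_space_real (ker (Oper X Y D))"
    by (rule vector_space_ker) (simp_all add: D banach_normed assms)
  obtain r where r: "r > 0"
      "\<And>E. E \<in> bounded_ops X Y \<Longrightarrow> op_dist X Y D E < r \<Longrightarrow> is_basis (ker (Oper X Y E)) []"
    using trivial_kernel_near_iso[OF assms] by blast
  interpret two_normed X Y ..
  show b: "is_basis (ker (Oper X Y D)) []" using r D by simp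
  then show "vdim (ker (Oper X Y D)) = 0"
    using vector_space_real.vdim_trivial[OF V] vector_space_real.is_basis_Nil[OF V] by simp
qed

abbreviation canonical_vector :: "'a tree nspace \<Rightarrow> 'a tree nspace \<Rightarrow> ('a tree \<Rightarrow> 'a tree) \<Rightarrow> 'a tree det_elt"
  where "canonical_vector X Y D \<equiv> det_vec (Oper X Y D) [] []"

lemma canonical_vector_nonzero:
  assumes "banach_space X" "banach_space Y" "is_iso X Y D"
  shows "canonical_vector X Y D \<in> vcarrier (det_line (Oper X Y D))"
    "canonical_vector X Y D \<noteq> \<zero>\<^bsub>det_line (Oper X Y D)\<^esub>"
proof -
  interpret Y: banach_space Y by fact
  show "canonical_vector X Y D \<in> vcarrier (det_line (Oper X Y D))"
    "canonical_vector X Y D \<noteq> \<zero>\<^bsub>det_line (Oper X Y D)\<^esub>"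
    using det_vec_surj[of "Oper X Y D" "[]"] is_isoD[OF assms] Y.vector_space_real_axioms by auto
qed

text \<open>Kernels stay trivial near an isomorphism, so the empty list is a kernel frame there, and the determinant
  vector of the empty frame is \<open>1 \<otimes> 1\<^sup>*\<close>.\<close>

lemma (in admissible_system) canonical_vector_continuous:
  assumes X: "banach_space X" and Y: "banach_space Y"
    and \<gamma>: "continuous_map (top_of_set A) (fredholm_top X Y) \<gamma>" and "t0 \<in> A"
    and iso: "\<And>t. t \<in> A \<Longrightarrow> is_iso X Y (\<gamma> t)"
  obtains V where "openin (top_of_set A) V" "t0 \<in> V"
    "continuous_map (top_of_set V) (det_top X Y) (\<lambda>t. (\<gamma> t, canonical_vector X Y (\<gamma> t)))"
proof -
  interpret X: banach_space X by (rule X)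
  interpret Y: banach_space Y by (rule Y)
  interpret two_normed X Y ..
  obtain r where r: "r > 0"
      "\<And>E. E \<in> bounded_ops X Y \<Longrightarrow> op_dist X Y (\<gamma> t0) E < r \<Longrightarrow> is_basis (ker (Oper X Y E)) []"
    using trivial_kernel_near_iso[OF X Y iso[OF \<open>t0 \<in> A\<close>]] by blast
  note \<gamma>0 = is_isoD(1)[OF X Y iso[OF \<open>t0 \<in> A\<close>]]
  let ?U = "{E \<in> surj_fredholm_ops X Y. op_dist X Y (\<gamma> t0) E < r}"
  have frame: "kernel_frame X Y ?U 0 (\<lambda>_ D. \<zero>\<^bsub>X\<^esub>)"
    unfolding kernel_frame_def
    using openin_surj_ball[OF X.normed_vspace_axioms Y.normed_vspace_axioms \<gamma>0] r(2)
    by (auto simp: surj_fredholm_ops_def fredholm_ops_def fredholm_def)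
  have "continuous_map (top_of_set A) (op_top X Y) \<gamma>"
    using \<gamma> unfolding fredholm_top_def by (rule continuous_map_into_fulltopology)
  then obtain V where V: "openin (top_of_set A) V" "t0 \<in> V" "\<forall>s\<in>V. op_dist X Y (\<gamma> t0) (\<gamma> s) < r"
    using r(1) \<open>t0 \<in> A\<close> unfolding continuous_map_op_top by force
  have VA: "V \<subseteq> A" using V(1) openin_imp_subset by blast
  have "\<gamma> s \<in> ?U" if "s \<in> V" for s
  proof -
    have "\<gamma> s \<in> fredholm_ops X Y"
      using continuous_map_image_subset_topspace[OF \<gamma>] that VA by (auto simp: topspace_fredholm_top[OF X Y])
    then show ?thesis using V(3) that is_isoD(2)[OF X Y iso] VA by (auto simp: surj_fredholm_ops_def)
  qed
  moreover have "continuous_map (top_of_set V) (fredholm_top X Y) \<gamma>"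
    using continuous_map_from_subtopology[OF \<gamma>, of V] restrict_top_of_set[OF V(1)] by simp
  ultimately have "continuous_map (top_of_set V) (det_top X Y)
      (\<lambda>t. (\<gamma> t, det_vec (Oper X Y (\<gamma> t)) (map (\<lambda>i. \<zero>\<^bsub>X\<^esub>) [0..<0]) []))"
    by (intro frame_section_continuous[OF X Y frame]) auto
  then show thesis using that V(1,2) by simp
qed

locale stabilized_system = admissible_system det_top \<Psi> + stabilization X Y y0
  for det_top :: "'a tree nspace \<Rightarrow> 'a tree nspace \<Rightarrow> (('a tree \<Rightarrow> 'a tree) \<times> 'a tree det_elt) topology"
    and \<Psi> :: "'a tree triple \<Rightarrow> 'a tree det2_elt \<Rightarrow> 'a tree det_elt"
    and X Y :: "'a tree nspace" and y0 :: "'a tree"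
begin

text \<open>The key computation. Let \<open>e t\<close> span the kernel of \<open>stab (\<gamma> t)\<close> and have component
  \<open>g t \<odot> y0\<close> in the line, and let \<open>\<nu>\<close> be the generator of the determinant line of \<open>N\<close>
  given by \<open>y0\<close>. When \<open>\<gamma> t\<close> is an isomorphism, the second normalization axiom says that \<open>\<Psi>\<close>
  takes wedge products of kernel vectors. So it maps \<open>g t\<close> times \<open>(1 \<otimes> 1\<^sup>*) \<otimes> \<nu>\<close> to the generator given by \<open>e t\<close>.
  For a continuous section \<open>\<sigma>\<close> without zeros, \<open>\<Psi> (\<sigma> \<otimes> \<nu>)\<close> is a continuous multiple \<open>b\<close> of that
  generator, and \<open>b\<close> has no zeros, even where \<open>\<gamma> t\<close> is not an isomorphism. Hence the coefficient of
  \<open>\<sigma>\<close> with respect to \<open>1 \<otimes> 1\<^sup>*\<close> is \<open>g * b\<close>.\<close>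

lemma section_vs_kernel_vector:
  fixes A :: "real set"
  assumes \<gamma>: "continuous_map (top_of_set A) (fredholm_top X Y) \<gamma>"
    and e: "\<And>t. t \<in> A \<Longrightarrow> is_basis (ker (Oper (X \<boxplus> L) Y (stab (\<gamma> t)))) [e t]"
    and surj: "\<And>t. t \<in> A \<Longrightarrow> surj_op (Oper (X \<boxplus> L) Y (stab (\<gamma> t)))"
    and q: "continuous_map (top_of_set A) (det_top (X \<boxplus> L) Y)
      (\<lambda>t. (stab (\<gamma> t), det_vec (Oper (X \<boxplus> L) Y (stab (\<gamma> t))) [e t] []))"
    and g: "\<And>t. t \<in> A \<Longrightarrow> rgt (e t) = g t \<odot>\<^bsub>Y\<^esub> y0"
    and \<sigma>: "continuous_map (top_of_set A) (det_top X Y) (\<lambda>t. (\<gamma> t, \<sigma> t))"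
      "\<And>t. t \<in> A \<Longrightarrow> \<sigma> t \<noteq> \<zero>\<^bsub>det_line (Oper X Y (\<gamma> t))\<^esub>"
    and t0: "t0 \<in> A"
  obtains V b where "openin (top_of_set A) V" "t0 \<in> V" "continuous_on V b" "\<And>t. t \<in> V \<Longrightarrow> b t \<noteq> 0"
    "\<And>t. t \<in> V \<Longrightarrow> is_iso X Y (\<gamma> t) \<Longrightarrow>
      \<sigma> t = (g t * b t) \<odot>\<^bsub>det_line (Oper X Y (\<gamma> t))\<^esub> canonical_vector X Y (\<gamma> t)"
proof -
  interpret Y: banach_space Y by (rule Y)
  interpret Z: banach_space Z by (rule Z)
  let ?P = "\<lambda>t. Oper X Y (\<gamma> t)" and ?Q = "\<lambda>t. Oper (X \<boxplus> L) Y (stab (\<gamma> t))"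
  let ?T = "triple_top (X \<boxplus> L) Y X Y L Z" and ?\<tau> = "\<lambda>t. stab_triple (\<gamma> t)"
  define q' where "q' t = det_vec (?Q t) [e t] []" for t
  define \<nu> where "\<nu> = det_vec N [y0] []"
  define s where "s t = \<Psi> (?\<tau> t) (det_tens (?P t) N (\<sigma> t) \<nu>)" for t
  have op_simps [simp]: "opL (?\<tau> t) = ?P t" "opC (?\<tau> t) = ?Q t" "opR (?\<tau> t) = N" for t
    by (simp_all add: stab_triple_def)
  have P: "fredholm (?P t)" if "t \<in> A" for t
    using continuous_map_image_subset_topspace[OF \<gamma>] that
    by (auto simp: topspace_fredholm_top[OF X Y] fredholm_ops_def)
  have \<gamma>_bounded: "\<gamma> t \<in> bounded_ops X Y" if "t \<in> A" for t using P[OF that] by (simp add: fredholm_def)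
  have Q: "fredholm (?Q t)" if "t \<in> A" for t
    by (rule fredholm_surj[OF XL Y stab_bounded[OF \<gamma>_bounded[OF that]] e[OF that] surj[OF that]])
  have ker_Q: "vector_space_real (ker (?Q t))" if "t \<in> A" for t
    by (rule vector_space_ker) (simp_all add: banach_normed XL Y stab_bounded \<gamma>_bounded that)
  have \<tau>: "continuous_map (top_of_set A) ?T ?\<tau>"
    by (rule stab_triple_continuous[OF \<gamma>]) (use Q in simp)
  have \<tau>_in: "?\<tau> t \<in> topspace ?T" if "t \<in> A" for t
    using continuous_map_image_subset_topspace[OF \<tau>] that by auto
  have exact: "exact_triple (?\<tau> t)" if "t \<in> A" for t
    by (rule stab_triple_exact[OF P[OF that] Q[OF that]])
  have q': "q' t \<in> vcarrier (det_line (?Q t))" "q' t \<noteq> \<zero>\<^bsub>det_line (?Q t)\<^esub>" if "t \<in> A" for t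
    using det_vec_surj[OF ker_Q[OF that] _ surj[OF that] e[OF that]] Y.vector_space_real_axioms
    by (auto simp: q'_def)
  have \<nu>: "\<nu> \<in> vcarrier (det_line N)" "\<nu> \<noteq> \<zero>\<^bsub>det_line N\<^esub>"
    using det_vec_surj[OF vector_space_ker_N _ N_surj N_basis] Z.vector_space_real_axioms
    by (auto simp: \<nu>_def)
  have \<sigma>_in: "\<sigma> t \<in> vcarrier (det_line (?P t))" if "t \<in> A" for t
    using continuous_map_image_subset_topspace[OF \<sigma>(1)] that by (auto simp: topspace_det_top[OF X Y])
  note Psi_nonzero = Psi_nonzero[OF XL Y X Y L Z refl]
  have s: "s t \<in> vcarrier (det_line (?Q t))" "s t \<noteq> \<zero>\<^bsub>det_line (?Q t)\<^esub>" if "t \<in> A" for t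
    using Psi_nonzero[OF \<tau>_in[OF that], of "det_tens (?P t) N (\<sigma> t) \<nu>"]
      det_tens_closed[OF P[OF that] N_fredholm \<sigma>_in[OF that] \<nu>(1)]
      det_tens_nonzero[OF P[OF that] N_fredholm \<sigma>_in[OF that] \<sigma>(2)[OF that] \<nu>]
    by (auto simp: s_def)
  have \<nu>_cont: "continuous_map (top_of_set A) (det_top L Z) (\<lambda>t. (fn N, \<nu>))"
    using \<nu>(1) N_fredholm N_def by (simp add: topspace_det_top[OF L Z] fredholm_ops_def)
  have s_cont: "continuous_map (top_of_set A) (det_top (X \<boxplus> L) Y) (\<lambda>t. (stab (\<gamma> t), s t))"
    using Psi_continuous[OF XL Y X Y L Z refl \<tau>, of \<sigma> "\<lambda>_. \<nu>"] \<sigma>(1) \<nu>_cont by (simp add: s_def)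
  obtain V b where V: "openin (top_of_set A) V" "t0 \<in> V" "continuous_on V b"
    and b: "\<And>u. u \<in> V \<Longrightarrow> s u = b u \<odot>\<^bsub>det_line (?Q u)\<^esub> q' u"
    using section_ratio[OF det_line_bundle[OF XL Y] t0, of "\<lambda>t. stab (\<gamma> t)" q' s]
      q s_cont q'(2)[OF t0] unfolding q'_def by blast
  have VA: "V \<subseteq> A" using V(1) openin_imp_subset by blast
  have b_nz: "b t \<noteq> 0" if "t \<in> V" for t
  proof
    assume "b t = 0"
    then have "s t = \<zero>\<^bsub>det_line (?Q t)\<^esub>"
      using b[OF that] vector_space_real.scale_zero[OF det_line_fibre(1)[OF Q]] q'(1) that VA by auto
    then show False using s(2) that VA by blast
  qed
  have "\<sigma> t = (g t * b t) \<odot>\<^bsub>det_line (?P t)\<^esub> canonical_vector X Y (\<gamma> t)"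
    if t: "t \<in> V" and iso: "is_iso X Y (\<gamma> t)" for t
  proof -
    have tA: "t \<in> A" using t VA by blast
    interpret P: vector_space_real "det_line (?P t)" by (rule det_line_fibre[OF P[OF tA]])
    interpret Q: vector_space_real "det_line (?Q t)" by (rule det_line_fibre[OF Q[OF tA]])
    let ?c = "canonical_vector X Y (\<gamma> t)"
    note iso_facts = is_isoD[OF X Y iso]
    note c = canonical_vector_nonzero[OF X Y iso]
    obtain a where a: "\<sigma> t = a \<odot>\<^bsub>det_line (?P t)\<^esub> ?c"
      using P.is_basis_singletonD(3)[OF det_line_fibre(2)[OF P[OF tA] c] \<sigma>_in[OF tA]] by blast
    have linear: "\<Psi> (?\<tau> t) (k \<odot>\<^bsub>det_tensor (?P t) N\<^esub> det_tens (?P t) N ?c \<nu>)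
        = k \<odot>\<^bsub>det_line (?Q t)\<^esub> \<Psi> (?\<tau> t) (det_tens (?P t) N ?c \<nu>)" for k
      using Psi_linear[OF exact[OF tA]] det_tens_closed[OF P[OF tA] N_fredholm c(1) \<nu>(1)]
      by (simp add: linear_on_def)
    have "jX (?\<tau> t) (e t) = g t \<odot>\<^bsub>ker N\<^esub> y0"
      using vector_space_real.is_basis_singletonD(1)[OF ker_Q[OF tA] e[OF tA]] g[OF tA]
      by (auto simp: stab_triple_def proj2_def)
    then have \<nu>_scale: "det_vec N (map (jX (?\<tau> t)) [e t]) [] = g t \<odot>\<^bsub>det_line N\<^esub> \<nu>"
      using det_vec_singleton_scale[OF vector_space_ker_N _ N_surj N_basis, of "g t"] Z.vector_space_real_axioms
      by (simp add: \<nu>_def)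
    have "\<Psi> (?\<tau> t) (det_tens (opL (?\<tau> t)) (opR (?\<tau> t)) (det_vec (opL (?\<tau> t)) [] [])
          (det_vec (opR (?\<tau> t)) (map (jX (?\<tau> t)) [e t]) []))
        = det_vec (opC (?\<tau> t)) (map (iX (?\<tau> t)) [] @ [e t]) []"
    proof (rule normalization_II[OF exact[OF tA]])
      show "surj_op (opL (?\<tau> t))" "surj_op (opR (?\<tau> t))" using iso_facts(2) N_surj by simp_all
      show "[] \<in> tuples (vdim (ker (opL (?\<tau> t)))) (vcarrier (ker (opL (?\<tau> t))))"
        using iso_facts(4) by simp
      show "[e t] \<in> tuples (vdim (ker (opR (?\<tau> t)))) (vcarrier (ker (opC (?\<tau> t))))"
        using vector_space_real.vdim_singleton[OF vector_space_ker_N N_basis]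
          vector_space_real.is_basis_singletonD(1)[OF ker_Q[OF tA] e[OF tA]]
        by (simp add: tuples_def del: N_simps)
    qed
    then have "\<Psi> (?\<tau> t) (det_tens (?P t) N ?c (g t \<odot>\<^bsub>det_line N\<^esub> \<nu>)) = q' t"
      using \<nu>_scale by (simp add: q'_def)
    then have key: "g t \<odot>\<^bsub>det_line (?Q t)\<^esub> \<Psi> (?\<tau> t) (det_tens (?P t) N ?c \<nu>) = q' t"
      using linear[of "g t"] tens_scale_right[OF c(1) \<nu>(1), of "g t"] by (simp add: det_tens_def det_tensor_def)
    have "s t = a \<odot>\<^bsub>det_line (?Q t)\<^esub> \<Psi> (?\<tau> t) (det_tens (?P t) N ?c \<nu>)"
      using linear[of a] tens_scale_left[OF c(1) \<nu>(1), of a] a by (simp add: s_def det_tens_def det_tensor_def)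
    then have "g t \<odot>\<^bsub>det_line (?Q t)\<^esub> s t = a \<odot>\<^bsub>det_line (?Q t)\<^esub> q' t"
      using key Psi_nonzero(1)[OF \<tau>_in[OF tA], of "det_tens (?P t) N ?c \<nu>"]
        det_tens_closed[OF P[OF tA] N_fredholm c(1) \<nu>(1)]
      by (simp add: Q.scale_scale mult.commute flip: key)
    then have "(g t * b t) \<odot>\<^bsub>det_line (?Q t)\<^esub> q' t = a \<odot>\<^bsub>det_line (?Q t)\<^esub> q' t"
      using b[OF t] q'(1)[OF tA] by (simp add: Q.scale_scale)
    then have "g t * b t = a" by (rule Q.scale_right_cancel[OF q'[OF tA]])
    with a show ?thesis by simp
  qed
  then show thesis using that V b_nz by blast
qed

end

lemma constant_sign_near:
  fixes b :: "real \<Rightarrow> real"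
  assumes V: "openin (top_of_set A) V" "t0 \<in> V" and b: "continuous_on V b" "b t0 \<noteq> 0"
  obtains r where "r > 0" "A \<inter> ball t0 r \<subseteq> V" "\<And>u. u \<in> A \<inter> ball t0 r \<Longrightarrow> b u * b t0 > 0"
proof -
  have "openin (top_of_set V) (V \<inter> (\<lambda>u. b u * b t0) -` {0<..})"
    by (rule continuous_openin_preimage_gen) (auto intro!: continuous_intros b)
  then have "openin (top_of_set A) (V \<inter> (\<lambda>u. b u * b t0) -` {0<..})" using V(1) openin_trans by blast
  moreover have "b t0 * b t0 > 0" using b(2) not_real_square_gt_zero by blast
  then have "t0 \<in> V \<inter> (\<lambda>u. b u * b t0) -` {0<..}" using V(2) by simp
  ultimately obtain r where "r > 0" "ball t0 r \<inter> A \<subseteq> V \<inter> (\<lambda>u. b u * b t0) -` {0<..}"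
    unfolding openin_contains_ball by blast
  then show thesis by (intro that[of r]) auto
qed

context admissible_system
begin

lemma sign_near_regular:
  fixes D :: "real \<Rightarrow> 'a tree \<Rightarrow> 'a tree"
  assumes X: "banach_space X" and Y: "banach_space Y"
    and D: "continuous_map (top_of_set {0..1}) (fredholm_top X Y) D"
    and V: "openin (top_of_set {0..1}) V" "t0 \<in> V"
    and \<sigma>: "continuous_map (top_of_set V) (det_top X Y) (\<lambda>u. (D u, \<sigma> u))"
      "\<And>u. u \<in> V \<Longrightarrow> \<sigma> u \<noteq> \<zero>\<^bsub>det_line (Oper X Y (D u))\<^esub>"
    and iso: "\<And>u. u \<in> V \<Longrightarrow> is_iso X Y (D u)"
  obtains r a \<kappa> where "r > 0" "{0..1} \<inter> ball t0 r \<subseteq> V"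
    "\<And>u. u \<in> {0..1} \<inter> ball t0 r \<Longrightarrow>
      \<sigma> u = a u \<odot>\<^bsub>det_line (Oper X Y (D u))\<^esub> canonical_vector X Y (D u) \<and> \<kappa> * a u > (0::real)"
proof -
  have DV: "continuous_map (top_of_set V) (fredholm_top X Y) D"
    using continuous_map_from_subtopology[OF D, of V] restrict_top_of_set[OF V(1)] by simp
  obtain W where W: "openin (top_of_set V) W" "t0 \<in> W"
    "continuous_map (top_of_set W) (det_top X Y) (\<lambda>t. (D t, canonical_vector X Y (D t)))"
    using canonical_vector_continuous[OF X Y DV V(2) iso] by blast
  have WV: "W \<subseteq> V" using W(1) openin_imp_subset by blast
  have \<sigma>W: "continuous_map (top_of_set W) (det_top X Y) (\<lambda>u. (D u, \<sigma> u))"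
    using continuous_map_from_subtopology[OF \<sigma>(1), of W] restrict_top_of_set[OF W(1)] by simp
  have c0: "canonical_vector X Y (D t0) \<noteq> \<zero>\<^bsub>det_line (Oper X Y (D t0))\<^esub>"
    by (rule canonical_vector_nonzero[OF X Y iso[OF V(2)]])
  obtain W' k where W': "openin (top_of_set W) W'" "t0 \<in> W'" "continuous_on W' k"
    and k: "\<And>u. u \<in> W' \<Longrightarrow> \<sigma> u = k u \<odot>\<^bsub>det_line (Oper X Y (D u))\<^esub> canonical_vector X Y (D u)"
    using section_ratio[OF det_line_bundle[OF X Y] W(2,3) c0 \<sigma>W] by blast
  have "k t0 \<noteq> 0"
  proof
    assume "k t0 = 0"
    have "fredholm (Oper X Y (D t0))"
      using continuous_map_image_subset_topspace[OF DV] V(2) by (auto simp: topspace_fredholm_top[OF X Y] fredholm_ops_def)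
    then have "\<sigma> t0 = \<zero>\<^bsub>det_line (Oper X Y (D t0))\<^esub>"
      using k[OF W'(2)] \<open>k t0 = 0\<close> vector_space_real.scale_zero[OF det_line_fibre(1)]
        canonical_vector_nonzero(1)[OF X Y iso[OF V(2)]] by simp
    then show False using \<sigma>(2)[OF V(2)] by contradiction
  qed
  moreover have W'_open: "openin (top_of_set {0..1}) W'" using W'(1) W(1) V(1) openin_trans by blast
  ultimately obtain r where r: "r > 0" "{0..1} \<inter> ball t0 r \<subseteq> W'"
      "\<And>u. u \<in> {0..1} \<inter> ball t0 r \<Longrightarrow> k u * k t0 > 0"
    using constant_sign_near[OF W'_open W'(2,3)] by blast
  show thesis
  proof (rule that[of r k "k t0"])
    have "W' \<subseteq> W" using W'(1) openin_imp_subset by blast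
    then show "{0..1} \<inter> ball t0 r \<subseteq> V" using r(2) WV by blast
  qed (use r k in \<open>auto simp: mult.commute\<close>)
qed

text \<open>At a transverse degeneration the kernel of the stabilized operator is spanned by
  \<open>(x0, 0) - R w\<close>, whose component in the line is \<open>- f t \<odot> y0\<close>. So \<open>1 \<otimes> 1\<^sup>*\<close>
  changes sign with \<open>f\<close>. That \<open>X = S \<oplus> \<real> x0\<close> follows from a nearby parameter at which \<open>D\<close> is
  invertible and \<open>f\<close> is not zero.\<close>

lemma sign_change_at_degeneration:
  fixes D :: "real \<Rightarrow> 'a tree \<Rightarrow> 'a tree"
  assumes X: "banach_space X" and Y: "banach_space Y"
    and D: "continuous_map (top_of_set {0..1}) (fredholm_top X Y) D"
    and V: "openin (top_of_set {0..1}) V" "t0 \<in> V"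
    and \<sigma>: "continuous_map (top_of_set V) (det_top X Y) (\<lambda>u. (D u, \<sigma> u))"
      "\<And>u. u \<in> V \<Longrightarrow> \<sigma> u \<noteq> \<zero>\<^bsub>det_line (Oper X Y (D u))\<^esub>"
    and iso: "\<And>u. u \<in> V \<Longrightarrow> u \<noteq> t0 \<Longrightarrow> is_iso X Y (D u)"
    and transverse: "transverse_at X Y D t0"
  obtains r a \<kappa> where "r > 0" "{0..1} \<inter> ball t0 r \<subseteq> V"
    "\<And>u. u \<in> {0..1} \<inter> ball t0 r \<Longrightarrow> u \<noteq> t0 \<Longrightarrow>
      \<sigma> u = a u \<odot>\<^bsub>det_line (Oper X Y (D u))\<^esub> canonical_vector X Y (D u) \<and> \<kappa> * a u * (u - t0) < (0::real)"
proof -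
  interpret X: banach_space X by (rule X)
  interpret Y: banach_space Y by (rule Y)
  obtain x0 y0 S \<delta> B f where
    x0: "x0 \<in> vcarrier (ker (Oper X Y (D t0)))" "x0 \<noteq> \<zero>\<^bsub>X\<^esub>"
    and y0: "y0 \<in> vcarrier Y - D t0 ` vcarrier X"
    and S: "subspace_of S X" "closedin (norm_top X) S"
    and S_iso: "is_iso (X\<lparr>vcarrier := S\<rparr>) (Y\<lparr>vcarrier := D t0 ` vcarrier X\<rparr>) (restrict (D t0) S)"
    and \<delta>: "\<delta> > 0" "{t0 - \<delta> <..< t0 + \<delta>} \<subseteq> {0..1}"
    and decomp': "\<forall>t\<in>{t0 - \<delta> <..< t0 + \<delta>}. \<forall>y\<in>vcarrier Y.
        \<exists>!p. fst p \<in> D t ` S \<and> y = fst p \<oplus>\<^bsub>Y\<^esub> (snd p \<odot>\<^bsub>Y\<^esub> y0)"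
    and B: "B ` {t0 - \<delta> <..< t0 + \<delta>} \<subseteq> S"
    and Dx0': "\<forall>t\<in>{t0 - \<delta> <..< t0 + \<delta>}. D t x0 = D t (B t) \<oplus>\<^bsub>Y\<^esub> (f t \<odot>\<^bsub>Y\<^esub> y0)"
    and f': "\<forall>s t. t0 - \<delta> < s \<and> s < t0 \<and> t0 < t \<and> t < t0 + \<delta> \<longrightarrow> f s * f t < 0"
    using transverse unfolding transverse_at_def by (elim conjE exE) (rule that)
  note decomp = decomp'[rule_format] and Dx0 = Dx0'[rule_format] and f = f'[rule_format]
  have D_Fredholm: "fredholm (Oper X Y (D t))" if "t \<in> {0..1}" for t
    using continuous_map_image_subset_topspace[OF D, THEN subsetD, of "D t"] that
    by (simp add: topspace_fredholm_top[OF X Y] fredholm_ops_def)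
  have D_bounded: "D t \<in> bounded_ops X Y" if "t \<in> {0..1}" for t
    using D_Fredholm[OF that] by (simp add: fredholm_def)
  have t0: "t0 \<in> {0..1}" using \<delta>(1) by (intro subsetD[OF \<delta>(2)]) simp
  note D0 = D_bounded[OF t0]
  have D0_zero: "D t0 \<zero>\<^bsub>X\<^esub> = \<zero>\<^bsub>Y\<^esub>"
    by (rule bounded_ops_zero[OF D0 X.vector_space_real_axioms Y.vector_space_real_axioms])
  have x0X: "x0 \<in> vcarrier X" "D t0 x0 = \<zero>\<^bsub>Y\<^esub>" using x0(1) by auto
  have y0Y: "y0 \<in> vcarrier Y" "y0 \<notin> D t0 ` vcarrier X" using y0 by auto
  have y0_nz: "y0 \<noteq> \<zero>\<^bsub>Y\<^esub>" using y0Y(2) D0_zero X.zero_closed by (metis imageI)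
  interpret stabilized_system det_top \<Psi> X Y y0
    by (intro stabilized_system.intro admissible_system_axioms stabilization.intro X Y y0Y(1) y0_nz)
  interpret L: banach_space L by (rule L)
  interpret XL: banach_space "X \<boxplus> L" by (rule XL)
  have SX: "s \<in> vcarrier X" if "s \<in> S" for s using S(1) that by (auto simp: subspace_of_def)
  obtain M where M: "M > 0" "\<And>s. s \<in> S \<Longrightarrow> vnorm X s \<le> M * vnorm Y (D t0 s)"
  proof -
    obtain g where g: "g \<in> bounded_ops (Y\<lparr>vcarrier := D t0 ` vcarrier X\<rparr>) (X\<lparr>vcarrier := S\<rparr>)"
        "\<And>s. s \<in> S \<Longrightarrow> g (D t0 s) = s"
      using S_iso unfolding is_iso_def by auto
    obtain K where K: "\<And>y. y \<in> D t0 ` vcarrier X \<Longrightarrow> vnorm X (g y) \<le> K * vnorm Y y"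
      using g(1) unfolding bounded_ops_def by auto
    have "vnorm X s \<le> max K 1 * vnorm Y (D t0 s)" if "s \<in> S" for s
    proof -
      have "vnorm X s \<le> K * vnorm Y (D t0 s)" using K[of "D t0 s"] g(2)[OF that] SX[OF that] by auto
      also have "\<dots> \<le> max K 1 * vnorm Y (D t0 s)"
        using Y.norm_nonneg[OF bounded_opsD(1)[OF D0 SX[OF that]]] by (intro mult_right_mono) auto
      finally show ?thesis .
    qed
    then show thesis using that[of "max K 1"] by simp
  qed
  have decomp_ex: "\<exists>s\<in>S. \<exists>c. y = D t s \<oplus>\<^bsub>Y\<^esub> (c \<odot>\<^bsub>Y\<^esub> y0)"
    if ty: "t \<in> {t0 - \<delta> <..< t0 + \<delta>}" "y \<in> vcarrier Y" for t y
  proof -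
    obtain p where p: "fst p \<in> D t ` S" "y = fst p \<oplus>\<^bsub>Y\<^esub> (snd p \<odot>\<^bsub>Y\<^esub> y0)"
      using ex1_implies_ex[OF decomp[OF ty]] by blast
    then obtain s where "s \<in> S" "fst p = D t s" by blast
    with p(2) show ?thesis by (intro bexI[of _ s] exI[of _ "snd p"]) simp_all
  qed
  have decomp0: "\<exists>s\<in>S. \<exists>c. y = D t0 s \<oplus>\<^bsub>Y\<^esub> (c \<odot>\<^bsub>Y\<^esub> y0)" if "y \<in> vcarrier Y" for y
    by (rule decomp_ex[OF _ that]) (use \<delta>(1) in simp)
  have "y0 \<notin> D t0 ` S" using y0Y(2) SX by blast
  obtain R K where "right_inverse (X \<boxplus> L) Y (stab (D t0)) R K"
    and R: "\<And>s a. s \<in> S \<Longrightarrow> R (D t0 s \<oplus>\<^bsub>Y\<^esub> (a \<odot>\<^bsub>Y\<^esub> y0)) = Pr s (a \<odot>\<^bsub>Y\<^esub> y0)"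
    using bounded_right_inverse[OF D0 S M \<open>y0 \<notin> D t0 ` S\<close> decomp0] by blast
  then interpret right_inverse "X \<boxplus> L" Y "stab (D t0)" R K by blast
  let ?k0 = "Pr x0 \<zero>\<^bsub>Y\<^esub>"

  \<comment> \<open>A parameter near \<open>t0\<close> with \<open>f\<close> nonzero and \<open>D\<close> invertible shows that \<open>S\<close> and \<open>x0\<close> span \<open>X\<close>.\<close>
  obtain rV where rV: "rV > 0" "ball t0 rV \<inter> {0..1} \<subseteq> V"
    using V unfolding openin_contains_ball by blast
  define r1 where "r1 = min rV \<delta>"
  have r1: "r1 > 0" "r1 \<le> rV" "r1 \<le> \<delta>" using rV(1) \<delta>(1) by (auto simp: r1_def)
  define t1 where "t1 = t0 + r1 / 2"
  have t1: "t1 \<in> {t0 - \<delta> <..< t0 + \<delta>}" "t0 < t1" using r1 by (auto simp: t1_def)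
  have "t1 \<in> ball t0 rV" using r1 by (simp add: t1_def dist_real_def)
  then have t1V: "t1 \<in> V" using rV(2) subsetD[OF \<delta>(2) t1(1)] by blast
  note iso1 = is_isoD[OF X Y iso[OF t1V]]
  have "f t1 \<noteq> 0" using f[of "t0 - r1 / 2" t1] t1 r1 by auto
  have span_X: "\<exists>s\<in>S. \<exists>c. x = s \<oplus>\<^bsub>X\<^esub> (c \<odot>\<^bsub>X\<^esub> x0)" if x: "x \<in> vcarrier X" for x
  proof -
    have D1: "D t1 \<in> bounded_ops X Y" and inj: "inj_on (D t1) (vcarrier X)" using iso1 t1(2) by auto
    note lin = bounded_ops_linear[OF D1] and D1_closed = bounded_opsD(1)[OF D1]
    have Bt: "B t1 \<in> S" using B t1(1) by blast
    obtain s c where s: "s \<in> S" "D t1 x = D t1 s \<oplus>\<^bsub>Y\<^esub> (c \<odot>\<^bsub>Y\<^esub> y0)"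
      using decomp_ex[OF t1(1) D1_closed[OF x]] by blast
    let ?d = "c / f t1"
    have s': "s \<ominus>\<^bsub>X\<^esub> (?d \<odot>\<^bsub>X\<^esub> B t1) \<in> S"
      using S(1) s(1) Bt by (auto simp: subspace_of_def vminus_def)
    have "D t1 (?d \<odot>\<^bsub>X\<^esub> x0) = D t1 (?d \<odot>\<^bsub>X\<^esub> B t1) \<oplus>\<^bsub>Y\<^esub> (c \<odot>\<^bsub>Y\<^esub> y0)"
      using Dx0[OF t1(1)] lin(2)[OF x0X(1)] lin(2)[OF SX[OF Bt]] D1_closed[OF SX[OF Bt]] y0Y(1) \<open>f t1 \<noteq> 0\<close>
      by (simp add: Y.scale_add_right scale_y0 Y.scale_scale)
    then have "D t1 ((s \<ominus>\<^bsub>X\<^esub> (?d \<odot>\<^bsub>X\<^esub> B t1)) \<oplus>\<^bsub>X\<^esub> (?d \<odot>\<^bsub>X\<^esub> x0))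
        = ((D t1 s \<ominus>\<^bsub>Y\<^esub> D t1 (?d \<odot>\<^bsub>X\<^esub> B t1)) \<oplus>\<^bsub>Y\<^esub> D t1 (?d \<odot>\<^bsub>X\<^esub> B t1)) \<oplus>\<^bsub>Y\<^esub> (c \<odot>\<^bsub>Y\<^esub> y0)"
      using lin(1)[OF SX[OF s'] X.scale_closed[OF x0X(1)], of ?d] SX[OF s(1)] SX[OF Bt] D1_closed scale_y0
        bounded_ops_minus[OF D1 X.vector_space_real_axioms SX[OF s(1)] X.scale_closed[OF SX[OF Bt]], of ?d]
      by (simp add: Y.add_assoc Y.minus_closed X.scale_closed)
    also have "\<dots> = D t1 x"
      using s SX[OF s(1)] SX[OF Bt] D1_closed by (simp add: Y.minus_add_cancel X.scale_closed)
    finally have "(s \<ominus>\<^bsub>X\<^esub> (?d \<odot>\<^bsub>X\<^esub> B t1)) \<oplus>\<^bsub>X\<^esub> (?d \<odot>\<^bsub>X\<^esub> x0) = x"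
      by (rule inj_onD[OF inj]) (simp_all add: x X.add_closed X.scale_closed x0X(1) SX[OF s'])
    then show ?thesis using s' by (intro bexI[OF _ s'] exI[of _ ?d]) simp
  qed

  have k0: "?k0 \<in> vcarrier (X \<boxplus> L)" "?k0 \<noteq> \<zero>\<^bsub>X \<boxplus> L\<^esub>" "stab (D t0) ?k0 = \<zero>\<^bsub>Y\<^esub>"
    using x0X x0(2) zero_in_L by (simp_all add: stab_Pr Y.add_zero Y.zero_closed)
  have span: "\<exists>c. p = R (stab (D t0) p) \<oplus>\<^bsub>X \<boxplus> L\<^esub> (c \<odot>\<^bsub>X \<boxplus> L\<^esub> ?k0)" if p_in: "p \<in> vcarrier (X \<boxplus> L)" for p
  proof -
    obtain x a where p: "p = Pr x (a \<odot>\<^bsub>Y\<^esub> y0)" "x \<in> vcarrier X" using p_in by auto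
    obtain s c where s: "s \<in> S" "x = s \<oplus>\<^bsub>X\<^esub> (c \<odot>\<^bsub>X\<^esub> x0)" using span_X[OF p(2)] by blast
    have "D t0 x = D t0 s"
      using s bounded_ops_linear[OF D0] SX[OF s(1)] x0X bounded_opsD(1)[OF D0 SX[OF s(1)]]
      by (simp add: X.scale_closed Y.scale_zero_right Y.add_zero)
    then have "R (stab (D t0) p) = Pr s (a \<odot>\<^bsub>Y\<^esub> y0)" using p R[OF s(1)] by (simp add: stab_Pr)
    then show ?thesis using p s scale_y0 by (auto simp: Y.scale_zero_right Y.add_zero)
  qed

  let ?e = "\<lambda>t. kernel_vector ?k0 (stab (D t))"
  define A where "A = {t \<in> V \<inter> {t0 - \<delta> <..< t0 + \<delta>}. stab (D t) \<in> near}"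
  have V01: "V \<subseteq> {0..1}" using V(1) openin_imp_subset by blast
  have stab_cont: "continuous_map (top_of_set {0..1}) (op_top (X \<boxplus> L) Y) (\<lambda>t. stab (D t))"
    by (rule stab_continuous) (use D in \<open>simp add: fredholm_top_def continuous_map_in_subtopology\<close>)
  interpret XLY: two_normed "X \<boxplus> L" Y ..
  have near_ball: "near = XLY.ops.mball (stab (D t0)) (1 / (2 * K))"
    using E0 by (auto simp: near_def)
  have A: "openin (top_of_set {0..1}) A" "t0 \<in> A"
  proof -
    have "openin (top_of_set {0..1}) {t \<in> {0..1}. stab (D t) \<in> near}"
      using openin_continuous_map_preimage[OF stab_cont, of near] near_ball by (simp add: op_top_def)
    moreover have "openin (top_of_set {0..1}) {t0 - \<delta> <..< t0 + \<delta>}"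
      using \<delta>(2) by (auto simp: openin_open intro!: exI[of _ "{t0 - \<delta> <..< t0 + \<delta>}"])
    moreover have "A = V \<inter> {t0 - \<delta> <..< t0 + \<delta>} \<inter> {t \<in> {0..1}. stab (D t) \<in> near}"
      using V01 by (auto simp: A_def)
    ultimately show "openin (top_of_set {0..1}) A" using V(1) by (simp add: openin_Int)
    show "t0 \<in> A" using V(2) \<delta>(1) E0_near by (simp add: A_def)
  qed
  have A01: "A \<subseteq> {0..1}" using V01 by (auto simp: A_def)
  have to_A: "continuous_map (top_of_set A) T h" if "continuous_map (top_of_set {0..1}) T h" for T h
    using continuous_map_from_subtopology[OF that, of A] restrict_top_of_set[OF A(1)] by simp
  have near_A: "stab (D t) \<in> near" if "t \<in> A" for t using that by (simp add: A_def)
  have basis: "is_basis (ker (Oper (X \<boxplus> L) Y (stab (D t)))) [?e t]" if "t \<in> A" for t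
    by (rule kernel_vector_basis[OF k0 span near_A[OF that]])
  have stab_fredholm: "fredholm (Oper (X \<boxplus> L) Y (stab (D t)))" if "t \<in> A" for t
    by (rule fredholm_surj[OF XL Y near_bounded[OF near_A[OF that]] basis[OF that] near_surj_op[OF near_A[OF that]]])
  have "continuous_map (top_of_set A) (fredholm_top (X \<boxplus> L) Y) (\<lambda>t. stab (D t))"
    unfolding fredholm_top_def using stab_fredholm
    by (intro continuous_map_into_subtopology to_A stab_cont) (auto simp: fredholm_ops_def)
  then have q: "continuous_map (top_of_set A) (det_top (X \<boxplus> L) Y)
      (\<lambda>t. (stab (D t), det_vec (Oper (X \<boxplus> L) Y (stab (D t))) [?e t] []))"
    using frame_section_continuous[OF XL Y kernel_line_frame[OF k0 span], of "top_of_set A" "\<lambda>t. stab (D t)"]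
      near_A stab_fredholm near_surj_op by (auto simp: surj_fredholm_ops_def fredholm_ops_def)

  have component: "rgt (?e t) = (- f t) \<odot>\<^bsub>Y\<^esub> y0" if "t \<in> A" for t
  proof -
    have t: "t \<in> {t0 - \<delta> <..< t0 + \<delta>}" using that by (simp add: A_def)
    note w = correction[OF k0 span near_A[OF that]]
    obtain s c where s: "s \<in> S" "correction ?k0 (stab (D t)) = D t0 s \<oplus>\<^bsub>Y\<^esub> (c \<odot>\<^bsub>Y\<^esub> y0)"
      using decomp0[OF w(1)] by blast
    have Rw: "R (correction ?k0 (stab (D t))) = Pr s (c \<odot>\<^bsub>Y\<^esub> y0)" using R[OF s(1)] s(2) by simp
    have Dt: "D t \<in> bounded_ops X Y" using D_bounded that A01 by blast
    have "D t s \<oplus>\<^bsub>Y\<^esub> (c \<odot>\<^bsub>Y\<^esub> y0) = D t x0"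
      using w(2) Rw SX[OF s(1)] x0X(1) zero_in_L bounded_opsD(1)[OF Dt x0X(1)]
      by (simp add: stab_Pr Y.add_zero)
    moreover have "D t x0 = D t (B t) \<oplus>\<^bsub>Y\<^esub> (f t \<odot>\<^bsub>Y\<^esub> y0)" by (rule Dx0[OF t])
    moreover have "B t \<in> S" using B t by blast
    ultimately have "(D t s, c) = (D t (B t), f t)"
      using decomp[OF t bounded_opsD(1)[OF Dt x0X(1)]] s(1)
      by (metis (mono_tags, lifting) fst_conv snd_conv imageI)
    then have "c = f t" by simp
    then show ?thesis using Rw y0Y(1)
      by (simp add: kernel_vector_def vminus_def Y.zero_add scale_y0 Y.scale_scale Y.scale_closed)
  qed
  obtain W b where W: "openin (top_of_set A) W" "t0 \<in> W" "continuous_on W b" "\<And>t. t \<in> W \<Longrightarrow> b t \<noteq> 0"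
    and \<sigma>_eq: "\<And>t. t \<in> W \<Longrightarrow> is_iso X Y (D t) \<Longrightarrow>
      \<sigma> t = ((- f t) * b t) \<odot>\<^bsub>det_line (Oper X Y (D t))\<^esub> canonical_vector X Y (D t)"
  proof (rule section_vs_kernel_vector[OF to_A[OF D] basis near_surj_op[OF near_A] q component _ _ A(2)])
    have "openin (top_of_set V) A"
      using A(1) V01 by (auto simp: A_def intro: openin_subset_trans)
    then show "continuous_map (top_of_set A) (det_top X Y) (\<lambda>t. (D t, \<sigma> t))"
      using continuous_map_from_subtopology[OF \<sigma>(1), of A] restrict_top_of_set[of V A] by simp
    show "\<sigma> t \<noteq> \<zero>\<^bsub>det_line (Oper X Y (D t))\<^esub>" if "t \<in> A" for t using \<sigma>(2) that by (simp add: A_def)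
  qed (use that in blast)+
  have W_open: "openin (top_of_set {0..1}) W" using W(1) A(1) openin_trans by blast
  have WA: "W \<subseteq> A" using W(1) openin_imp_subset by blast
  obtain r2 where r2: "r2 > 0" "{0..1} \<inter> ball t0 r2 \<subseteq> W" "\<And>u. u \<in> {0..1} \<inter> ball t0 r2 \<Longrightarrow> b u * b t0 > 0"
    using constant_sign_near[OF W_open W(2,3) W(4)[OF W(2)]] by blast
  \<comment> \<open>The sign of \<open>f\<close> after \<open>t0\<close> is that of \<open>f t1\<close>, and the sign before it is the opposite one.\<close>
  have f_sign: "f u * f t1 * (u - t0) > 0" if u: "u \<in> {t0 - \<delta> <..< t0 + \<delta>}" "u \<noteq> t0" for u
  proof (cases "u < t0")
    case True
    then have "f u * f t1 < 0" using f[of u t1] u t1 by auto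
    then show ?thesis using True by (simp add: mult_neg_neg)
  next
    case False
    let ?s = "t0 - \<delta> / 2"
    have "f ?s * f u < 0" "f ?s * f t1 < 0" using f[of ?s u] f[of ?s t1] u t1 False \<delta>(1) by auto
    then have "f u * f t1 > 0" by (auto simp: mult_less_0_iff zero_less_mult_iff)
    then show ?thesis using False u by simp
  qed
  show thesis
  proof (rule that[of r2 "\<lambda>u. (- f u) * b u" "f t1 * b t0"])
    show "r2 > 0" by (rule r2(1))
    show "{0..1} \<inter> ball t0 r2 \<subseteq> V" using r2(2) WA by (auto simp: A_def)
    fix u assume u: "u \<in> {0..1} \<inter> ball t0 r2" "u \<noteq> t0"
    have uW: "u \<in> W" using r2(2) u(1) by blast
    then have uA: "u \<in> V" "u \<in> {t0 - \<delta> <..< t0 + \<delta>}" using WA by (auto simp: A_def)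
    have "(f u * f t1 * (u - t0)) * (b u * b t0) > 0"
      by (rule mult_pos_pos[OF f_sign[OF uA(2) u(2)] r2(3)[OF u(1)]])
    then have "f t1 * b t0 * ((- f u) * b u) * (u - t0) < 0" by (simp add: mult_ac)
    then show "\<sigma> u = ((- f u) * b u) \<odot>\<^bsub>det_line (Oper X Y (D u))\<^esub> canonical_vector X Y (D u) \<and>
        f t1 * b t0 * ((- f u) * b u) * (u - t0) < 0"
      using \<sigma>_eq[OF uW iso[OF uA(1) u(2)]] by blast
  qed
qed

end

section \<open>Counting degenerations\<close>

context vector_space_real
begin

lemma mem_ray_self: "v \<in> vcarrier V \<Longrightarrow> v \<in> ray V v"
  unfolding ray_def using scale_one[of v] by (intro CollectI exI[of _ 1]) simp

lemma ray_scale: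
  assumes "v \<in> vcarrier V" "a > 0" shows "ray V (a \<odot> v) = ray V v"
proof (intro equalityI subsetI)
  fix x assume "x \<in> ray V (a \<odot> v)"
  then obtain c where "c > 0" "x = (c * a) \<odot> v" using assms by (auto simp: ray_def scale_scale)
  then show "x \<in> ray V v" using assms(2) unfolding ray_def by (intro CollectI exI[of _ "c * a"]) simp
next
  fix x assume "x \<in> ray V v"
  then obtain c where "c > 0" "x = c \<odot> v" by (auto simp: ray_def)
  then have "x = (c / a) \<odot> (a \<odot> v)" "c / a > 0" using assms by (simp_all add: scale_scale)
  then show "x \<in> ray V (a \<odot> v)" unfolding ray_def by blast
qed

lemma ray_eq: "v \<in> vcarrier V \<Longrightarrow> x \<in> ray V v \<Longrightarrow> ray V x = ray V v"
  using ray_scale by (auto simp: ray_def[of V v])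

lemma ray_neg:
  assumes "v \<in> vcarrier V" "v \<noteq> \<zero>" "a < 0" shows "ray V (a \<odot> v) \<noteq> ray V v"
proof
  assume "ray V (a \<odot> v) = ray V v"
  then have "a \<odot> v \<in> ray V v" using mem_ray_self[OF scale_closed[OF assms(1), of a]] by simp
  then obtain c where "c > 0" "a \<odot> v = c \<odot> v" by (auto simp: ray_def)
  then show False using scale_right_cancel[OF assms(1,2)] assms(3) by fastforce
qed

lemma orientation_eq_ray:
  assumes "orientation V os" "x \<in> os" shows "os = ray V x"
  using assms ray_eq unfolding orientation_def by metis

end

locale transverse_path = admissible_system det_top \<Psi>
  for det_top :: "'a tree nspace \<Rightarrow> 'a tree nspace \<Rightarrow> (('a tree \<Rightarrow> 'a tree) \<times> 'a tree det_elt) topology"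
    and \<Psi> :: "'a tree triple \<Rightarrow> 'a tree det2_elt \<Rightarrow> 'a tree det_elt" +
  fixes X Y :: "'a tree nspace" and D :: "real \<Rightarrow> 'a tree \<Rightarrow> 'a tree"
  assumes X: "banach_space X" and Y: "banach_space Y"
    and D: "continuous_map (top_of_set {0..1}) (fredholm_top X Y) D"
    and finite_degenerations: "finite (degenerations X Y D)"
    and degenerations_interior: "degenerations X Y D \<subseteq> {0<..<1}"
    and transverse: "t \<in> degenerations X Y D \<Longrightarrow> transverse_at X Y D t"
begin

abbreviation line :: "real \<Rightarrow> 'a tree det_elt vspace"
  where "line t \<equiv> det_line (Oper X Y (D t))"

abbreviation regular :: "real \<Rightarrow> bool"
  where "regular t \<equiv> is_iso X Y (D t)"

text \<open>Multiplied by this sign, the canonical vectors \<open>1 \<otimes> 1\<^sup>*\<close> have rays that vary continuously also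
  across the degenerations.\<close>

definition passed_sign :: "real \<Rightarrow> real"
  where "passed_sign t = (-1) ^ card {d \<in> degenerations X Y D. d < t}"

definition signed_vector :: "real \<Rightarrow> 'a tree det_elt"
  where "signed_vector t = passed_sign t \<odot>\<^bsub>line t\<^esub> canonical_vector X Y (D t)"

lemma degenerate_iff: "t \<in> {0..1} \<Longrightarrow> t \<in> degenerations X Y D \<longleftrightarrow> \<not> regular t"
  by (simp add: degenerations_def)

lemma fredholm_path: "t \<in> {0..1} \<Longrightarrow> fredholm (Oper X Y (D t))"
  using continuous_map_image_subset_topspace[OF D, THEN subsetD, of "D t"]
  by (simp add: topspace_fredholm_top[OF X Y] fredholm_ops_def)

lemma line_vs: "t \<in> {0..1} \<Longrightarrow> vector_space_real (line t)"
  by (rule det_line_fibre(1)[OF fredholm_path])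

lemma passed_sign_square: "passed_sign t * passed_sign t = 1"
  by (simp add: passed_sign_def flip: power_mult_distrib)

lemma passed_sign_nonzero: "passed_sign t \<noteq> 0"
  by (simp add: passed_sign_def)

lemma passed_sign_endpoints:
  "passed_sign 0 = 1" "passed_sign 1 = (-1) ^ card (degenerations X Y D)"
proof -
  have "{d \<in> degenerations X Y D. d < 0} = {}" "{d \<in> degenerations X Y D. d < 1} = degenerations X Y D"
    using degenerations_interior by auto
  then show "passed_sign 0 = 1" "passed_sign 1 = (-1) ^ card (degenerations X Y D)"
    by (simp_all only: passed_sign_def card.empty power_0)
qed

lemma signed_vector:
  assumes "t \<in> {0..1}" "regular t"
  shows "signed_vector t \<in> vcarrier (line t)" "signed_vector t \<noteq> \<zero>\<^bsub>line t\<^esub>"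
proof -
  interpret vector_space_real "line t" by (rule line_vs[OF assms(1)])
  note c = canonical_vector_nonzero[OF X Y assms(2)]
  show "signed_vector t \<in> vcarrier (line t)" using c by (simp add: signed_vector_def scale_closed)
  show "signed_vector t \<noteq> \<zero>\<^bsub>line t\<^esub>"
    using scale_eq_zeroD[OF c(1) _ c(2)] passed_sign_nonzero[of t] by (auto simp: signed_vector_def)
qed

lemma isolated_degenerations:
  obtains r where "r > 0" "\<And>u. u \<in> {0..1} \<inter> ball t r \<Longrightarrow> u \<noteq> t \<Longrightarrow> regular u"
proof -
  have "open (- (degenerations X Y D - {t}))"
    using finite_degenerations by (intro open_Compl finite_imp_closed) auto
  then obtain r where r: "r > 0" "ball t r \<subseteq> - (degenerations X Y D - {t})"
    unfolding open_contains_ball by blast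
  show thesis
    by (rule that[OF r(1)]) (use r(2) degenerate_iff in blast)
qed

lemma passed_sign_near:
  assumes t: "t \<in> {0..1}" and u: "u \<in> {0..1} \<inter> ball t r"
    and isolated: "\<And>u. u \<in> {0..1} \<inter> ball t r \<Longrightarrow> u \<noteq> t \<Longrightarrow> regular u"
  shows "passed_sign u = (if \<not> regular t \<and> t < u then - passed_sign t else passed_sign t)"
proof -
  let ?d = "degenerations X Y D"
  have d01: "?d \<subseteq> {0..1}" by (auto simp: degenerations_def)
  have between: "d = t" if "d \<in> ?d" "min t u \<le> d" "d \<le> max t u" for d
  proof (rule ccontr)
    assume "d \<noteq> t"
    moreover have "d \<in> {0..1} \<inter> ball t r" using that d01 u by (auto simp: dist_real_def)
    ultimately show False using isolated[of d] degenerate_iff[of d] that(1) by auto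
  qed
  show ?thesis
  proof (cases "\<not> regular t \<and> t < u")
    case True
    have "{d \<in> ?d. d < u} = insert t {d \<in> ?d. d < t}"
      using True between degenerate_iff[OF t] by (force simp: min_def max_def)
    moreover have "card (insert t {d \<in> ?d. d < t}) = Suc (card {d \<in> ?d. d < t})"
      using finite_degenerations by simp
    ultimately show ?thesis using True by (simp add: passed_sign_def)
  next
    case False
    have "d < u \<longleftrightarrow> d < t" if "d \<in> ?d" for d
    proof
      assume "d < u"
      show "d < t"
      proof (rule ccontr)
        assume "\<not> d < t"
        then have "d = t" using between[OF that] \<open>d < u\<close> by simp
        then show False using False \<open>d < u\<close> that degenerate_iff[OF t] by simp
      qed
    next
      assume "d < t"
      show "d < u"
      proof (rule ccontr)
        assume "\<not> d < u"
        then have "d = t" using between[OF that] \<open>d < t\<close> by simp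
        then show False using \<open>d < t\<close> by simp
      qed
    qed
    then have "{d \<in> ?d. d < u} = {d \<in> ?d. d < t}" by blast
    then show ?thesis using False by (simp only: passed_sign_def if_False)
  qed
qed

definition signed_section :: "real \<Rightarrow> real \<Rightarrow> (real \<Rightarrow> 'a tree det_elt) \<Rightarrow> bool"
  where "signed_section t r \<sigma> \<longleftrightarrow> r > 0 \<and>
    (\<forall>u\<in>{0..1} \<inter> ball t r. (u \<noteq> t \<longrightarrow> regular u) \<and> \<sigma> u \<in> vcarrier (line u) \<and> \<sigma> u \<noteq> \<zero>\<^bsub>line u\<^esub> \<and>
      (regular u \<longrightarrow> \<sigma> u \<in> ray (line u) (signed_vector u))) \<and>
    continuous_map (top_of_set ({0..1} \<inter> ball t r)) (det_top X Y) (\<lambda>u. (D u, \<sigma> u))"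

text \<open>Near every parameter, the signed canonical vectors are positive multiples of one continuous,
  nowhere vanishing section: at a degeneration the change of sign of \<open>1 \<otimes> 1\<^sup>*\<close> is compensated by
  that of \<open>passed_sign\<close>.\<close>

lemma signed_section_exists:
  assumes t: "t \<in> {0..1}" shows "\<exists>r \<sigma>. signed_section t r \<sigma>"
proof -
  obtain V0 \<sigma> where V0: "openin (top_of_set {0..1}) V0" "t \<in> V0"
    and \<sigma>: "\<And>u. u \<in> V0 \<Longrightarrow> \<sigma> u \<in> vcarrier (line u)" "\<And>u. u \<in> V0 \<Longrightarrow> \<sigma> u \<noteq> \<zero>\<^bsub>line u\<^esub>"
    and multiples: "\<And>c. continuous_map (top_of_set V0) (det_top X Y) (\<lambda>u. (D u, c \<odot>\<^bsub>line u\<^esub> \<sigma> u))"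
  proof (rule local_section[OF det_line_bundle[OF X Y] D t], goal_cases)
    case (1 V0 \<sigma>)
    show ?case by (rule that[of V0 \<sigma>, OF 1(2-6)])
  qed
  obtain r0 where r0: "r0 > 0" "\<And>u. u \<in> {0..1} \<inter> ball t r0 \<Longrightarrow> u \<noteq> t \<Longrightarrow> regular u"
    using isolated_degenerations by blast
  define V where "V = V0 \<inter> ball t r0"
  have V: "openin (top_of_set {0..1}) V" "t \<in> V"
    using V0 r0(1) by (simp_all add: V_def openin_Int_open)
  have V01: "V \<subseteq> {0..1}" using V(1) openin_imp_subset by blast
  have iso: "regular u" if "u \<in> V" "u \<noteq> t" for u
    using r0(2)[of u] that V01 by (auto simp: V_def)
  have \<sigma>V: "\<sigma> u \<noteq> \<zero>\<^bsub>line u\<^esub>" if "u \<in> V" for u using \<sigma>(2) that by (simp add: V_def)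
  have one: "1 \<odot>\<^bsub>line u\<^esub> \<sigma> u = \<sigma> u" if "u \<in> V0" for u
    using vector_space_real.scale_one[OF line_vs \<sigma>(1)[OF that]] that V0(1) openin_imp_subset by blast
  have multiples_V: "continuous_map (top_of_set W) (det_top X Y) (\<lambda>u. (D u, c \<odot>\<^bsub>line u\<^esub> \<sigma> u))"
    if "W \<subseteq> V" for W c
    using continuous_map_from_subtopology[OF multiples, of W c] that
    by (simp add: V_def subtopology_subtopology inf.absorb2)
  have \<sigma>_cont: "continuous_map (top_of_set V) (det_top X Y) (\<lambda>u. (D u, \<sigma> u))"
    by (rule continuous_map_eq[OF multiples_V[OF order_refl, of 1]]) (use one in \<open>simp add: V_def\<close>)
  \<comment> \<open>The coefficient of \<open>\<sigma>\<close> has a constant sign near a regular \<open>t\<close> and changes it at a degeneration.\<close>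
  obtain r1 a \<kappa> where r1: "r1 > 0" "{0..1} \<inter> ball t r1 \<subseteq> V"
    and a: "\<And>u. u \<in> {0..1} \<inter> ball t r1 \<Longrightarrow> regular u \<Longrightarrow>
      \<sigma> u = a u \<odot>\<^bsub>line u\<^esub> canonical_vector X Y (D u) \<and>
      (if \<not> regular t \<and> t < u then \<kappa> * a u < 0 else \<kappa> * a u > (0::real))"
  proof (cases "regular t")
    case True
    then have all: "regular u" if "u \<in> V" for u using iso[OF that] by blast
    obtain r a \<kappa> where *: "r > 0" "{0..1} \<inter> ball t r \<subseteq> V"
      "\<And>u. u \<in> {0..1} \<inter> ball t r \<Longrightarrow> \<sigma> u = a u \<odot>\<^bsub>line u\<^esub> canonical_vector X Y (D u) \<and> \<kappa> * a u > (0::real)"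
      using sign_near_regular[OF X Y D V \<sigma>_cont \<sigma>V all] by blast
    show thesis by (rule that[OF *(1,2), where a = a and \<kappa> = \<kappa>]) (use True *(3) in simp)
  next
    case False
    obtain r a \<kappa> where *: "r > 0" "{0..1} \<inter> ball t r \<subseteq> V"
      "\<And>u. u \<in> {0..1} \<inter> ball t r \<Longrightarrow> u \<noteq> t \<Longrightarrow>
        \<sigma> u = a u \<odot>\<^bsub>line u\<^esub> canonical_vector X Y (D u) \<and> \<kappa> * a u * (u - t) < (0::real)"
      using sign_change_at_degeneration[OF X Y D V \<sigma>_cont \<sigma>V iso]
        transverse degenerate_iff[OF t] False by blast
    show thesis
    proof (rule that[OF *(1,2)])
      fix u assume u: "u \<in> {0..1} \<inter> ball t r" "regular u"
      then have "u \<noteq> t" using False by blast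
      note facts = *(3)[OF u(1) this]
      then show "\<sigma> u = a u \<odot>\<^bsub>line u\<^esub> canonical_vector X Y (D u) \<and>
          (if \<not> regular t \<and> t < u then \<kappa> * a u < 0 else \<kappa> * a u > 0)"
        using False \<open>u \<noteq> t\<close> by (auto simp: mult_less_0_iff)
    qed
  qed
  have r10: "ball t r1 \<inter> {0..1} \<subseteq> ball t r0" using r1(2) by (auto simp: V_def)
  have isolated: "regular u" if "u \<in> {0..1} \<inter> ball t r1" "u \<noteq> t" for u using iso that r1(2) by blast
  let ?c = "\<kappa> * passed_sign t"
  have \<kappa>: "\<kappa> \<noteq> 0"
  proof -
    have "\<exists>u. u \<in> {0..1} \<inter> ball t r1 \<and> u \<noteq> t"
    proof (cases "t < 1")
      case True
      then show ?thesis using t r1(1)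
        by (intro exI[of _ "min 1 (t + r1 / 2)"]) (auto simp: dist_real_def min_def)
    next
      case False
      then show ?thesis using t r1(1)
        by (intro exI[of _ "max 0 (t - r1 / 2)"]) (auto simp: dist_real_def max_def)
    qed
    then show ?thesis using a isolated by (metis less_irrefl mult_zero_left)
  qed
  have section_u: "?c \<odot>\<^bsub>line u\<^esub> \<sigma> u \<in> vcarrier (line u) \<and> ?c \<odot>\<^bsub>line u\<^esub> \<sigma> u \<noteq> \<zero>\<^bsub>line u\<^esub> \<and>
      (regular u \<longrightarrow> ?c \<odot>\<^bsub>line u\<^esub> \<sigma> u \<in> ray (line u) (signed_vector u))"
    if u: "u \<in> {0..1} \<inter> ball t r1" for u
  proof (intro conjI impI)
    have u01: "u \<in> {0..1}" using u by blast
    interpret vector_space_real "line u" by (rule line_vs[OF u01])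
    have uV0: "u \<in> V0" using r1(2) u by (auto simp: V_def)
    show "?c \<odot>\<^bsub>line u\<^esub> \<sigma> u \<in> vcarrier (line u)" by (rule scale_closed[OF \<sigma>(1)[OF uV0]])
    show "?c \<odot>\<^bsub>line u\<^esub> \<sigma> u \<noteq> \<zero>\<^bsub>line u\<^esub>"
      using scale_eq_zeroD[OF \<sigma>(1)[OF uV0] _ \<sigma>(2)[OF uV0]] \<kappa> passed_sign_nonzero by (metis mult_eq_0_iff)
    assume reg: "regular u"
    let ?v = "canonical_vector X Y (D u)"
    have v: "?v \<in> vcarrier (line u)" by (rule canonical_vector_nonzero[OF X Y reg])
    have pos: "\<kappa> * a u * passed_sign t * passed_sign u > 0"
    proof -
      note passed_sign_near[OF t u isolated]
      then have "\<kappa> * a u * passed_sign t * passed_sign u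
          = (if \<not> regular t \<and> t < u then - (\<kappa> * a u) else \<kappa> * a u) * (passed_sign t * passed_sign t)"
        by simp
      then show ?thesis using a[OF u reg] by (simp add: passed_sign_square split: if_splits)
    qed
    have "?c \<odot>\<^bsub>line u\<^esub> \<sigma> u = (\<kappa> * passed_sign t * a u) \<odot>\<^bsub>line u\<^esub> ?v"
      using a[OF u reg] v by (simp add: scale_scale)
    also have "\<kappa> * passed_sign t * a u = (\<kappa> * a u * passed_sign t * passed_sign u) * passed_sign u"
      using passed_sign_square[of u] by (simp add: mult.assoc)
    also have "\<dots> \<odot>\<^bsub>line u\<^esub> ?v = (\<kappa> * a u * passed_sign t * passed_sign u) \<odot>\<^bsub>line u\<^esub> signed_vector u"
      using v by (simp add: signed_vector_def scale_scale)
    finally show "?c \<odot>\<^bsub>line u\<^esub> \<sigma> u \<in> ray (line u) (signed_vector u)"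
      using pos unfolding ray_def by blast
  qed
  show ?thesis
  proof (intro exI)
    show "signed_section t r1 (\<lambda>u. ?c \<odot>\<^bsub>line u\<^esub> \<sigma> u)"
      unfolding signed_section_def using r1(1) isolated section_u multiples_V[OF r1(2), of ?c] by blast
  qed
qed

lemma openin_ball: "t \<in> {0..1} \<Longrightarrow> openin (top_of_set {0..1}) ({0..1} \<inter> ball t r)"
  for t :: real by (simp add: openin_open_Int)

lemma regular_endpoints: "regular 0" "regular 1"
  using degenerate_iff[of 0] degenerate_iff[of 1] degenerations_interior by auto

lemma canonical_endpoints:
  "ray (line 0) (signed_vector 0) = canonical_orientation (Oper X Y (D 0))"
  "ray (line 1) (signed_vector 1) = canonical_orientation (Oper X Y (D 1)) \<longleftrightarrow>
    even (card (degenerations X Y D))"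
proof -
  interpret L0: vector_space_real "line 0" by (rule line_vs) simp
  interpret L1: vector_space_real "line 1" by (rule line_vs) simp
  note c0 = canonical_vector_nonzero[OF X Y regular_endpoints(1)]
  note c1 = canonical_vector_nonzero[OF X Y regular_endpoints(2)]
  show "ray (line 0) (signed_vector 0) = canonical_orientation (Oper X Y (D 0))"
    using c0 by (simp add: signed_vector_def passed_sign_endpoints L0.scale_one canonical_orientation_def)
  show "ray (line 1) (signed_vector 1) = canonical_orientation (Oper X Y (D 1)) \<longleftrightarrow>
      even (card (degenerations X Y D))"
    using c1 L1.ray_neg[OF c1, of "-1"]
    by (cases "even (card (degenerations X Y D))")
       (simp_all add: signed_vector_def passed_sign_endpoints L1.scale_one canonical_orientation_def)
qed

text \<open>At a degeneration, where there is no canonical vector, the orientation is given by the value of the local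
  section.\<close>

lemma signed_orientation_continuous:
  obtains os where "continuous_orientation (top_of_set {0..1}) D (det_top X Y) line os"
    "os 0 = ray (line 0) (signed_vector 0)" "os 1 = ray (line 1) (signed_vector 1)"
proof -
  obtain r \<sigma> where "\<forall>t\<in>{0..1}. signed_section t (r t) (\<sigma> t)"
    using signed_section_exists by metis
  note r\<sigma> = this[unfolded signed_section_def]
  define os where "os t = (if regular t then ray (line t) (signed_vector t) else ray (line t) (\<sigma> t t))" for t
  have centre: "t \<in> {0..1} \<inter> ball t (r t)" if "t \<in> {0..1}" for t using r\<sigma> that by simp
  have "continuous_orientation (top_of_set {0..1}) D (det_top X Y) line os"
    unfolding continuous_orientation_def
  proof (intro conjI ballI)
    fix t :: real assume "t \<in> topspace (top_of_set {0..1})"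
    then have t: "t \<in> {0..1}" by simp
    show "orientation (line t) (os t)"
    proof (cases "regular t")
      case True
      then show ?thesis unfolding orientation_def using signed_vector[OF t] by (auto simp: os_def)
    next
      case False
      have "\<sigma> t t \<in> vcarrier (line t)" "\<sigma> t t \<noteq> \<zero>\<^bsub>line t\<^esub>" using r\<sigma> t centre[OF t] by blast+
      then show ?thesis unfolding orientation_def os_def using False by (intro bexI[of _ "\<sigma> t t"]) simp_all
    qed
    have "\<sigma> t u \<in> os u" if u: "u \<in> {0..1} \<inter> ball t (r t)" for u
    proof (cases "regular u")
      case True
      then show ?thesis using r\<sigma> t u by (simp add: os_def)
    next
      case False
      then have "u = t" using r\<sigma> t u by blast
      moreover have "\<sigma> t t \<in> ray (line t) (\<sigma> t t)"
        using vector_space_real.mem_ray_self[OF line_vs[OF t]] r\<sigma> t centre[OF t] by blast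
      ultimately show ?thesis using False by (simp add: os_def)
    qed
    moreover have "subtopology (top_of_set {0..1}) ({0..1} \<inter> ball t (r t)) = top_of_set ({0..1} \<inter> ball t (r t))"
      by (rule restrict_top_of_set[OF openin_ball[OF t]])
    ultimately show "\<exists>U s. openin (top_of_set {0..1}) U \<and> t \<in> U \<and>
        continuous_map (subtopology (top_of_set {0..1}) U) (det_top X Y) (\<lambda>u. (D u, s u)) \<and> (\<forall>u\<in>U. s u \<in> os u)"
      using r\<sigma> t centre[OF t] openin_ball[OF t]
      by (intro exI[of _ "{0..1} \<inter> ball t (r t)"] exI[of _ "\<sigma> t"]) auto
  qed
  then show thesis by (rule that) (simp_all add: os_def regular_endpoints)
qed

text \<open>Conversely, comparison with the signed canonical vectors is locally constant along the
  regular parameters, which are dense. So an orientation that starts at the canonical one is the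
  signed one everywhere.\<close>

lemma orientation_is_signed:
  assumes os: "continuous_orientation (top_of_set {0..1}) D (det_top X Y) line os"
    and start: "os 0 = ray (line 0) (signed_vector 0)"
  shows "os 1 = ray (line 1) (signed_vector 1)"
proof (rule connected_induction[of "{0..1::real}" regular "\<lambda>t. os t = ray (line t) (signed_vector t)" 0 1])
  fix T and t :: real assume T: "openin (top_of_set {0..1}) T" "t \<in> T"
  have t: "t \<in> {0..1}" using T openin_imp_subset by blast
  show "\<exists>z. z \<in> T \<and> regular z"
  proof (cases "regular t")
    case False
    then have t': "0 < t" "t < 1" using degenerate_iff[OF t] degenerations_interior by auto
    obtain r where r: "r > 0" "\<And>u. u \<in> {0..1} \<inter> ball t r \<Longrightarrow> u \<noteq> t \<Longrightarrow> regular u"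
      using isolated_degenerations by blast
    obtain r' where r': "r' > 0" "ball t r' \<inter> {0..1} \<subseteq> T" using T unfolding openin_contains_ball by blast
    let ?z = "t + min (min r r') (1 - t) / 2"
    have "?z \<in> {0..1} \<inter> ball t r" "?z \<in> ball t r' \<inter> {0..1}" "?z \<noteq> t"
      using t' r(1) r'(1) by (auto simp: dist_real_def min_def field_simps)
    then show ?thesis using r(2) r'(2) by blast
  qed (use T in blast)
next
  fix t :: real assume t: "t \<in> {0..1}"
  obtain r \<sigma> where "signed_section t r \<sigma>" using signed_section_exists[OF t] by blast
  then have r: "r > 0"
    and \<sigma>: "\<And>u. u \<in> {0..1} \<inter> ball t r \<Longrightarrow> \<sigma> u \<in> vcarrier (line u)"
      "\<And>u. u \<in> {0..1} \<inter> ball t r \<Longrightarrow> \<sigma> u \<noteq> \<zero>\<^bsub>line u\<^esub>"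
    and \<sigma>_cont: "continuous_map (top_of_set ({0..1} \<inter> ball t r)) (det_top X Y) (\<lambda>u. (D u, \<sigma> u))"
    and \<sigma>_ray: "\<And>u. u \<in> {0..1} \<inter> ball t r \<Longrightarrow> regular u \<Longrightarrow> \<sigma> u \<in> ray (line u) (signed_vector u)"
    unfolding signed_section_def by blast+
  have "\<exists>U s. openin (top_of_set {0..1}) U \<and> t \<in> U \<and>
      continuous_map (subtopology (top_of_set {0..1}) U) (det_top X Y) (\<lambda>u. (D u, s u)) \<and> (\<forall>u\<in>U. s u \<in> os u)"
    using os[unfolded continuous_orientation_def, THEN conjunct2, rule_format, of t] t by simp
  then obtain U s where U: "openin (top_of_set {0..1}) U" "t \<in> U"
    and s: "continuous_map (subtopology (top_of_set {0..1}) U) (det_top X Y) (\<lambda>u. (D u, s u))"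
    and s_os: "\<And>u. u \<in> U \<Longrightarrow> s u \<in> os u"
    by blast
  have orient: "orientation (line u) (os u)" if "u \<in> {0..1}" for u
    using os that unfolding continuous_orientation_def by simp
  define A where "A = {0..1} \<inter> ball t r \<inter> U"
  have A: "openin (top_of_set {0..1}) A" "t \<in> A"
    unfolding A_def using openin_Int[OF openin_ball[OF t] U(1)] t r U(2) by auto
  have A01: "A \<subseteq> {0..1}" by (auto simp: A_def)
  have \<sigma>A: "continuous_map (top_of_set A) (det_top X Y) (\<lambda>u. (D u, \<sigma> u))"
    using continuous_map_from_subtopology[OF \<sigma>_cont, of A] by (simp add: A_def subtopology_subtopology inf.absorb2)
  have sA: "continuous_map (top_of_set A) (det_top X Y) (\<lambda>u. (D u, s u))"
  proof -
    have "{0..1} \<inter> U \<inter> A = A" by (auto simp: A_def)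
    then show ?thesis
      using continuous_map_from_subtopology[OF s, of A] by (simp only: subtopology_subtopology)
  qed
  obtain V k where V: "openin (top_of_set A) V" "t \<in> V" "continuous_on V k"
    and k: "\<And>u. u \<in> V \<Longrightarrow> s u = k u \<odot>\<^bsub>line u\<^esub> \<sigma> u"
    using section_ratio[OF det_line_bundle[OF X Y] A(2) \<sigma>A _ sA] \<sigma>(2) A(2) unfolding A_def by blast
  have VA: "V \<subseteq> A" using V(1) openin_imp_subset by blast
  have s_ray: "os u = ray (line u) (s u)" if "u \<in> A" for u
    using vector_space_real.orientation_eq_ray[OF line_vs orient s_os] that A01 by (auto simp: A_def)
  have k_nz: "k u \<noteq> 0" if "u \<in> V" for u
  proof
    assume "k u = 0"
    have u: "u \<in> {0..1}" "u \<in> {0..1} \<inter> ball t r" using that VA by (auto simp: A_def)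
    interpret vector_space_real "line u" by (rule line_vs[OF u(1)])
    have "s u = \<zero>\<^bsub>line u\<^esub>" using k[OF that] \<open>k u = 0\<close> \<sigma>(1)[OF u(2)] by (simp add: scale_zero)
    moreover obtain v where v: "v \<in> vcarrier (line u)" "v \<noteq> \<zero>\<^bsub>line u\<^esub>" "os u = ray (line u) v"
      using orient[OF u(1)] unfolding orientation_def by blast
    moreover have "s u \<in> os u" using s_os that VA by (auto simp: A_def)
    ultimately obtain c where "c > 0" "c \<odot>\<^bsub>line u\<^esub> v = \<zero>\<^bsub>line u\<^esub>" by (auto simp: ray_def)
    then show False using scale_eq_zeroD[OF v(1) _ v(2)] by fastforce
  qed
  have V_open: "openin (top_of_set {0..1}) V" using V(1) A(1) openin_trans by blast
  obtain r' where r': "r' > 0" "{0..1} \<inter> ball t r' \<subseteq> V"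
    "\<And>u. u \<in> {0..1} \<inter> ball t r' \<Longrightarrow> k u * k t > 0"
    using constant_sign_near[OF V_open V(2,3) k_nz[OF V(2)]] by blast
  have same: "os u = ray (line u) (signed_vector u) \<longleftrightarrow> k t > 0"
    if u: "u \<in> {0..1} \<inter> ball t r'" "regular u" for u
  proof -
    have uV: "u \<in> V" using r'(2) u(1) by blast
    have uA: "u \<in> {0..1}" "u \<in> {0..1} \<inter> ball t r" "u \<in> A" using uV VA by (auto simp: A_def)
    interpret vector_space_real "line u" by (rule line_vs[OF uA(1)])
    note w = signed_vector[OF uA(1) u(2)]
    have "os u = ray (line u) (k u \<odot>\<^bsub>line u\<^esub> \<sigma> u)" using s_ray[OF uA(3)] k[OF uV] by simp
    moreover have "ray (line u) (\<sigma> u) = ray (line u) (signed_vector u)"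
      by (rule ray_eq[OF w(1) \<sigma>_ray[OF uA(2) u(2)]])
    moreover have "k u > 0 \<longleftrightarrow> k t > 0" using r'(3)[OF u(1)] by (auto simp: zero_less_mult_iff)
    ultimately show ?thesis
      using ray_scale[OF \<sigma>(1)[OF uA(2)], of "k u"] ray_neg[OF \<sigma>[OF uA(2)], of "k u"] k_nz[OF uV]
      by (metis linorder_neqE_linordered_idom)
  qed
  show "\<exists>T. openin (top_of_set {0..1}) T \<and> t \<in> T \<and> (\<forall>x\<in>T. \<forall>y\<in>T. regular x \<and> regular y \<and>
      os x = ray (line x) (signed_vector x) \<longrightarrow> os y = ray (line y) (signed_vector y))"
    using openin_ball[OF t, of r'] same t r'(1) by (intro exI[of _ "{0..1} \<inter> ball t r'"]) auto
qed (use start regular_endpoints in auto)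

end

theorem proposition5p9:
  fixes det_top :: "'a tree nspace \<Rightarrow> 'a tree nspace \<Rightarrow>
      (('a tree \<Rightarrow> 'a tree) \<times> 'a tree det_elt) topology"
    and \<Psi> :: "'a tree triple \<Rightarrow> 'a tree det2_elt \<Rightarrow> 'a tree det_elt"
    and X Y :: "'a tree nspace"
    and D :: "real \<Rightarrow> 'a tree \<Rightarrow> 'a tree"
  assumes "admissible_system det_top \<Psi>"
    and "banach_space X" and "banach_space Y"
    and "continuous_map (top_of_set {0..1}) (fredholm_top X Y) D"
    and "finite (degenerations X Y D)" and "degenerations X Y D \<subseteq> {0<..<1}"
    and "\<forall>t\<in>degenerations X Y D. transverse_at X Y D t"
  shows "(\<exists>os. continuous_orientation (top_of_set {0..1}) D (det_top X Y)
              (\<lambda>t. det_line (Oper X Y (D t))) os \<and>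
            os 0 = canonical_orientation (Oper X Y (D 0)) \<and>
            os 1 = canonical_orientation (Oper X Y (D 1)))
         \<longleftrightarrow> even (card (degenerations X Y D))"
proof -
  interpret transverse_path det_top \<Psi> X Y D
    by (intro transverse_path.intro transverse_path_axioms.intro) (use assms in auto)
  show ?thesis
    using signed_orientation_continuous orientation_is_signed canonical_endpoints by metis
qed

end
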